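(* As $n\to\infty$, \[ g_{1,1}(n)\sim g_{1,2}(n)\sim \frac{\log(\sqrt2+1)}{2^{5/4}\pi} n^{-1/4}e^{\frac{\pi}{2}\sqrt n}. \]
   Context: A partition $\lambda=(\lambda_1\ge \lambda_2\ge\cdots\ge\lambda_k)$ of $n$ is a weakly decreasing sequence of positive integers summing to $n$; its conjugate is $\lambda'$ with $\lambda'_j=\#\{i:\lambda_i\ge j\}$. For the cell in row $i$ and column $j$ of the Young diagram of $\lambda$, its hook length is $h(i,j)=\lambda_i+\lambda'_j-i-j+1$. A $t$-hook is a cell with hook length $t$. For a positive integer $t$, $g_{1,t}(n)$ denotes the total number of $t$-hooks, summed over all partitions of $n$ such that consecutive parts differ by at least $2$ and, whenever $\lambda_i$ is odd, $\lambda_i-\lambda_{i+1}>2$ (i.e. parts differ by at least 2 and no two odd parts differ by exactly 2). *)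

theory Defs
  imports "HOL-Analysis.Analysis" "HOL-Library.Landau_Symbols"
begin

definition is_partition :: "nat \<Rightarrow> nat list \<Rightarrow> bool" where
  "is_partition n xs \<longleftrightarrow> sorted_wrt (\<ge>) xs \<and> (\<forall>x\<in>set xs. 0 < x) \<and> sum_list xs = n"

text \<open>Rows and columns are numbered from 1, so the part in row \<open>i\<close> is \<open>xs ! (i - 1)\<close>.\<close>

definition part :: "nat list \<Rightarrow> nat \<Rightarrow> nat" where
  "part xs i = xs ! (i - 1)"

definition conj_part :: "nat list \<Rightarrow> nat \<Rightarrow> nat" where
  "conj_part xs j = card {i \<in> {1..length xs}. j \<le> part xs i}"

definition young_cells :: "nat list \<Rightarrow> (nat \<times> nat) set" where
  "young_cells xs = (SIGMA i:{1..length xs}. {1..part xs i})"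

definition hook_length :: "nat list \<Rightarrow> nat \<Rightarrow> nat \<Rightarrow> int" where
  "hook_length xs i j = int (part xs i) + int (conj_part xs j) - int i - int j + 1"

definition hook_count :: "nat \<Rightarrow> nat list \<Rightarrow> nat" where
  "hook_count t xs = card {(i, j) \<in> young_cells xs. hook_length xs i j = int t}"

text \<open>The gap conditions are imposed only between two actual parts: no part of size 0 is
  appended, so the smallest part may be 1.\<close>

definition gap_partitions :: "nat \<Rightarrow> nat list set" where
  "gap_partitions n = {xs. is_partition n xs \<and>
     (\<forall>i\<in>{1..<length xs}. part xs (i + 1) + 2 \<le> part xs i \<and>
        (odd (part xs i) \<longrightarrow> part xs (i + 1) + 2 < part xs i))}"

definition g1 :: "nat \<Rightarrow> nat \<Rightarrow> nat" where
  "g1 t n = (\<Sum>xs\<in>gap_partitions n. hook_count t xs)"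

lemma finite_gap_partitions: "finite (gap_partitions n)"
proof (rule finite_subset)
  have len: "length xs \<le> sum_list xs" if "\<forall>x\<in>set xs. 0 < x" for xs :: "nat list"
    using that by (induction xs) auto
  show "gap_partitions n \<subseteq> {xs. set xs \<subseteq> {..n} \<and> length xs \<le> n}"
    using len by (auto simp: gap_partitions_def is_partition_def dest: member_le_sum_list)
  show "finite {xs :: nat list. set xs \<subseteq> {..n} \<and> length xs \<le> n}"
    by (rule finite_lists_length_le) simp
qed

end

(*
The 1-hooks of such a partition are in bijection with its parts, and the 2-hooks with its parts
different from 1, so both counts equal the total number A(n) of parts up to an error of at most
the number p(n) of partitions. Subtracting 2 from every part shows that the partitions with k
parts have the generating function
  w_k(q) = prod_{j=1}^k q^(2j) (1 + q^(2j-3)) / (1 - q^(2j)),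
and Lebesgue's identity turns the sum F(q) of the w_k(q) into the product of all 1 + q^m with m
congruent to 0, 1 or 2 modulo 4 (the little Goellnitz identity). With q = exp(-z), expanding log F
as a Lambert series gives log F = pi^2/(16 z) - (log 2)/4 + o(1) in a sector, and a saddle point
argument at t = pi/(4 sqrt n) yields p(n). Under the weights w_k(exp(-t)) the ratio
w_(k+1)/w_k is close to x(1+x)/(1-x) with x = exp(-2kt), which crosses 1 at x = sqrt 2 - 1. Hence the
number of parts is exponentially concentrated around log(1 + sqrt 2)/(2t); as the weight of the
size n is only polynomially small, A(n) is asymptotic to p(n) log(1 + sqrt 2)/(2t).
*)
theory Submission
  imports Defs "HOL-Complex_Analysis.Complex_Analysis" "HOL-Real_Asymp.Real_Asymp" "HOL-Probability.Sinc_Integral"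
begin

subsection \<open>Reduction to numbers of parts\<close>

text \<open>The product formula counts the partitions without recording their lengths, so the saddle
  point argument is applied to it alone, and the mean length is recovered from the k-part weights,
  which are explicit for every k. What links the two is a local limit theorem: the partitions of n
  carry a share of order t^(3/2) of F(exp(-t)), whereas untypical lengths carry at most exp(-c/t).
  In the Fourier integral the angle is scaled as t^(3/2) u, because the second derivative of
  pi^2/(16 z) is of order t^(-3). Dominated convergence then asks only for the pointwise behaviour
  of log F in a sector, without error terms, at the price of one integrable majorant valid on the
  whole circle. The obstacle to this majorant is the angle pi, at which all factors 1 + q^m with m
  even are as large as at angle 0. The stationary point of n t + pi^2/(16 t) gives t, and the two
  summands are equal there.\<close>

definition gap_rel :: "nat \<Rightarrow> nat \<Rightarrow> bool" where
  "gap_rel x y \<longleftrightarrow> y + 2 \<le> x \<and> (odd x \<longrightarrow> y + 2 < x)"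

definition gap_lists :: "nat \<Rightarrow> nat \<Rightarrow> nat list set" where
  "gap_lists m k = {xs. length xs = k \<and> sorted_wrt gap_rel xs \<and> (\<forall>x\<in>set xs. m < x)}"

text \<open>Two gaps add up to at least 4, so the parity clause is automatic for parts that are not
  neighbours. Hence \<open>sorted_wrt\<close>, which compares all pairs, can express a condition on
  neighbours.\<close>

lemma transp_gap_rel: "transp gap_rel"
  by (auto simp: transp_def gap_rel_def)

lemma gap_partitions_eq:
  "gap_partitions n = {xs. sorted_wrt gap_rel xs \<and> (\<forall>x\<in>set xs. 0 < x) \<and> sum_list xs = n}"
proof -
  have "(\<forall>i\<in>{1..<length xs}. part xs (i + 1) + 2 \<le> part xs i \<and>
        (odd (part xs i) \<longrightarrow> part xs (i + 1) + 2 < part xs i)) \<longleftrightarrow> sorted_wrt gap_rel xs" for xs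
  proof -
    have "(\<forall>i\<in>{1..<length xs}. part xs (i + 1) + 2 \<le> part xs i \<and>
        (odd (part xs i) \<longrightarrow> part xs (i + 1) + 2 < part xs i)) \<longleftrightarrow>
        (\<forall>i\<in>Suc ` {0..<length xs - 1}. gap_rel (xs ! (i - 1)) (xs ! i))"
      by (intro ball_cong) (auto simp: gap_rel_def part_def image_Suc_atLeastLessThan)
    also have "\<dots> \<longleftrightarrow> sorted_wrt gap_rel xs"
      unfolding sorted_wrt_iff_nth_Suc_transp[OF transp_gap_rel] ball_simps by auto
    finally show ?thesis .
  qed
  moreover have "sorted_wrt (\<ge>) xs" if "sorted_wrt gap_rel xs" for xs
    using that by (rule sorted_wrt_mono_rel[rotated]) (auto simp: gap_rel_def)
  ultimately show ?thesis
    by (auto simp: gap_partitions_def is_partition_def)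
qed

lemma nth_antimono_gap:
  assumes "sorted_wrt gap_rel xs" "i < j" "j < length xs"
  shows "xs ! j + 2 \<le> xs ! i"
  using sorted_wrt_nth_less[OF assms] by (simp add: gap_rel_def)

text \<open>The rows above row i are longer, so column j reaches down to row i at least. If the cell
  is one of the last two of its row, the next row is too short by the gap of 2, and the leg is
  empty.\<close>

lemma conj_part_gap:
  assumes "sorted_wrt gap_rel xs" "i \<in> {1..length xs}" "1 \<le> j" "j \<le> part xs i"
  shows "conj_part xs j \<ge> i" and "part xs i \<le> j + 1 \<Longrightarrow> conj_part xs j = i"
proof -
  have sub: "{1..i} \<subseteq> {i \<in> {1..length xs}. j \<le> part xs i}"
  proof
    fix l assume l: "l \<in> {1..i}"
    have "part xs i \<le> part xs l"
    proof (cases "l = i")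
      case False
      then have "l - 1 < i - 1" "i - 1 < length xs" using l assms(2) by auto
      from nth_antimono_gap[OF assms(1) this] show ?thesis by (simp add: part_def)
    qed simp
    then show "l \<in> {i \<in> {1..length xs}. j \<le> part xs i}" using l assms by auto
  qed
  then have "card {1..i} \<le> conj_part xs j"
    unfolding conj_part_def by (intro card_mono) auto
  then show "conj_part xs j \<ge> i" by simp
  assume *: "part xs i \<le> j + 1"
  have "{i \<in> {1..length xs}. j \<le> part xs i} \<subseteq> {1..i}"
  proof (intro subsetI, rule ccontr)
    fix l assume l: "l \<in> {i \<in> {1..length xs}. j \<le> part xs i}" "l \<notin> {1..i}"
    then have "part xs l + 2 \<le> part xs i"
      using nth_antimono_gap[OF assms(1), of "i - 1" "l - 1"] assms(2) by (auto simp: part_def)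
    with l * show False by auto
  qed
  with sub have "{i \<in> {1..length xs}. j \<le> part xs i} = {1..i}" by blast
  then show "conj_part xs j = i" by (simp add: conj_part_def)
qed

text \<open>Legs are nonnegative, so a hook of length at most 2 starts in one of the last two cells
  of its row, where the leg is empty; it is therefore horizontal. The second to last cell exists
  unless the part is 1, and only the smallest part can be 1.\<close>

lemma hook_count_gap:
  assumes xs: "sorted_wrt gap_rel xs" "\<forall>x\<in>set xs. 0 < x"
  shows "hook_count 1 xs = length xs"
    and "hook_count 2 xs \<le> length xs" and "length xs \<le> hook_count 2 xs + 1"
proof -
  have pos: "0 < part xs i" if "i \<in> {1..length xs}" for i
    using xs(2) that by (auto simp: part_def)
  have "{(i, j) \<in> young_cells xs. hook_length xs i j = int 1} = (\<lambda>i. (i, part xs i)) ` {1..length xs}"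
    using conj_part_gap[OF xs(1)] pos
    by (force simp: young_cells_def hook_length_def image_iff)
  moreover have inj: "inj_on (\<lambda>i. (i, f i)) A" for f :: "nat \<Rightarrow> nat" and A
    by (auto simp: inj_on_def)
  ultimately show "hook_count 1 xs = length xs"
    by (simp add: hook_count_def card_image)
  have eq: "{(i, j) \<in> young_cells xs. hook_length xs i j = int 2} =
      (\<lambda>i. (i, part xs i - 1)) ` {i\<in>{1..length xs}. 2 \<le> part xs i}" (is "?A = ?B")
  proof safe
    fix i j assume *: "(i, j) \<in> young_cells xs" "hook_length xs i j = int 2"
    then have ij: "i \<in> {1..length xs}" "1 \<le> j" "j \<le> part xs i"
      by (auto simp: young_cells_def)
    from conj_part_gap[OF xs(1) ij] *(2) have c: "conj_part xs j = i"
      by (auto simp: hook_length_def)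
    with *(2) ij have "part xs i = j + 1" by (simp add: hook_length_def)
    with ij show "(i, j) \<in> ?B" by (auto intro!: rev_image_eqI[of i])
  next
    fix i assume "i \<in> {1..length xs}" "2 \<le> part xs i"
    then show "(i, part xs i - 1) \<in> young_cells xs" "hook_length xs i (part xs i - 1) = int 2"
      using conj_part_gap(2)[OF xs(1), of i "part xs i - 1"]
      by (auto simp: young_cells_def hook_length_def of_nat_diff)
  qed
  have hc: "hook_count 2 xs = card {i\<in>{1..length xs}. 2 \<le> part xs i}"
    unfolding hook_count_def eq by (simp add: card_image inj)
  have "card {i\<in>{1..length xs}. 2 \<le> part xs i} \<le> card {1..length xs}"
    by (intro card_mono) auto
  then show "hook_count 2 xs \<le> length xs" using hc by simp
  have "{1..<length xs} \<subseteq> {i\<in>{1..length xs}. 2 \<le> part xs i}"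
  proof
    fix i assume i: "i \<in> {1..<length xs}"
    then have "part xs (length xs) + 2 \<le> part xs i"
      using nth_antimono_gap[OF xs(1), of "i - 1" "length xs - 1"] by (auto simp: part_def)
    with i show "i \<in> {i\<in>{1..length xs}. 2 \<le> part xs i}" by auto
  qed
  then have "card {1..<length xs} \<le> hook_count 2 xs"
    unfolding hc by (intro card_mono) auto
  then show "length xs \<le> hook_count 2 xs + 1" by simp
qed

lemma g1_1_eq: "g1 1 n = (\<Sum>xs\<in>gap_partitions n. length xs)"
  unfolding g1_def by (intro sum.cong refl) (use hook_count_gap(1) in \<open>auto simp: gap_partitions_eq\<close>)

lemma g1_2_bounds: "g1 2 n \<le> g1 1 n" "g1 1 n \<le> g1 2 n + card (gap_partitions n)"
proof -
  show "g1 2 n \<le> g1 1 n"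
    unfolding g1_1_eq unfolding g1_def
    by (intro sum_mono) (use hook_count_gap(2) in \<open>auto simp: gap_partitions_eq\<close>)
  have "g1 1 n \<le> (\<Sum>xs\<in>gap_partitions n. hook_count 2 xs + 1)"
    unfolding g1_1_eq
    by (intro sum_mono) (use hook_count_gap(3) in \<open>auto simp: gap_partitions_eq\<close>)
  then show "g1 1 n \<le> g1 2 n + card (gap_partitions n)"
    by (simp add: g1_def sum.distrib del: add_Suc_right)
qed

text \<open>Removing a last part 1 or 2 leaves parts that are at least 4 in both cases: 3 is excluded
  above 1 by the parity condition. Shifting by 2 then gives parts larger than 1, which is why lower
  bounds other than 0 are needed.\<close>

lemma gap_lists_shift: "gap_lists (m + 2) k = map (\<lambda>x. x + 2) ` gap_lists m k"
proof (intro equalityI subsetI)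
  fix xs assume xs: "xs \<in> gap_lists (m + 2) k"
  let ?ys = "map (\<lambda>x. x - 2) xs"
  have ge: "\<forall>x\<in>set xs. m + 2 < x" using xs by (simp add: gap_lists_def)
  have "sorted_wrt gap_rel ?ys"
    unfolding sorted_wrt_map
  proof (rule sorted_wrt_mono_rel[of _ gap_rel])
    fix x y assume "x \<in> set xs" "y \<in> set xs" "gap_rel x y"
    then show "gap_rel (x - 2) (y - 2)" using ge by (force simp: gap_rel_def)
  qed (use xs in \<open>simp add: gap_lists_def\<close>)
  then have "?ys \<in> gap_lists m k" using xs by (force simp: gap_lists_def)
  moreover have "xs = map (\<lambda>x. x + 2) ?ys"
    using ge by (auto simp: o_def intro!: map_idI[symmetric] dest!: bspec)
  ultimately show "xs \<in> map (\<lambda>x. x + 2) ` gap_lists m k" by blast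
next
  have "gap_rel (x + 2) (y + 2) = gap_rel x y" for x y by (simp add: gap_rel_def)
  then show "xs \<in> gap_lists (m + 2) k" if "xs \<in> map (\<lambda>x. x + 2) ` gap_lists m k" for xs
    using that by (auto simp: gap_lists_def sorted_wrt_map)
qed

lemma gap_lists_snoc_subset:
  assumes "c \<in> {1, 2}" "m < c"
  shows "(\<lambda>xs. xs @ [c]) ` gap_lists 3 k \<subseteq> gap_lists m (Suc k)"
proof -
  have "gap_rel x c" "m < x" if "3 < x" for x using that assms by (cases "x = 4", auto simp: gap_rel_def)
  with assms(2) show ?thesis by (auto simp: gap_lists_def sorted_wrt_append)
qed

lemma gap_lists_snoc_cases:
  assumes "xs \<in> gap_lists m (Suc k)"
  shows "xs \<in> gap_lists 2 (Suc k) \<or> xs \<in> (\<lambda>xs. xs @ [1]) ` gap_lists 3 k \<and> m = 0 \<or>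
    xs \<in> (\<lambda>xs. xs @ [2]) ` gap_lists 3 k"
proof -
  from assms have "xs \<noteq> []" by (auto simp: gap_lists_def)
  then obtain ys c where xs: "xs = ys @ [c]" by (metis rev_exhaust)
  have *: "length ys = k" "sorted_wrt gap_rel ys" "\<forall>y\<in>set ys. gap_rel y c" "m < c"
    using assms by (auto simp: gap_lists_def xs sorted_wrt_append)
  consider "c \<ge> 3" | "c = 1" | "c = 2" using *(4) by linarith
  then show ?thesis
  proof cases
    case 1
    then have "xs \<in> gap_lists 2 (Suc k)"
      using * assms by (auto simp: gap_lists_def xs sorted_wrt_append gap_rel_def)
    then show ?thesis ..
  next
    case 2
    then have "y > 3" if "y \<in> set ys" for y
      using *(3) that by (cases "y = 3") (force simp: gap_rel_def)+
    then have "ys \<in> gap_lists 3 k" using * by (auto simp: gap_lists_def)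
    with 2 xs *(4) show ?thesis by blast
  next
    case 3
    then have "ys \<in> gap_lists 3 k" using * by (force simp: gap_lists_def gap_rel_def)
    with 3 xs show ?thesis by blast
  qed
qed

lemma gap_lists_mono: "l \<le> m \<Longrightarrow> gap_lists m k \<subseteq> gap_lists l k"
  by (auto simp: gap_lists_def)

lemma gap_lists_0_Suc:
  "gap_lists 0 (Suc k) = gap_lists 2 (Suc k) \<union>
     ((\<lambda>xs. xs @ [1]) ` gap_lists 3 k \<union> (\<lambda>xs. xs @ [2]) ` gap_lists 3 k)"
  (is "_ = ?A \<union> (?B \<union> ?C)")
proof -
  have "xs \<in> ?A \<or> xs \<in> ?B \<or> xs \<in> ?C" if "xs \<in> gap_lists 0 (Suc k)" for xs
    using gap_lists_snoc_cases[OF that] by blast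
  moreover have "?A \<subseteq> gap_lists 0 (Suc k)" by (rule gap_lists_mono) simp
  moreover have "?B \<subseteq> gap_lists 0 (Suc k)" "?C \<subseteq> gap_lists 0 (Suc k)"
    by (rule gap_lists_snoc_subset; simp)+
  ultimately show ?thesis by blast
qed

lemma gap_lists_1_Suc:
  "gap_lists 1 (Suc k) = gap_lists 2 (Suc k) \<union> (\<lambda>xs. xs @ [2]) ` gap_lists 3 k"
proof -
  have "xs \<in> gap_lists 2 (Suc k) \<or> xs \<in> (\<lambda>xs. xs @ [2]) ` gap_lists 3 k" if "xs \<in> gap_lists 1 (Suc k)" for xs
    using gap_lists_snoc_cases[OF that] by auto
  moreover have "gap_lists 2 (Suc k) \<subseteq> gap_lists 1 (Suc k)" by (rule gap_lists_mono) simp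
  ultimately show ?thesis using gap_lists_snoc_subset[of 2 1 k] by auto
qed

text \<open>The field is left general because the series serves twice: at complex q in the Fourier
  integral and at real q as a weight on the numbers of parts.\<close>

definition gap_gf :: "'a::{real_normed_field,banach} \<Rightarrow> nat \<Rightarrow> nat \<Rightarrow> 'a" where
  "gap_gf q m k = (\<Sum>\<^sub>\<infinity>xs\<in>gap_lists m k. q ^ sum_list xs)"

text \<open>Forgetting every condition but the length leaves a k-fold product of geometric series, a
  majorant for all \<open>gap_gf\<close>.\<close>

lemma summable_lists_length:
  assumes "0 \<le> r" "r < (1::real)"
  shows "(\<lambda>xs. r ^ sum_list xs) summable_on {xs. length xs = k}"
proof (induction k)
  case (Suc k)
  have bij: "bij_betw (\<lambda>(x, xs). x # xs) (UNIV \<times> {xs. length xs = k}) {xs. length xs = Suc k}"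
    by (rule bij_betwI[of _ _ _ "\<lambda>xs. (hd xs, tl xs)"]) (auto simp: length_Suc_conv)
  have "(\<lambda>(x, xs). r ^ x * r ^ sum_list xs) summable_on UNIV \<times> {xs. length xs = k}"
  proof (rule summable_on_SigmaI)
    show "((\<lambda>xs. case (x, xs) of (x, xs) \<Rightarrow> r ^ x * r ^ sum_list xs) has_sum
      (r ^ x * (\<Sum>\<^sub>\<infinity>xs\<in>{xs. length xs = k}. r ^ sum_list xs))) {xs. length xs = k}" for x
      using Suc.IH by (simp add: has_sum_cmult_right)
    have "(\<lambda>x. r ^ x) summable_on UNIV"
      using assms by (intro summable_nonneg_imp_summable_on summable_geometric) auto
    then show "(\<lambda>x. r ^ x * (\<Sum>\<^sub>\<infinity>xs\<in>{xs. length xs = k}. r ^ sum_list xs)) summable_on UNIV"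
      by (rule summable_on_cmult_left)
  qed (use assms in auto)
  then show ?case
    by (subst summable_on_reindex_bij_betw[OF bij, symmetric]) (simp add: case_prod_unfold power_add)
qed auto

context
  fixes q :: "'a::{real_normed_field,banach}"
  assumes q: "norm q < 1"
begin

lemma summable_gap_lists: "(\<lambda>xs. q ^ sum_list xs) summable_on gap_lists m k"
proof (rule abs_summable_summable)
  show "(\<lambda>xs. norm (q ^ sum_list xs)) summable_on gap_lists m k"
    using q by (auto simp: norm_power gap_lists_def intro!: summable_on_subset_banach[OF summable_lists_length[of "norm q" k]])
qed

lemma gap_gf_shift: "gap_gf q (m + 2) k = q ^ (2 * k) * gap_gf q m k"
proof -
  have injs: "inj_on (map (\<lambda>x. x + 2)) (gap_lists m k)"
    by (rule inj_on_mapI) (simp add: inj_on_def)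
  have "gap_gf q (m + 2) k = (\<Sum>\<^sub>\<infinity>xs\<in>gap_lists m k. q ^ sum_list (map (\<lambda>x. x + 2) xs))"
    unfolding gap_gf_def gap_lists_shift
    by (subst infsum_reindex[OF injs]) (simp add: o_def)
  also have "\<dots> = (\<Sum>\<^sub>\<infinity>xs\<in>gap_lists m k. q ^ (2 * k) * q ^ sum_list xs)"
    by (intro infsum_cong) (auto simp: sum_list_addf sum_list_triv gap_lists_def power_add mult.commute simp del: add_2_eq_Suc')
  also have "\<dots> = q ^ (2 * k) * gap_gf q m k"
    by (simp add: infsum_cmult_right' gap_gf_def)
  finally show ?thesis .
qed

lemma has_sum_gap_snoc:
  "((\<lambda>xs. q ^ sum_list xs) has_sum (q ^ c * (q ^ (2 * k) * gap_gf q 1 k))) ((\<lambda>xs. xs @ [c]) ` gap_lists 3 k)"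
proof -
  have "((\<lambda>xs. q ^ sum_list xs) has_sum gap_gf q 3 k) (gap_lists 3 k)"
    unfolding gap_gf_def by (rule has_sum_infsum[OF summable_gap_lists])
  then have "((\<lambda>xs. q ^ c * q ^ sum_list xs) has_sum (q ^ c * gap_gf q 3 k)) (gap_lists 3 k)"
    by (rule has_sum_cmult_right)
  then show ?thesis
    using gap_gf_shift[of 1 k]
    by (subst has_sum_reindex) (simp_all add: o_def power_add mult.commute inj_on_def numeral_3_eq_3)
qed

lemma has_sum_gap_lists: "((\<lambda>xs. q ^ sum_list xs) has_sum gap_gf q m k) (gap_lists m k)"
  unfolding gap_gf_def by (rule has_sum_infsum[OF summable_gap_lists])

text \<open>The lower bounds 0 and 1 form a closed system: splitting off a last part 1 or 2 leads to
  bound 3, keeping all parts above 2 leads to bound 2, and the shift by 2 brings these back to 1 and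
  0.\<close>

lemma gap_gf_1_Suc:
  "gap_gf q 1 (Suc k) = q ^ (2 * k + 2) * gap_gf q 0 (Suc k) + q ^ (2 * k + 2) * gap_gf q 1 k"
proof -
  have "((\<lambda>xs. q ^ sum_list xs) has_sum
     (gap_gf q 2 (Suc k) + q ^ 2 * (q ^ (2 * k) * gap_gf q 1 k))) (gap_lists 1 (Suc k))"
    unfolding gap_lists_1_Suc
    by (intro has_sum_Un_disjoint has_sum_gap_lists has_sum_gap_snoc) (auto simp: gap_lists_def)
  then have "gap_gf q 1 (Suc k) = gap_gf q 2 (Suc k) + q ^ 2 * (q ^ (2 * k) * gap_gf q 1 k)"
    using has_sum_gap_lists has_sum_unique by blast
  then show ?thesis using gap_gf_shift[of 0 "Suc k"] by (simp add: numeral_2_eq_2 mult.assoc)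
qed

text \<open>The lists without parts 1 and 2 reproduce the unknown itself with the factor q^(2k+2).
  Solving for it is what creates the denominators 1 - q^(2k+2).\<close>

lemma gap_gf_0_Suc:
  "gap_gf q 0 (Suc k) = q ^ (2 * k + 2) * gap_gf q 0 (Suc k) + (q + q ^ 2) * q ^ (2 * k) * gap_gf q 1 k"
proof -
  have "((\<lambda>xs. q ^ sum_list xs) has_sum
     (gap_gf q 2 (Suc k) + (q ^ 1 * (q ^ (2 * k) * gap_gf q 1 k) + q ^ 2 * (q ^ (2 * k) * gap_gf q 1 k))))
       (gap_lists 0 (Suc k))"
    unfolding gap_lists_0_Suc
    by (intro has_sum_Un_disjoint has_sum_gap_lists has_sum_gap_snoc) (auto simp: gap_lists_def)
  then have "gap_gf q 0 (Suc k) = gap_gf q 2 (Suc k) +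
     (q ^ 1 * (q ^ (2 * k) * gap_gf q 1 k) + q ^ 2 * (q ^ (2 * k) * gap_gf q 1 k))"
    using has_sum_gap_lists has_sum_unique by blast
  then show ?thesis using gap_gf_shift[of 0 "Suc k"] by (simp add: numeral_2_eq_2 algebra_simps)
qed

end

lemma power_neq_1:
  fixes q :: "'a::real_normed_field"
  assumes "norm q < 1" "0 < k"
  shows "q ^ k \<noteq> 1"
proof
  assume "q ^ k = 1"
  then have "norm q ^ k = 1" by (metis norm_one norm_power)
  moreover have "norm q ^ k < 1" using assms by (simp add: power_less_one_iff)
  ultimately show False by simp
qed

text \<open>In q-Pochhammer notation this is Q^(k(k+1)/2) (-aQ;Q)_k / (Q;Q)_k, the summand of
  Lebesgue's identity. At a = 0 it is the summand of Euler's series.\<close>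

definition leb_term :: "'a::field \<Rightarrow> 'a \<Rightarrow> nat \<Rightarrow> 'a" where
  "leb_term Q a k = (\<Prod>j=1..k. Q ^ j * (1 + a * Q ^ j) / (1 - Q ^ j))"

lemma leb_term_Suc: "leb_term Q a (Suc k) = leb_term Q a k * (Q ^ Suc k * (1 + a * Q ^ Suc k) / (1 - Q ^ Suc k))"
  by (simp add: leb_term_def)

text \<open>\<open>W\<close> expresses bound 0 through bound 1, and inserting it turns
  \<open>Y\<close> into a one-term recursion; two consecutive instances of \<open>W\<close> then
  give the ratio. The parameter q^(-3) comes from the factor 1 + q^(2j-3), whose exponent is
  negative at j = 1, so q must not vanish.\<close>

lemma gap_gf_eq_leb_term:
  fixes q :: "'a::{real_normed_field,banach}"
  assumes q: "norm q < 1" "q \<noteq> 0"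
  shows "gap_gf q 0 k = leb_term (q ^ 2) (1 / q ^ 3) k"
proof -
  have ne: "1 - q ^ (2 * k + 2) \<noteq> 0" for k
    using power_neq_1[OF q(1), of "2 * k + 2"] by auto
  have W: "gap_gf q 0 (Suc k) = (q + q ^ 2) * q ^ (2 * k) / (1 - q ^ (2 * k + 2)) * gap_gf q 1 k" for k
    using gap_gf_0_Suc[OF q(1), of k] ne[of k] by (simp add: field_simps)
  have Y: "gap_gf q 1 (Suc k) = q ^ (2 * k + 2) * (1 + q ^ (2 * k + 1)) / (1 - q ^ (2 * k + 2)) * gap_gf q 1 k" for k
  proof -
    have "gap_gf q 1 (Suc k) = q ^ (2 * k + 2) *
       ((q + q ^ 2) * q ^ (2 * k) / (1 - q ^ (2 * k + 2)) * gap_gf q 1 k + gap_gf q 1 k)"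
      using gap_gf_1_Suc[OF q(1), of k] unfolding W by (simp add: algebra_simps)
    also have "\<dots> = q ^ (2 * k + 2) * (1 + q ^ (2 * k + 1)) / (1 - q ^ (2 * k + 2)) * gap_gf q 1 k"
      using ne[of k] by (simp add: divide_simps) (simp add: algebra_simps power2_eq_square)
    finally show ?thesis .
  qed
  have nil: "gap_gf q m 0 = 1" for m
  proof -
    have "gap_lists m 0 = {[]}" by (auto simp: gap_lists_def)
    then show ?thesis by (simp add: gap_gf_def)
  qed
  show ?thesis
  proof (cases k)
    case (Suc n)
    have "gap_gf q 0 (Suc n) = leb_term (q ^ 2) (1 / q ^ 3) (Suc n)"
    proof (induction n)
      case 0
      have "q\<^sup>2 * (1 + q\<^sup>2 / q ^ 3) = q + q\<^sup>2"
        using q(2) by (simp add: field_simps eval_nat_numeral)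
      then show ?case unfolding W leb_term_Suc nil by (simp add: leb_term_def) (simp add: power2_eq_square)
    next
      case (Suc n)
      have 1: "(q\<^sup>2) ^ Suc (Suc n) = q ^ (2 * n + 4)"
        by (metis power_mult mult_Suc_right add.commute add.left_commute numeral_Bit0)
      have "q ^ (2 * n + 4) = q ^ 3 * q ^ (2 * n + 1)"
        by (subst power_add[symmetric]) (simp add: add.commute)
      then have 2: "1 / q ^ 3 * q ^ (2 * n + 4) = q ^ (2 * n + 1)"
        using q(2) by simp
      have 3: "a * p / d * (p * r / e * y) = a * s / e * y * (t * r / d)" if "p * p = s * t" for a p d r e y s t :: 'a
      proof -
        have "a * p / d * (p * r / e * y) = a * (p * p) * r * y / (d * e)"
          by simp
        also have "\<dots> = a * s / e * y * (t * r / d)" unfolding that by (simp add: mult_ac)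
        finally show ?thesis .
      qed
      have 4: "q ^ (2 * n + 2) * q ^ (2 * n + 2) = q ^ (2 * n) * q ^ (2 * n + 4)"
        unfolding power_add[symmetric] by (rule arg_cong[where f = "power q"]) simp
      have 5: "2 * Suc n = 2 * n + 2" "2 * n + 2 + 2 = 2 * n + 4" by simp_all
      have "gap_gf q 0 (Suc (Suc n)) = gap_gf q 0 (Suc n) *
          ((q\<^sup>2) ^ Suc (Suc n) * (1 + 1 / q ^ 3 * (q\<^sup>2) ^ Suc (Suc n)) / (1 - (q\<^sup>2) ^ Suc (Suc n)))"
        unfolding 1 2 W[of "Suc n"] W[of n] Y[of n] 5 by (rule 3[OF 4])
      then show ?case unfolding Suc.IH by (simp only: leb_term_Suc[of _ _ "Suc n"])
    qed
    then show ?thesis using Suc by simp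
  qed (simp add: nil leb_term_def)
qed

subsection \<open>The little Goellnitz identity\<close>

lemma norm_one_minus_power_ge:
  fixes Q :: "'a::real_normed_field"
  shows "1 - norm Q ^ j \<le> norm (1 - Q ^ j)"
  using norm_triangle_ineq2[of 1 "Q ^ j"] by (simp add: norm_power)

text \<open>The majorant depends on b only through the bound B. It is thus uniform when a is
  replaced by all the a Q^(2n), as the passage to the limit under the sum requires.\<close>

lemma norm_leb_term_le:
  fixes Q :: "'a::real_normed_field"
  assumes "norm Q < 1" "norm b \<le> B"
  shows "norm (leb_term Q b k) \<le> leb_term (norm Q) B k"
  unfolding leb_term_def prod_norm[symmetric]
proof (rule prod_mono, intro conjI)
  fix j assume j: "j \<in> {1..k}"
  have "norm (1 + b * Q ^ j) \<le> 1 + norm (b * Q ^ j)"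
    using norm_triangle_ineq[of 1 "b * Q ^ j"] by simp
  also have "\<dots> \<le> 1 + B * norm Q ^ j"
    using assms by (simp add: norm_mult norm_power mult_right_mono)
  finally have 1: "norm (1 + b * Q ^ j) \<le> 1 + B * norm Q ^ j" .
  have "norm Q ^ j < 1" using assms j by (simp add: power_less_one_iff)
  then show "norm (Q ^ j * (1 + b * Q ^ j) / (1 - Q ^ j)) \<le> norm Q ^ j * (1 + B * norm Q ^ j) / (1 - norm Q ^ j)"
    unfolding norm_divide norm_mult norm_power
    by (intro frac_le mult_left_mono 1 norm_one_minus_power_ge mult_nonneg_nonneg)
       (use order_trans[OF norm_ge_zero 1] in auto)
qed simp

lemma leb_term_ratio_bound:
  fixes r B :: real
  assumes "0 \<le> r" "r < 1"
  shows "\<forall>\<^sub>F k in sequentially. r ^ Suc k * (1 + B * r ^ Suc k) / (1 - r ^ Suc k) < 1 / 2"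
proof -
  have "(\<lambda>k. r ^ Suc k) \<longlonglongrightarrow> 0"
    using assms by (intro LIMSEQ_Suc LIMSEQ_power_zero) simp
  then have "(\<lambda>k. r ^ Suc k * (1 + B * r ^ Suc k) / (1 - r ^ Suc k)) \<longlonglongrightarrow> 0 * (1 + B * 0) / (1 - 0)"
    by (intro tendsto_intros) auto
  then show ?thesis by (rule order_tendstoD) simp
qed

lemma summable_leb_term_real:
  fixes r B :: real
  assumes "0 \<le> r" "r < 1" "0 \<le> B"
  shows "summable (leb_term r B)"
proof -
  have nonneg: "leb_term r B k \<ge> 0" for k
    unfolding leb_term_def using assms by (intro prod_nonneg ballI divide_nonneg_nonneg mult_nonneg_nonneg add_nonneg_nonneg)
      (auto simp: power_le_one)
  from leb_term_ratio_bound[OF assms(1,2), of B]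
  obtain N where N: "\<And>k. k \<ge> N \<Longrightarrow> r ^ Suc k * (1 + B * r ^ Suc k) / (1 - r ^ Suc k) < 1 / 2"
    unfolding eventually_sequentially by blast
  show ?thesis
  proof (rule summable_ratio_test[of "1 / 2" N])
    fix k assume "N \<le> k"
    from mult_left_mono[OF less_imp_le[OF N[OF this]] nonneg[of k]] nonneg[of k] nonneg[of "Suc k"]
    show "norm (leb_term r B (Suc k)) \<le> 1 / 2 * norm (leb_term r B k)"
      unfolding leb_term_Suc real_norm_def by linarith
  qed simp
qed

context
  fixes Q :: "'a::{real_normed_field,banach}"
  assumes Q: "norm Q < 1"
begin

lemma summable_norm_leb_term: "summable (\<lambda>k. norm (leb_term Q b k))"
  by (rule summable_comparison_test'[OF summable_leb_term_real[of "norm Q" "norm b"]])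
     (use Q norm_leb_term_le[OF Q order_refl] in auto)

lemma summable_leb_term: "summable (leb_term Q b)"
  using summable_norm_cancel[OF summable_norm_leb_term] .

lemma one_minus_power_neq_0: "0 < j \<Longrightarrow> 1 - Q ^ j \<noteq> 0"
  using power_neq_1[OF Q] by fastforce

text \<open>Replacing a by a Q^2 moves the factors 1 + a Q^j along by two places, so only two of
  them at either end do not cancel. The multiplied form stays valid where a factor vanishes.\<close>

lemma leb_term_shift:
  "leb_term Q (a * Q ^ 2) k * ((1 + a * Q) * (1 + a * Q ^ 2)) = leb_term Q a k * ((1 + a * Q ^ Suc k) * (1 + a * Q ^ Suc (Suc k)))"
proof (induction k)
  case (Suc k)
  have *: "a * Q ^ 2 * Q ^ Suc k = a * Q ^ Suc (Suc (Suc k))"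
    by (simp add: power2_eq_square mult_ac)
  have "leb_term Q (a * Q ^ 2) (Suc k) * ((1 + a * Q) * (1 + a * Q ^ 2)) =
    (leb_term Q (a * Q ^ 2) k * ((1 + a * Q) * (1 + a * Q ^ 2))) * (Q ^ Suc k * (1 + a * Q ^ Suc (Suc (Suc k))) / (1 - Q ^ Suc k))"
    unfolding leb_term_Suc * by (simp add: mult_ac)
  also have "\<dots> = leb_term Q a (Suc k) * ((1 + a * Q ^ Suc (Suc k)) * (1 + a * Q ^ Suc (Suc (Suc k))))"
    unfolding Suc.IH leb_term_Suc by (simp add: mult_ac)
  finally show ?case .
qed (simp add: leb_term_def power2_eq_square)

text \<open>After multiplication by 1 + a Q, both series can be written over the same
  \<open>leb_term Q a k\<close>. The potential is 0 at k = 0 because of 1 - Q^0 and tends to 0, so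
  the multiplied difference is 0; this is where 1 + a Q must be cancelled.\<close>

lemma lebesgue_step:
  assumes "1 + a * Q \<noteq> 0"
  shows "(\<Sum>k. leb_term Q a k) = (1 + a * Q ^ 2) * (\<Sum>k. leb_term Q (a * Q ^ 2) k)"
proof -
  \<comment> \<open>The difference of the two sides telescopes with this potential.\<close>
  define G where "G k = - a * Q * leb_term Q a k * (1 - Q ^ k)" for k
  have G: "G (Suc k) - G k = (1 + a * Q) * (leb_term Q a k - (1 + a * Q ^ 2) * leb_term Q (a * Q ^ 2) k)" for k
  proof -
    have "G (Suc k) = - a * Q * leb_term Q a k * (Q ^ Suc k * (1 + a * Q ^ Suc k))"
      unfolding G_def leb_term_Suc using one_minus_power_neq_0[of "Suc k"] by simp
    moreover have "(1 + a * Q) * ((1 + a * Q ^ 2) * leb_term Q (a * Q ^ 2) k) =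
        leb_term Q a k * ((1 + a * Q ^ Suc k) * (1 + a * Q ^ Suc (Suc k)))"
      using leb_term_shift[of a k] by (simp only: mult_ac)
    ultimately show ?thesis
      unfolding right_diff_distrib[of "1 + a * Q"] by (simp add: G_def algebra_simps)
  qed
  have "(\<lambda>k. - a * Q * leb_term Q a k * (1 - Q ^ k)) \<longlonglongrightarrow> - a * Q * 0 * (1 - 0)"
    by (intro tendsto_intros summable_LIMSEQ_zero[OF summable_leb_term] LIMSEQ_power_zero Q)
  then have "G \<longlonglongrightarrow> 0" by (simp add: G_def[abs_def])
  from telescope_sums[OF this] have "(\<lambda>k. (1 + a * Q) * (leb_term Q a k - (1 + a * Q ^ 2) * leb_term Q (a * Q ^ 2) k)) sums 0"
    unfolding G by (simp add: G_def)
  moreover have "(\<lambda>k. (1 + a * Q) * (leb_term Q a k - (1 + a * Q ^ 2) * leb_term Q (a * Q ^ 2) k)) sums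
      ((1 + a * Q) * ((\<Sum>k. leb_term Q a k) - (1 + a * Q ^ 2) * (\<Sum>k. leb_term Q (a * Q ^ 2) k)))"
    by (intro sums_mult sums_diff summable_sums summable_leb_term)
  ultimately have "(1 + a * Q) * ((\<Sum>k. leb_term Q a k) - (1 + a * Q ^ 2) * (\<Sum>k. leb_term Q (a * Q ^ 2) k)) = 0"
    using sums_unique2 by blast
  with assms show ?thesis by simp
qed

section \<open>Euler's product for the series with a = 0\<close>

lemma summable_euler: "norm z \<le> 1 \<Longrightarrow> summable (\<lambda>k. z ^ k * leb_term Q 0 k)"
  by (rule summable_norm_cancel, rule summable_comparison_test'[OF summable_norm_leb_term[of 0]])
     (simp add: norm_mult norm_power mult_left_le_one_le power_le_one)

text \<open>In the difference of the series at z and at z Q, the factor 1 - Q^k cancels the last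
  denominator; this lowers k by one and frees a factor z Q.\<close>

lemma euler_step:
  assumes z: "norm z \<le> 1"
  shows "(\<Sum>k. z ^ k * leb_term Q 0 k) = (1 + z * Q) * (\<Sum>k. (z * Q) ^ k * leb_term Q 0 k)"
proof -
  have zQ: "norm (z * Q) \<le> 1" using z Q by (simp add: norm_mult mult_le_one)
  let ?d = "\<lambda>k. z ^ k * leb_term Q 0 k - (z * Q) ^ k * leb_term Q 0 k"
  have d: "summable ?d" by (intro summable_diff summable_euler z zQ)
  have "(\<Sum>k. z ^ k * leb_term Q 0 k) - (\<Sum>k. (z * Q) ^ k * leb_term Q 0 k) = (\<Sum>k. ?d k)"
    by (intro suminf_diff summable_euler z zQ)
  also have "\<dots> = (\<Sum>k. ?d (Suc k))"
    using suminf_split_head[OF d] by simp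
  also have "(\<lambda>k. ?d (Suc k)) = (\<lambda>k. z * Q * ((z * Q) ^ k * leb_term Q 0 k))"
  proof
    fix k
    have "?d (Suc k) = z ^ Suc k * (leb_term Q 0 (Suc k) * (1 - Q ^ Suc k))"
      by (simp add: power_mult_distrib algebra_simps)
    also have "leb_term Q 0 (Suc k) * (1 - Q ^ Suc k) = leb_term Q 0 k * Q ^ Suc k"
      unfolding leb_term_Suc using one_minus_power_neq_0[of "Suc k"] by simp
    finally show "?d (Suc k) = z * Q * ((z * Q) ^ k * leb_term Q 0 k)"
      by (simp add: power_mult_distrib)
  qed
  also have "(\<Sum>k. z * Q * ((z * Q) ^ k * leb_term Q 0 k)) = z * Q * (\<Sum>k. (z * Q) ^ k * leb_term Q 0 k)"
    by (intro suminf_mult summable_euler zQ)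
  finally show ?thesis by (simp add: algebra_simps)
qed

lemma euler_prod:
  "(\<Sum>k. leb_term Q 0 k) = (\<Prod>i<n. 1 + Q ^ Suc i) * (\<Sum>k. (Q ^ n) ^ k * leb_term Q 0 k)"
proof (induction n)
  case (Suc n)
  have "(\<Sum>k. (Q ^ n) ^ k * leb_term Q 0 k) = (1 + Q ^ Suc n) * (\<Sum>k. (Q ^ Suc n) ^ k * leb_term Q 0 k)"
    using euler_step[of "Q ^ n"] Q by (simp add: norm_power power_le_one mult.commute)
  with Suc.IH show ?case by simp
qed simp

text \<open>Iterating the functional equation from z = 1 leaves the series at Q^n, which tends to
  its constant term 1.\<close>

lemma suminf_leb_term_0: "(\<lambda>n. \<Prod>i<n. 1 + Q ^ Suc i) \<longlonglongrightarrow> (\<Sum>k. leb_term Q 0 k)"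
proof -
  have "(\<lambda>n. \<Sum>k. (Q ^ n) ^ k * leb_term Q 0 k) \<longlonglongrightarrow> (\<Sum>k. if k = 0 then 1 else 0)"
  proof (rule conjunct2[OF conjunct2[OF tannerys_theorem]])
    fix k
    have "(\<lambda>n. (Q ^ n) ^ k * leb_term Q 0 k) \<longlonglongrightarrow> 0 ^ k * leb_term Q 0 k"
      by (intro tendsto_intros LIMSEQ_power_zero Q)
    then show "(\<lambda>n. (Q ^ n) ^ k * leb_term Q 0 k) \<longlonglongrightarrow> (if k = 0 then 1 else 0)"
      by (cases "k = 0") (simp_all only: leb_term_def power_0_left, simp_all)
    show "\<forall>\<^sub>F (k, n) in at_top \<times>\<^sub>F sequentially. norm ((Q ^ n) ^ k * leb_term Q 0 k) \<le> norm (leb_term Q 0 k)"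
      using Q by (intro always_eventually)
        (auto simp: norm_mult norm_power power_mult[symmetric] mult_left_le_one_le power_le_one)
  qed (simp_all add: summable_norm_leb_term)
  moreover have "(\<Sum>k. if k = 0 then 1 else 0 :: 'a) = 1"
    using suminf_finite[of "{0}" "\<lambda>k. if k = 0 then 1 else 0 :: 'a"] by simp
  ultimately have E: "(\<lambda>n. \<Sum>k. (Q ^ n) ^ k * leb_term Q 0 k) \<longlonglongrightarrow> 1" by simp
  then have "(\<lambda>n. (\<Sum>k. leb_term Q 0 k) / (\<Sum>k. (Q ^ n) ^ k * leb_term Q 0 k)) \<longlonglongrightarrow> (\<Sum>k. leb_term Q 0 k) / 1"
    by (intro tendsto_intros) auto
  moreover have "\<forall>\<^sub>F n in sequentially. (\<Sum>k. (Q ^ n) ^ k * leb_term Q 0 k) \<noteq> 0"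
    using tendsto_imp_eventually_ne[OF E] by simp
  then have "\<forall>\<^sub>F n in sequentially. (\<Sum>k. leb_term Q 0 k) / (\<Sum>k. (Q ^ n) ^ k * leb_term Q 0 k) = (\<Prod>i<n. 1 + Q ^ Suc i)"
  proof eventually_elim
    case (elim n)
    then show ?case by (subst euler_prod[of n]) simp
  qed
  ultimately show ?thesis using Lim_transform_eventually by fastforce
qed

lemma lebesgue_prod:
  assumes "\<And>j. 1 + a * Q ^ j \<noteq> 0"
  shows "(\<Sum>k. leb_term Q a k) = (\<Prod>i<n. 1 + a * Q ^ (2 * i + 2)) * (\<Sum>k. leb_term Q (a * Q ^ (2 * n)) k)"
proof (induction n)
  case (Suc n)
  have "(\<Sum>k. leb_term Q (a * Q ^ (2 * n)) k) = (1 + a * Q ^ (2 * n + 2)) * (\<Sum>k. leb_term Q (a * Q ^ (2 * Suc n)) k)"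
    using lebesgue_step[of "a * Q ^ (2 * n)"] assms[of "2 * n + 1"]
    by (simp add: power2_eq_square mult_ac)
  with Suc.IH show ?case by simp
qed simp

lemma tendsto_leb_term: "(f \<longlongrightarrow> b) F \<Longrightarrow> ((\<lambda>x. leb_term Q (f x) k) \<longlongrightarrow> leb_term Q b k) F"
  unfolding leb_term_def by (intro tendsto_intros one_minus_power_neq_0) auto

text \<open>\<open>?P n * ?S n\<close> equals the sum for every n. Since \<open>?P\<close> converges
  and \<open>?S\<close> and \<open>?R\<close> have the same limit, \<open>?R\<close> may replace
  \<open>?S\<close>, and the limit of \<open>?P\<close> never has to be identified. The second
  product has 2n factors so that both products end at the power Q^(2n).\<close>

lemma lebesgue_identity:
  assumes ne: "\<And>j. 1 + a * Q ^ j \<noteq> 0"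
  shows "(\<lambda>n. (\<Prod>i<n. 1 + a * Q ^ (2 * i + 2)) * (\<Prod>i<2 * n. 1 + Q ^ Suc i)) \<longlonglongrightarrow> (\<Sum>k. leb_term Q a k)"
proof -
  let ?P = "\<lambda>n. \<Prod>i<n. 1 + a * Q ^ (2 * i + 2)"
  let ?R = "\<lambda>n. \<Prod>i<2 * n. 1 + Q ^ Suc i"
  let ?S = "\<lambda>n. \<Sum>k. leb_term Q (a * Q ^ (2 * n)) k"
  have "(\<lambda>n. Q ^ (2 * n)) \<longlonglongrightarrow> 0"
    using LIMSEQ_power_zero[of "Q ^ 2"] Q by (simp add: power_mult norm_power power_less_one_iff)
  then have lim0: "(\<lambda>n. a * Q ^ (2 * n)) \<longlonglongrightarrow> 0" by (rule tendsto_mult_right_zero)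
  have S: "?S \<longlonglongrightarrow> (\<Sum>k. leb_term Q 0 k)"
  proof (rule conjunct2[OF conjunct2[OF tannerys_theorem]])
    show "(\<lambda>n. leb_term Q (a * Q ^ (2 * n)) k) \<longlonglongrightarrow> leb_term Q 0 k" for k
      by (rule tendsto_leb_term[OF lim0])
    have "norm (leb_term Q (a * Q ^ (2 * n)) k) \<le> leb_term (norm Q) (norm a) k" for n k
      using Q by (intro norm_leb_term_le) (auto simp: norm_mult norm_power mult_left_le power_le_one)
    then show "\<forall>\<^sub>F (k, n) in at_top \<times>\<^sub>F sequentially. norm (leb_term Q (a * Q ^ (2 * n)) k) \<le> leb_term (norm Q) (norm a) k"
      by (simp add: case_prod_unfold)
  qed (use Q in \<open>auto intro: summable_leb_term_real\<close>)
  have R: "?R \<longlonglongrightarrow> (\<Sum>k. leb_term Q 0 k)"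
    using LIMSEQ_subseq_LIMSEQ[OF suminf_leb_term_0, of "\<lambda>n. 2 * n"] by (simp add: strict_mono_def o_def)
  have "summable (\<lambda>i. norm (a * Q ^ (2 * i + 2)))"
  proof -
    have "summable (\<lambda>i. norm a * norm Q ^ 2 * (norm Q ^ 2) ^ i)"
      using Q by (intro summable_mult summable_geometric) (simp add: power_less_one_iff)
    moreover have "norm (a * Q ^ (2 * i + 2)) = norm a * norm Q ^ 2 * (norm Q ^ 2) ^ i" for i
      unfolding norm_mult norm_power power_add power_mult by (simp only: mult_ac)
    ultimately show ?thesis by simp
  qed
  then have "convergent_prod (\<lambda>i. 1 + a * Q ^ (2 * i + 2))"
    by (intro abs_convergent_prod_imp_convergent_prod summable_imp_abs_convergent_prod) simp
  then have "convergent (\<lambda>n. \<Prod>i\<le>n. 1 + a * Q ^ (2 * i + 2))"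
    by (rule convergent_prod_imp_convergent)
  then obtain L where "(\<lambda>n. \<Prod>i\<le>n. 1 + a * Q ^ (2 * i + 2)) \<longlonglongrightarrow> L" by (auto simp: convergent_def)
  then have P: "?P \<longlonglongrightarrow> L" by (subst (asm) LIMSEQ_lessThan_iff_atMost[symmetric])
  have "(\<lambda>n. ?P n * ?S n + ?P n * (?R n - ?S n)) \<longlonglongrightarrow> (\<Sum>k. leb_term Q a k) + L * ((\<Sum>k. leb_term Q 0 k) - (\<Sum>k. leb_term Q 0 k))"
    unfolding lebesgue_prod[OF ne, symmetric] by (intro tendsto_intros P S R)
  then show ?thesis by (simp add: algebra_simps)
qed

end

text \<open>With Q = q^2 and a = q^(-3), the first product has the exponents 4i + 1 and the second
  one all positive even exponents. A vanishing factor would mean q^(2j) = - q^3, hence 2j = 3 on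
  comparing moduli, which parity forbids.\<close>

lemma gap_gf_prod:
  fixes q :: "'a::{real_normed_field,banach}"
  assumes q: "norm q < 1" "q \<noteq> 0"
  shows "(\<lambda>n. \<Prod>i<n. (1 + q ^ (4 * i + 1)) * (1 + q ^ (4 * i + 2)) * (1 + q ^ (4 * i + 4))) \<longlonglongrightarrow>
    (\<Sum>k. gap_gf q 0 k)"
proof -
  have Q: "norm (q ^ 2) < 1" using q by (simp add: norm_power power_less_one_iff)
  have ne: "1 + 1 / q ^ 3 * (q ^ 2) ^ j \<noteq> 0" for j
  proof
    assume "1 + 1 / q ^ 3 * (q ^ 2) ^ j = 0"
    then have "(q ^ 2) ^ j = - (q ^ 3)"
      using q by (simp add: field_simps add_eq_0_iff)
    then have "q ^ (2 * j) = - (q ^ 3)" by (simp only: power_mult)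
    then have "norm q ^ (2 * j) = norm q ^ 3"
      by (metis norm_minus_cancel norm_power)
    moreover have "0 < norm q" using q by simp
    ultimately have "2 * j = 3" using q(1) power_inject_exp' by (metis less_irrefl)
    then show False by presburger
  qed
  have pw: "1 / q ^ 3 * (q ^ 2) ^ (2 * i + 2) = q ^ (4 * i + 1)" for i
  proof -
    have "(q ^ 2) ^ (2 * i + 2) = q ^ 3 * q ^ (4 * i + 1)"
      unfolding power_mult[symmetric] power_add[symmetric] by (rule arg_cong[where f = "power q"]) simp
    then show ?thesis using q by simp
  qed
  have "(\<Prod>i<n. 1 + 1 / q ^ 3 * (q ^ 2) ^ (2 * i + 2)) * (\<Prod>i<2 * n. 1 + (q ^ 2) ^ Suc i) =
      (\<Prod>i<n. (1 + q ^ (4 * i + 1)) * (1 + q ^ (4 * i + 2)) * (1 + q ^ (4 * i + 4)))" for n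
  proof (induction n)
    case (Suc n)
    have 1: "(q ^ 2) ^ Suc (2 * n) = q ^ (4 * n + 2)" "(q ^ 2) ^ Suc (Suc (2 * n)) = q ^ (4 * n + 4)"
      unfolding power_mult[symmetric] by (rule arg_cong[where f = "power q"], simp)+
    have 2: "2 * Suc n = Suc (Suc (2 * n))" by simp
    show ?case
      unfolding 2 prod.lessThan_Suc 1 pw Suc.IH[unfolded pw, symmetric] by (simp only: mult_ac)
  qed simp
  with lebesgue_identity[OF Q ne] show ?thesis
    by (simp add: gap_gf_eq_leb_term[OF q, abs_def])
qed

section \<open>Rearrangement from numbers of parts to sizes\<close>

lemma gap_partitions_Union: "(\<Union>n. gap_partitions n) = (\<Union>k. gap_lists 0 k)"
  by (auto simp: gap_partitions_eq gap_lists_def)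

lemma summable_gap_gf:
  fixes q :: "'a::{real_normed_field,banach}"
  assumes q: "norm q < 1" "q \<noteq> 0"
  shows "summable (\<lambda>k. gap_gf q 0 k)"
  using summable_leb_term[of "q ^ 2"] q by (simp add: gap_gf_eq_leb_term norm_power power_less_one_iff)

lemma gap_gf_nonneg: "0 \<le> r \<Longrightarrow> 0 \<le> gap_gf (r::real) m k"
  unfolding gap_gf_def by (intro infsum_nonneg) auto

text \<open>The same lists are grouped once by length and once by sum. The family is absolutely
  summable because the positive series at \<open>norm q\<close>, grouped by length,
  converges.\<close>

lemma has_sum_gap_partitions:
  fixes q :: "'a::{real_normed_field,banach}"
  assumes q: "norm q < 1" "q \<noteq> 0"
  shows "((\<lambda>n. of_nat (card (gap_partitions n)) * q ^ n) has_sum (\<Sum>k. gap_gf q 0 k)) UNIV"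
proof -
  let ?f = "\<lambda>xs. q ^ sum_list xs"
  have bij: "bij_betw snd (SIGMA k:UNIV. gap_lists 0 k) (\<Union>k. gap_lists 0 k)"
    by (auto simp: bij_betw_def inj_on_def gap_lists_def image_iff)
  have bij': "bij_betw snd (SIGMA n:UNIV. gap_partitions n) (\<Union>n. gap_partitions n)"
    by (auto simp: bij_betw_def inj_on_def gap_partitions_eq image_iff)
  have "(\<lambda>(k, xs). norm q ^ sum_list xs) summable_on (SIGMA k:UNIV. gap_lists 0 k)"
  proof (rule summable_on_SigmaI)
    show "((\<lambda>xs. case (k, xs) of (k, xs) \<Rightarrow> norm q ^ sum_list xs) has_sum gap_gf (norm q) 0 k) (gap_lists 0 k)" for k
      using has_sum_gap_lists[of "norm q" 0 k] q by simp
    show "gap_gf (norm q) 0 summable_on UNIV"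
      using summable_gap_gf[of "norm q"] q by (intro summable_nonneg_imp_summable_on) (auto intro: gap_gf_nonneg)
  qed auto
  then have summ: "(\<lambda>(k, xs). ?f xs) summable_on (SIGMA k:UNIV. gap_lists 0 k)"
    by - (rule abs_summable_summable, simp add: case_prod_unfold norm_power)
  have "(gap_gf q 0 has_sum (\<Sum>k. gap_gf q 0 k)) UNIV"
  proof (rule norm_summable_imp_has_sum)
    show "summable (\<lambda>k. norm (gap_gf q 0 k))"
      using summable_norm_leb_term[of "q ^ 2"] q by (simp add: gap_gf_eq_leb_term norm_power power_less_one_iff)
    show "gap_gf q 0 sums (\<Sum>k. gap_gf q 0 k)"
      using summable_sums[OF summable_gap_gf[OF q]] by simp
  qed
  then have "((\<lambda>(k, xs). ?f xs) has_sum (\<Sum>k. gap_gf q 0 k)) (SIGMA k:UNIV. gap_lists 0 k)"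
    by (intro has_sum_SigmaI[OF _ _ summ]) (use has_sum_gap_lists[OF q(1)] in auto)
  then have "(?f has_sum (\<Sum>k. gap_gf q 0 k)) (\<Union>n. gap_partitions n)"
    unfolding gap_partitions_Union
    by (subst has_sum_reindex_bij_betw[OF bij, symmetric]) (simp add: case_prod_unfold)
  then have "((\<lambda>(n, xs). ?f xs) has_sum (\<Sum>k. gap_gf q 0 k)) (SIGMA n:UNIV. gap_partitions n)"
    by (subst (asm) has_sum_reindex_bij_betw[OF bij', symmetric]) (simp add: case_prod_unfold)
  then show ?thesis
  proof (rule has_sum_SigmaD)
    show "((\<lambda>xs. case (n, xs) of (n, xs) \<Rightarrow> ?f xs) has_sum of_nat (card (gap_partitions n)) * q ^ n) (gap_partitions n)" for n
    proof -
      have "(\<Sum>xs\<in>gap_partitions n. ?f xs) = (\<Sum>xs\<in>gap_partitions n. q ^ n)"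
        by (intro sum.cong) (auto simp: gap_partitions_eq)
      then show ?thesis by (intro has_sum_finiteI) (auto simp: finite_gap_partitions)
    qed
  qed
qed

text \<open>All terms of the series are nonnegative, so one size contributes at most the whole. This
  crude bound carries the exponential smallness of a weight over to the partitions of a single
  size.\<close>

lemma card_gap_partitions_length_le:
  assumes r: "0 < r" "r < (1::real)"
  shows "real (card {xs \<in> gap_partitions n. length xs = k}) * r ^ n \<le> gap_gf r 0 k"
proof -
  have "real (card {xs \<in> gap_partitions n. length xs = k}) * r ^ n = (\<Sum>xs\<in>{xs \<in> gap_partitions n. length xs = k}. r ^ sum_list xs)"
    by (simp add: gap_partitions_eq)
  also have "\<dots> \<le> gap_gf r 0 k"
    unfolding gap_gf_def
  proof (rule finite_sum_le_infsum)
    show "(\<lambda>xs. r ^ sum_list xs) summable_on gap_lists 0 k" using r by (intro summable_gap_lists) simp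
    show "finite {xs \<in> gap_partitions n. length xs = k}"
      using finite_gap_partitions[of n] by simp
  qed (use r in \<open>auto simp: gap_partitions_eq gap_lists_def\<close>)
  finally show ?thesis .
qed

subsection \<open>Asymptotics of the generating function near the positive axis\<close>

text \<open>For positive real part this is the sum of exp(-mz) over the positive m congruent to 0, 1
  or 2 modulo 4. Its pole at 0 has residue 3/4, one quarter for each residue class.\<close>

definition lambert :: "complex \<Rightarrow> complex" where
  "lambert z = (exp (- z) + exp (- 2 * z) + exp (- 4 * z)) / (1 - exp (- 4 * z))"

text \<open>Both \<open>lambert_rem\<close> and \<open>z \<mapsto> z * deriv lambert_rem z\<close> are bounded in a sector, so the terms of
  the alternating series become absolutely summable, uniformly in \<open>z\<close>, after pairing neighbours.\<close>

definition lambert_rem :: "complex \<Rightarrow> complex" where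
  "lambert_rem z = lambert z - 3 / (4 * z)"

text \<open>The Lambert series of a logarithm of the product over \<open>m\<close> congruent to 0, 1, 2 modulo 4.\<close>

definition log_gf :: "complex \<Rightarrow> complex" where
  "log_gf z = (\<Sum>j. (-1) ^ j / of_nat (Suc j) * lambert (of_nat (Suc j) * z))"

lemma norm_lambert_le:
  assumes "0 < a" "a \<le> Re z"
  shows "norm (lambert z) \<le> 3 / (1 - exp (- 4 * a)) * exp (- Re z)"
proof -
  have "norm (exp (- z) + exp (- 2 * z) + exp (- 4 * z)) \<le> exp (- Re z) + exp (- 2 * Re z) + exp (- 4 * Re z)"
    by (intro norm_triangle_mono) auto
  also have "\<dots> \<le> exp (- Re z) + exp (- Re z) + exp (- Re z)"
    using assms by (intro add_mono) auto
  finally have 1: "norm (exp (- z) + exp (- 2 * z) + exp (- 4 * z)) \<le> 3 * exp (- Re z)" by simp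
  have "1 - exp (- 4 * a) \<le> 1 - norm (exp (- 4 * z))" using assms by simp
  also have "\<dots> \<le> norm (1 - exp (- 4 * z))"
    using norm_triangle_ineq2[of 1 "exp (- 4 * z)"] by simp
  finally have 2: "1 - exp (- 4 * a) \<le> norm (1 - exp (- 4 * z))" .
  have "norm (lambert z) \<le> 3 * exp (- Re z) / (1 - exp (- 4 * a))"
    unfolding lambert_def norm_divide using assms by (intro frac_le 1 2) auto
  then show ?thesis by simp
qed

lemma summable_norm_lambert:
  assumes "0 < Re z"
  shows "summable (\<lambda>j. norm (lambert (of_nat (Suc j) * z)))"
proof (rule summable_comparison_test')
  show "summable (\<lambda>j. 3 / (1 - exp (- 4 * Re z)) * exp (- Re z) ^ Suc j)"
    using assms by (intro summable_mult, subst summable_Suc_iff) (auto intro!: summable_geometric)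
  show "norm (norm (lambert (of_nat (Suc j) * z))) \<le> 3 / (1 - exp (- 4 * Re z)) * exp (- Re z) ^ Suc j" for j
  proof -
    have "exp (- Re z) ^ Suc j = exp (- Re (of_nat (Suc j) * z))"
      by (subst exp_of_nat_mult[symmetric]) simp
    moreover have "Re z \<le> Re (of_nat (Suc j) * z)" using assms by simp
    ultimately show ?thesis using norm_lambert_le[of "Re z" "of_nat (Suc j) * z"] assms by simp
  qed
qed

lemma summable_log_gf:
  assumes "0 < Re z"
  shows "summable (\<lambda>j. (-1) ^ j / of_nat (Suc j) * lambert (of_nat (Suc j) * z))"
proof (rule summable_norm_cancel, rule summable_comparison_test'[OF summable_norm_lambert[OF assms]])
  show "norm (norm ((-1) ^ j / of_nat (Suc j) * lambert (of_nat (Suc j) * z))) \<le> norm (lambert (of_nat (Suc j) * z))" for j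
  proof -
    have "norm ((-1) ^ j / of_nat (Suc j) * lambert (of_nat (Suc j) * z)) = 1 / real (Suc j) * norm (lambert (of_nat (Suc j) * z))"
      by (simp add: norm_mult norm_divide norm_power del: of_nat_Suc)
    also have "\<dots> \<le> 1 * norm (lambert (of_nat (Suc j) * z))" by (intro mult_right_mono) auto
    finally show ?thesis by simp
  qed
qed

lemma ln_one_plus_sums:
  fixes w :: complex
  assumes "norm w < 1"
  shows "(\<lambda>j. (-1) ^ j / of_nat (Suc j) * w ^ Suc j) sums ln (1 + w)"
proof -
  have "(\<lambda>n. (-1) ^ Suc n / of_nat n * w ^ n) sums ln (1 + w)" by (rule Ln_series[OF assms])
  then have "(\<lambda>n. (-1) ^ Suc (Suc n) / of_nat (Suc n) * w ^ Suc n) sums (ln (1 + w) - (-1) ^ Suc 0 / of_nat 0 * w ^ 0)"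
    by (subst sums_Suc_iff) simp
  then show ?thesis by simp
qed

lemma sum_lambert_geometric:
  assumes "0 < Re z"
  shows "(\<Sum>i<n. exp (- z) ^ (4 * i + 1) + exp (- z) ^ (4 * i + 2) + exp (- z) ^ (4 * i + 4)) =
    lambert z * (1 - exp (- 4 * z) ^ n)"
proof -
  define q where "q = exp (- z)"
  have q: "norm q < 1" using assms by (simp add: q_def)
  then have ne: "q ^ 4 \<noteq> 1" by (metis norm_one norm_power power_less_one_iff norm_ge_zero less_irrefl zero_less_numeral)
  have e: "exp (- 2 * z) = q ^ 2" "exp (- 4 * z) = q ^ 4"
    unfolding q_def by (simp_all flip: exp_of_nat_mult)
  have "(\<Sum>i<n. q ^ (4 * i + 1) + q ^ (4 * i + 2) + q ^ (4 * i + 4)) = (q + q ^ 2 + q ^ 4) * (\<Sum>i<n. (q ^ 4) ^ i)"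
  proof -
    have "q ^ (4 * i + k) = q ^ k * (q ^ 4) ^ i" for i k
      by (subst power_add, subst power_mult) (simp only: mult.commute)
    then show ?thesis unfolding sum_distrib_left distrib_right by (simp only: power_one_right)
  qed
  also have "(\<Sum>i<n. (q ^ 4) ^ i) = (1 - (q ^ 4) ^ n) / (1 - q ^ 4)"
    using ne by (rule sum_gp_strict[THEN trans, OF if_not_P])
  finally show ?thesis unfolding lambert_def e q_def[symmetric] by simp
qed

text \<open>Principal logarithms are summed for finitely many factors only and then exponentiated,
  so no branch of the logarithm of the product enters. Truncating the product puts the factor 1 -
  exp(-4jz)^n on the j-th Lebesgue-free summand \<open>lambert (j z)\<close>, and dominated
  convergence removes it.\<close>

lemma exp_log_gf:
  assumes z: "0 < Re z"
  shows "(\<lambda>n. \<Prod>i<n. (1 + exp (- z) ^ (4 * i + 1)) * (1 + exp (- z) ^ (4 * i + 2)) * (1 + exp (- z) ^ (4 * i + 4)))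
    \<longlonglongrightarrow> exp (log_gf z)"
proof -
  let ?c = "\<lambda>j. (-1) ^ j / of_nat (Suc j) :: complex"
  let ?L = "\<lambda>j. lambert (of_nat (Suc j) * z)"
  let ?w = "exp (- 4 * z)"
  have ln1: "(\<lambda>j. ?c j * (exp (- (of_nat (Suc j) * z))) ^ k) sums ln (1 + exp (- z) ^ k)" if "0 < k" for k
  proof -
    have "(\<lambda>j. ?c j * (exp (- z) ^ k) ^ Suc j) sums ln (1 + exp (- z) ^ k)"
      using z that by (intro ln_one_plus_sums) (simp add: norm_power power_less_one_iff)
    moreover have "(exp (- z) ^ k) ^ Suc j = exp (- (of_nat (Suc j) * z)) ^ k" for j
      by (subst (1 2) power_mult[symmetric] exp_of_nat_mult[symmetric])
         (simp flip: exp_of_nat_mult power_mult add: algebra_simps)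
    ultimately show ?thesis by simp
  qed
  have S: "(\<Prod>i<n. (1 + exp (- z) ^ (4 * i + 1)) * (1 + exp (- z) ^ (4 * i + 2)) * (1 + exp (- z) ^ (4 * i + 4))) =
    exp (\<Sum>j. ?c j * (?L j * (1 - exp (- 4 * (of_nat (Suc j) * z)) ^ n)))" for n
  proof -
    have ne: "1 + exp (- z) ^ k \<noteq> 0" if "0 < k" for k
    proof
      assume "1 + exp (- z) ^ k = 0"
      then have "norm (exp (- z) ^ k) = norm (-1 :: complex)" by (metis add_eq_0_iff)
      moreover have "norm (exp (- z) ^ k) < 1" using z that by (simp add: norm_power power_less_one_iff)
      ultimately show False by simp
    qed
    have "(\<lambda>j. \<Sum>i<n. ?c j * (exp (- (of_nat (Suc j) * z))) ^ (4 * i + 1) + ?c j * (exp (- (of_nat (Suc j) * z))) ^ (4 * i + 2)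
        + ?c j * (exp (- (of_nat (Suc j) * z))) ^ (4 * i + 4)) sums
      (\<Sum>i<n. ln (1 + exp (- z) ^ (4 * i + 1)) + ln (1 + exp (- z) ^ (4 * i + 2)) + ln (1 + exp (- z) ^ (4 * i + 4)))"
      by (intro sums_sum sums_add ln1) auto
    also have "(\<lambda>j. \<Sum>i<n. ?c j * (exp (- (of_nat (Suc j) * z))) ^ (4 * i + 1) + ?c j * (exp (- (of_nat (Suc j) * z))) ^ (4 * i + 2)
        + ?c j * (exp (- (of_nat (Suc j) * z))) ^ (4 * i + 4)) = (\<lambda>j. ?c j * (?L j * (1 - exp (- 4 * (of_nat (Suc j) * z)) ^ n)))"
    proof
      fix j
      have "0 < Re (of_nat (Suc j) * z)" using z by simp
      from sum_lambert_geometric[OF this, of n, symmetric]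
      show "(\<Sum>i<n. ?c j * (exp (- (of_nat (Suc j) * z))) ^ (4 * i + 1) + ?c j * (exp (- (of_nat (Suc j) * z))) ^ (4 * i + 2)
        + ?c j * (exp (- (of_nat (Suc j) * z))) ^ (4 * i + 4)) = ?c j * (?L j * (1 - exp (- 4 * (of_nat (Suc j) * z)) ^ n))"
        by (simp only: sum_distrib_left distrib_left)
    qed
    finally have "(\<Sum>j. ?c j * (?L j * (1 - exp (- 4 * (of_nat (Suc j) * z)) ^ n))) =
      (\<Sum>i<n. ln (1 + exp (- z) ^ (4 * i + 1)) + ln (1 + exp (- z) ^ (4 * i + 2)) + ln (1 + exp (- z) ^ (4 * i + 4)))"
      by (rule sums_unique[symmetric])
    then show ?thesis using ne by (simp add: exp_sum exp_add exp_Ln del: power_Suc)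
  qed
  have "(\<lambda>n. \<Sum>j. ?c j * (?L j * (1 - exp (- 4 * (of_nat (Suc j) * z)) ^ n))) \<longlonglongrightarrow> (\<Sum>j. ?c j * ?L j)"
  proof (rule conjunct2[OF conjunct2[OF tannerys_theorem]])
    fix j
    have "norm (exp (- 4 * (of_nat (Suc j) * z))) < 1" using z by (simp add: add_pos_nonneg)
    then have "(\<lambda>n. ?c j * (?L j * (1 - exp (- 4 * (of_nat (Suc j) * z)) ^ n))) \<longlonglongrightarrow> ?c j * (?L j * (1 - 0))"
      by (intro tendsto_intros LIMSEQ_power_zero)
    then show "(\<lambda>n. ?c j * (?L j * (1 - exp (- 4 * (of_nat (Suc j) * z)) ^ n))) \<longlonglongrightarrow> ?c j * ?L j" by simp
  next
    have "norm (?c j * (?L j * (1 - exp (- 4 * (of_nat (Suc j) * z)) ^ n))) \<le> norm (?L j) * 2" for j n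
    proof -
      have c: "norm (?c j) \<le> 1" by (simp add: norm_divide norm_power del: of_nat_Suc)
      have "norm (exp (- 4 * (of_nat (Suc j) * z)) ^ n) \<le> 1"
        unfolding norm_power using z by (intro power_le_one) (auto intro!: mult_nonneg_nonneg add_nonneg_nonneg)
      then have "norm (1 - exp (- 4 * (of_nat (Suc j) * z)) ^ n) \<le> 2"
        using norm_triangle_ineq4[of 1 "exp (- 4 * (of_nat (Suc j) * z)) ^ n"] by simp
      then have "norm (?c j) * (norm (?L j) * norm (1 - exp (- 4 * (of_nat (Suc j) * z)) ^ n)) \<le> 1 * (norm (?L j) * 2)"
        using c by (intro mult_mono mult_left_mono) auto
      then show ?thesis by (simp only: norm_mult mult_1)
    qed
    then show "\<forall>\<^sub>F (j, n) in at_top \<times>\<^sub>F sequentially.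
        norm (?c j * (?L j * (1 - exp (- 4 * (of_nat (Suc j) * z)) ^ n))) \<le> norm (?L j) * 2"
      by (simp add: case_prod_unfold)
    show "summable (\<lambda>j. norm (?L j) * 2)" by (intro summable_mult2 summable_norm_lambert z)
  qed simp
  then show ?thesis unfolding S log_gf_def by (rule tendsto_exp)
qed

section \<open>Expansion of the Lambert series at the origin\<close>

lemma alternating_inverse_squares_sums:
  "(\<lambda>j. (-1) ^ j / real (Suc j) ^ 2) sums (pi ^ 2 / 12)"
proof -
  have z: "(\<lambda>n. 1 / real (Suc n) ^ 2) sums (pi ^ 2 / 6)"
    using inverse_squares_sums by (simp add: add.commute)
  \<comment> \<open>The signs change where \<open>Suc n\<close> is even, that is at odd indices.
    Twice the part of the series with even denominators is 2/4 of the whole, which is the factor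
    1/2.\<close>
  have "(\<lambda>m. 1 / 2 * (1 / real (Suc m) ^ 2)) sums (1 / 2 * (pi ^ 2 / 6))"
    by (intro sums_mult z)
  from sums_diff[OF z sums_if[OF this sums_zero]]
  have "(\<lambda>n. 1 / real (Suc n) ^ 2 - (if even n then 0 else 1 / 2 * (1 / real (Suc ((n - 1) div 2)) ^ 2))) sums (pi ^ 2 / 12)"
    by (simp add: field_simps)
  also have "(\<lambda>n. 1 / real (Suc n) ^ 2 - (if even n then 0 else 1 / 2 * (1 / real (Suc ((n - 1) div 2)) ^ 2))) =
      (\<lambda>j. (-1) ^ j / real (Suc j) ^ 2)"
  proof
    fix n :: nat
    show "1 / real (Suc n) ^ 2 - (if even n then 0 else 1 / 2 * (1 / real (Suc ((n - 1) div 2)) ^ 2)) = (-1) ^ n / real (Suc n) ^ 2"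
    proof (cases "even n")
      case False
      then obtain m where n: "n = 2 * m + 1" by (auto elim: oddE)
      have "real (Suc n) = 2 * real (Suc m)" by (simp add: n)
      then have "1 / 2 * (1 / real (Suc m) ^ 2) = 2 / real (Suc n) ^ 2" by (simp add: power_mult_distrib del: of_nat_Suc)
      then show ?thesis using False by (simp add: n)
    qed simp
  qed
  finally show ?thesis .
qed

text \<open>The zeros of 1 - exp(-4z) are the integer multiples of i pi/2, and pi/2 > 3/2. This is
  the origin of the radius 3/2 in the extension below.\<close>

lemma exp_neg_4_neq_1:
  fixes z :: complex
  assumes "z \<noteq> 0" "norm z < 3 / 2"
  shows "exp (- 4 * z) \<noteq> 1"
proof
  assume "exp (- 4 * z) = 1"
  then obtain n :: int where n: "Re (- 4 * z) = 0" "Im (- 4 * z) = of_int (2 * n) * pi"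
    unfolding exp_eq_1 by auto
  have "n \<noteq> 0" using n assms(1) by (auto simp: complex_eq_iff)
  then have "1 \<le> \<bar>real_of_int n\<bar>" by linarith
  then have "2 * 1 * pi \<le> 2 * \<bar>real_of_int n\<bar> * pi" by (intro mult_right_mono) auto
  also have "\<dots> = \<bar>2 * of_int n * pi\<bar>" by (simp add: abs_mult)
  also have "2 * of_int n * pi = - (4 * Im z)" using n(2) by simp
  also have "\<bar>\<dots>\<bar> = \<bar>4 * Im z\<bar>" by simp
  also have "\<dots> \<le> 4 * norm z" using abs_Im_le_cmod[of z] by simp
  finally show False using assms(2) pi_gt3 by simp
qed

text \<open>The pole is divided out in two stages: \<open>u\<close> extends (1 - exp(-4z))/z and has
  no zeros, so \<open>v\<close> extends z times \<open>lambert z\<close>, and the difference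
  quotient of \<open>v\<close> at 0 extends the remainder.\<close>

lemma lambert_rem_extension:
  obtains g where "g holomorphic_on ball 0 (3 / 2)" "\<And>z. z \<in> ball 0 (3 / 2) \<Longrightarrow> z \<noteq> 0 \<Longrightarrow> g z = lambert_rem z" "g 0 = - (1 / 4)"
proof -
  let ?B = "ball 0 (3 / 2) :: complex set"
  define u where "u z = (if z = 0 then 4 else (1 - exp (- 4 * z)) / z)" for z :: complex
  have "((\<lambda>z::complex. 1 - exp (- 4 * z)) has_field_derivative 4) (at 0)"
    by (auto intro!: derivative_eq_intros)
  then have d: "deriv (\<lambda>z::complex. 1 - exp (- 4 * z)) 0 = 4" by (rule DERIV_imp_deriv)
  have u: "u holomorphic_on ?B"
    by (rule pole_theorem_open_0[where g = "\<lambda>z. 1 - exp (- 4 * z)" and a = 0])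
       (auto simp: u_def d[simplified] intro!: holomorphic_intros)
  have u0: "u z \<noteq> 0" if "z \<in> ?B" for z
    using exp_neg_4_neq_1[of z] that by (auto simp: u_def)
  define v where "v z = (exp (- z) + exp (- 2 * z) + exp (- 4 * z)) / u z" for z
  have v: "v holomorphic_on ?B"
    unfolding v_def by (intro holomorphic_intros u u0) auto
  have v0: "v 0 = 3 / 4" by (simp add: v_def u_def)
  define g where "g z = (if z = 0 then deriv v 0 else lambert z - v 0 / (z - 0))" for z
  have g: "g holomorphic_on ?B"
    unfolding g_def
    by (rule pole_theorem_open[OF v]) (auto simp: v_def u_def lambert_def)
  have eq: "g z = lambert_rem z" if "z \<noteq> 0" for z
    using that by (simp add: g_def lambert_rem_def v0)
  have "isCont g 0"
    using g by (meson holomorphic_on_imp_continuous_on continuous_on_eq_continuous_at open_ball centre_in_ball zero_less_divide_iff zero_less_numeral)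
  then have lim: "(g \<longlongrightarrow> g 0) (at 0)" by (simp add: isCont_def)
  \<comment> \<open>By continuity the value at 0 can be read off along the positive reals, as the
    limit of an elementary real function. The exponents 1, 2 and 4 contribute 1/4, 0 and -1/2 to
    it.\<close>
  have "filterlim complex_of_real (at 0) (at_right 0)"
    unfolding filterlim_at by (auto intro!: tendsto_eq_intros simp: eventually_at_filter)
  from filterlim_compose[OF lim this] have 1: "((\<lambda>x. g (of_real x)) \<longlongrightarrow> g 0) (at_right 0)" .
  have "\<forall>\<^sub>F x in at_right 0. complex_of_real ((exp (-x) + exp (-2*x) + exp (-4*x)) / (1 - exp (-4*x)) - 3 / (4 * x)) = g (of_real x)"
    unfolding eventually_at_filter by (auto simp: eq lambert_rem_def lambert_def exp_of_real[symmetric])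
  moreover have "((\<lambda>x::real. (exp (-x) + exp (-2*x) + exp (-4*x)) / (1 - exp (-4*x)) - 3 / (4 * x)) \<longlongrightarrow> - (1/4)) (at_right 0)"
    by real_asymp
  then have "((\<lambda>x::real. complex_of_real ((exp (-x) + exp (-2*x) + exp (-4*x)) / (1 - exp (-4*x)) - 3 / (4 * x))) \<longlongrightarrow> of_real (- (1/4))) (at_right 0)"
    by (rule tendsto_of_real)
  ultimately have "((\<lambda>x. g (of_real x)) \<longlongrightarrow> of_real (- (1/4))) (at_right 0)"
    using Lim_transform_eventually by fastforce
  with 1 have "g 0 = of_real (- (1/4))" by (intro tendsto_unique[of "at_right (0::real)"]) auto
  then show ?thesis using that[of g] g eq by simp
qed

lemma lambert_rem_has_derivative:
  assumes "exp (- 4 * z) \<noteq> 1" "z \<noteq> 0"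
  shows "(lambert_rem has_field_derivative
    (((- exp (- z) - 2 * exp (- 2 * z) - 4 * exp (- 4 * z)) * (1 - exp (- 4 * z)) -
      (exp (- z) + exp (- 2 * z) + exp (- 4 * z)) * (4 * exp (- 4 * z))) / (1 - exp (- 4 * z)) ^ 2 + 3 / (4 * z ^ 2))) (at z)"
proof -
  have 1: "((\<lambda>z. exp (- z) + exp (- 2 * z) + exp (- 4 * z)) has_field_derivative
      - exp (- z) - 2 * exp (- 2 * z) - 4 * exp (- 4 * z)) (at z)"
    by (auto intro!: derivative_eq_intros)
  have 2: "((\<lambda>z. 1 - exp (- 4 * z)) has_field_derivative 4 * exp (- 4 * z)) (at z)"
    by (auto intro!: derivative_eq_intros)
  have 3: "((\<lambda>z. 3 / (4 * z)) has_field_derivative - (3 / (4 * z ^ 2))) (at z)"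
    using assms by (auto intro!: derivative_eq_intros simp: field_simps power2_eq_square)
  have "1 - exp (- 4 * z) \<noteq> 0" using assms by simp
  from DERIV_diff[OF DERIV_divide[OF 1 2 this] 3] show ?thesis
    unfolding lambert_rem_def[abs_def] lambert_def by (simp only: power2_eq_square diff_minus_eq_add)
qed

text \<open>In the sector, |z| at least 1 forces Re z to be at least 1/2, which keeps 1 - exp(-4z)
  away from 0, and the factor |z| is absorbed by exp(- Re z). The constant 300 is generous.\<close>

lemma lambert_rem_bounds_far:
  assumes "1 \<le> norm z" "norm z \<le> 2 * Re z"
  shows "norm (lambert_rem z) \<le> 300" "\<exists>d. (lambert_rem has_field_derivative d) (at z) \<and> norm z * norm d \<le> 300"
proof -
  define x where "x = Re z"
  have x: "1 / 2 \<le> x" using assms by (simp add: x_def)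
  define N where "N = exp (- z) + exp (- 2 * z) + exp (- 4 * z)"
  define N' where "N' = - exp (- z) - 2 * exp (- 2 * z) - 4 * exp (- 4 * z)"
  define E where "E = exp (- 4 * z)"
  have mono: "exp (- 2 * x) \<le> exp (- x)" "exp (- 4 * x) \<le> exp (- x)" using x by auto
  have "norm N \<le> exp (- x) + exp (- 2 * x) + exp (- 4 * x)"
    unfolding N_def x_def by (intro norm_triangle_mono) auto
  then have N: "norm N \<le> 3 * exp (- x)" using mono by linarith
  have "norm N' \<le> exp (- x) + 2 * exp (- 2 * x) + 4 * exp (- 4 * x)"
    unfolding N'_def x_def by (intro order_trans[OF norm_triangle_ineq4] add_mono) (auto simp: norm_mult)
  then have N': "norm N' \<le> 7 * exp (- x)" using mono by linarith
  have "exp (- 4 * x) \<le> exp (- 2)" using x by simp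
  also have "exp (- 2 :: real) = 1 / exp 2" by (simp add: exp_minus field_simps)
  also have "\<dots> \<le> 1 / 2" using exp_ge_add_one_self[of 2] by (simp add: field_simps)
  finally have E: "norm E \<le> 1 / 2" by (simp add: E_def x_def)
  have D: "1 / 2 \<le> norm (1 - E)" "norm (1 - E) \<le> 2"
    using norm_triangle_ineq2[of 1 E] norm_triangle_ineq4[of 1 E] E by auto
  have ne: "z \<noteq> 0" "E \<noteq> 1" using assms D by auto
  have ex1: "exp (- x) \<le> 1" using x by simp
  have z3: "norm (3 / (4 * z)) \<le> 3 / 4" using assms(1) ne by (simp add: norm_divide norm_mult field_simps)
  have lambert: "lambert z = N / (1 - E)" by (simp only: lambert_def N_def E_def)
  have "norm (lambert z) \<le> 3 / (1 / 2)"
    unfolding lambert norm_divide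
    using N D(1) ex1 by (intro frac_le order_trans[OF N]) auto
  then show "norm (lambert_rem z) \<le> 300"
    unfolding lambert_rem_def using norm_triangle_ineq4[of "lambert z" "3 / (4 * z)"] z3 by simp
  let ?d = "(N' * (1 - E) - N * (4 * E)) / (1 - E) ^ 2 + 3 / (4 * z ^ 2)"
  have "norm (N' * (1 - E) - N * (4 * E)) \<le> norm N' * norm (1 - E) + norm N * (4 * norm E)"
    using norm_triangle_ineq4[of "N' * (1 - E)" "N * (4 * E)"] by (simp add: norm_mult)
  also have "\<dots> \<le> (7 * exp (- x)) * 2 + (3 * exp (- x)) * (4 * (1 / 2))"
    using N N' D E by (intro add_mono mult_mono) auto
  finally have num: "norm (N' * (1 - E) - N * (4 * E)) \<le> 20 * exp (- x)" by simp
  have "norm ((N' * (1 - E) - N * (4 * E)) / (1 - E) ^ 2) \<le> 20 * exp (- x) / (1 / 2) ^ 2"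
    unfolding norm_divide norm_power using num D by (intro frac_le power_mono) auto
  then have "norm z * norm ((N' * (1 - E) - N * (4 * E)) / (1 - E) ^ 2) \<le> (2 * x) * (80 * exp (- x))"
    using assms(2) x by (intro mult_mono) (auto simp: x_def power2_eq_square)
  also have "\<dots> = 160 * (x * exp (- x))" by simp
  also have "x * exp (- x) \<le> 1"
  proof -
    have "x \<le> exp x" using exp_ge_add_one_self[of x] by linarith
    then show ?thesis by (simp add: exp_minus field_simps)
  qed
  finally have 1: "norm z * norm ((N' * (1 - E) - N * (4 * E)) / (1 - E) ^ 2) \<le> 160" by simp
  have "norm z * norm (3 / (4 * z ^ 2)) = norm (3 / (4 * z))"
    using ne by (simp add: norm_divide norm_mult power2_eq_square)
  then have 2: "norm z * norm (3 / (4 * z ^ 2)) \<le> 3 / 4" using z3 by simp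
  have "norm z * norm ?d \<le> norm z * (norm ((N' * (1 - E) - N * (4 * E)) / (1 - E) ^ 2) + norm (3 / (4 * z ^ 2)))"
    by (intro mult_left_mono norm_triangle_ineq) auto
  also have "\<dots> \<le> 300" using 1 2 by (simp only: distrib_left)
  finally have "norm z * norm ?d \<le> 300" .
  moreover have "(lambert_rem has_field_derivative ?d) (at z)"
    using lambert_rem_has_derivative[of z] ne unfolding N_def N'_def E_def by simp
  ultimately show "\<exists>d. (lambert_rem has_field_derivative d) (at z) \<and> norm z * norm d \<le> 300" by blast
qed

lemma lambert_rem_bounds:
  obtains C where "0 < C" "\<And>z. z \<noteq> 0 \<Longrightarrow> norm z \<le> 2 * Re z \<Longrightarrow> norm (lambert_rem z) \<le> C"
    "\<And>z. z \<noteq> 0 \<Longrightarrow> norm z \<le> 2 * Re z \<Longrightarrow> \<exists>d. (lambert_rem has_field_derivative d) (at z) \<and> norm z * norm d \<le> C"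
    "(lambert_rem \<longlongrightarrow> - (1 / 4)) (at 0)"
proof -
  from lambert_rem_extension obtain g where g: "g holomorphic_on ball 0 (3 / 2)"
    "\<And>z. z \<in> ball 0 (3 / 2) \<Longrightarrow> z \<noteq> 0 \<Longrightarrow> g z = lambert_rem z" "g 0 = - (1 / 4)" by blast
  have sub: "cball 0 1 \<subseteq> ball (0::complex) (3 / 2)" by (simp add: cball_subset_ball_iff)
  have "compact (g ` cball 0 1)"
    by (intro compact_continuous_image holomorphic_on_imp_continuous_on holomorphic_on_subset[OF g(1) sub]) auto
  then obtain C1 where C1: "\<And>z. z \<in> cball 0 1 \<Longrightarrow> norm (g z) \<le> C1"
    by (meson bounded_iff compact_imp_bounded imageI)
  have "deriv g holomorphic_on ball 0 (3 / 2)" by (intro holomorphic_deriv g) auto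
  then have "compact (deriv g ` cball 0 1)"
    by (intro compact_continuous_image holomorphic_on_imp_continuous_on holomorphic_on_subset[OF _ sub]) auto
  then obtain C2 where C2: "\<And>z. z \<in> cball 0 1 \<Longrightarrow> norm (deriv g z) \<le> C2"
    by (meson bounded_iff compact_imp_bounded imageI)
  define C where "C = max 300 (max C1 C2)"
  have ev: "\<forall>\<^sub>F w in nhds z. g w = lambert_rem w" if "z \<noteq> 0" "norm z \<le> 1" for z
  proof -
    have "\<forall>\<^sub>F w in nhds z. w \<in> ball 0 (3 / 2) - {0}"
      using that by (intro eventually_nhds_in_open) auto
    then show ?thesis by eventually_elim (use g(2) in auto)
  qed
  have "isCont g 0"
    using g(1) by (meson holomorphic_on_imp_continuous_on continuous_on_eq_continuous_at open_ball centre_in_ball zero_less_divide_iff zero_less_numeral)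
  then have lim: "(g \<longlongrightarrow> - (1 / 4)) (at 0)" using g(3) by (simp add: isCont_def)
  have "\<forall>\<^sub>F w in at 0. g w = lambert_rem w"
    using g(2) by (intro eventually_at_in_open[THEN eventually_mono, of "ball 0 (3/2)"]) auto
  with lim have L: "(lambert_rem \<longlongrightarrow> - (1 / 4)) (at 0)"
    using Lim_transform_eventually by blast
  show ?thesis
  proof (rule that[of C])
    show "0 < C" by (simp add: C_def)
    fix z :: complex assume z: "z \<noteq> 0" "norm z \<le> 2 * Re z"
    show "norm (lambert_rem z) \<le> C"
    proof (cases "norm z \<le> 1")
      case True
      then have "g z = lambert_rem z" using z by (intro g(2)) auto
      then show ?thesis using C1[of z] True by (simp add: C_def)
    next
      case False
      then show ?thesis using lambert_rem_bounds_far(1)[of z] z by (simp add: C_def)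
    qed
    show "\<exists>d. (lambert_rem has_field_derivative d) (at z) \<and> norm z * norm d \<le> C"
    proof (cases "norm z \<le> 1")
      case True
      have "(g has_field_derivative deriv g z) (at z)"
        using True by (intro holomorphic_derivI[OF g(1)]) auto
      then have "(lambert_rem has_field_derivative deriv g z) (at z)"
        using DERIV_cong_ev[OF refl ev[OF z(1) True] refl] by simp
      moreover have "norm z * norm (deriv g z) \<le> 1 * C2"
        using C2[of z] True by (intro mult_mono) auto
      ultimately show ?thesis by (auto simp: C_def)
    next
      case False
      then show ?thesis using lambert_rem_bounds_far(2)[of z] z by (force simp: C_def)
    qed
  qed (fact L)
qed

text \<open>The sector is convex, so it contains the segment from j z to (j+1) z. The derivative
  there is at most C/(j |z|), and the length |z| of the segment removes the dependence on z.\<close>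

lemma lambert_rem_diff:
  assumes C: "\<And>z. z \<noteq> 0 \<Longrightarrow> norm z \<le> 2 * Re z \<Longrightarrow> \<exists>d. (lambert_rem has_field_derivative d) (at z) \<and> norm z * norm d \<le> C"
    and z: "z \<noteq> 0" "norm z \<le> 2 * Re z" and j: "0 < j"
  shows "norm (lambert_rem (of_nat (Suc j) * z) - lambert_rem (of_nat j * z)) \<le> C / real j"
proof -
  have nz: "0 < norm z" using z by simp
  have 1: "w \<noteq> 0 \<and> norm w \<le> 2 * Re w \<and> real j * norm z \<le> norm w"
    if "w \<in> closed_segment (of_nat (Suc j) * z) (of_nat j * z)" for w
  proof -
    from that obtain u where u: "0 \<le> u" "u \<le> 1" and w: "w = (1 - u) *\<^sub>R (of_nat (Suc j) * z) + u *\<^sub>R (of_nat j * z)"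
      unfolding closed_segment_def by blast
    define r where "r = real j + (1 - u)"
    have r: "w = of_real r * z" "real j \<le> r"
      using u by (simp_all add: w r_def scaleR_conv_of_real algebra_simps)
    have "norm w = r * norm z" using r j by (simp add: norm_mult)
    moreover have "r * norm z \<le> r * (2 * Re z)" using r j z by (intro mult_left_mono) auto
    moreover have "Re w = r * Re z" by (simp add: r)
    moreover have "real j * norm z \<le> r * norm z" using r by (intro mult_right_mono) auto
    ultimately show ?thesis using r z j by auto
  qed
  define d where "d w = (SOME d. (lambert_rem has_field_derivative d) (at w) \<and> norm w * norm d \<le> C)" for w
  have d: "(lambert_rem has_field_derivative d w) (at w) \<and> norm w * norm (d w) \<le> C"
    if "w \<in> closed_segment (of_nat (Suc j) * z) (of_nat j * z)" for w
    unfolding d_def by (rule someI_ex, rule C) (use 1[OF that] in auto)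
  have "norm (lambert_rem (of_nat (Suc j) * z) - lambert_rem (of_nat j * z)) \<le>
      C / (real j * norm z) * norm (of_nat (Suc j) * z - of_nat j * z)"
  proof (rule field_differentiable_bound[where f' = d])
    fix w assume w: "w \<in> closed_segment (of_nat (Suc j) * z) (of_nat j * z)"
    show "(lambert_rem has_field_derivative d w) (at w within closed_segment (of_nat (Suc j) * z) (of_nat j * z))"
      using d[OF w] has_field_derivative_at_within by blast
    have "(real j * norm z) * norm (d w) \<le> norm w * norm (d w)"
      using 1[OF w] by (intro mult_right_mono) auto
    then have "(real j * norm z) * norm (d w) \<le> C" using d[OF w] by linarith
    then show "norm (d w) \<le> C / (real j * norm z)"
      using nz j by (simp add: field_simps)
  qed auto
  also have "of_nat (Suc j) * z - of_nat j * z = z" by (simp add: algebra_simps)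
  finally show ?thesis using nz by simp
qed

text \<open>The pole of \<open>lambert\<close> contributes 3/4 times the alternating sum pi^2/12 of
  inverse squares, and the value -1/4 of the remainder at 0 contributes -1/4 times the alternating
  harmonic series. An arbitrary filter lets one statement serve both for real z and for z moving
  along with the scaled angle.\<close>

lemma log_gf_asymp:
  assumes lim: "filterlim f (at 0) F" and sect: "\<forall>\<^sub>F x in F. norm (f x) \<le> 2 * Re (f x)" and F: "F \<noteq> bot"
  shows "((\<lambda>x. log_gf (f x) - of_real (pi ^ 2 / 16) / f x) \<longlongrightarrow> of_real (- (ln 2 / 4))) F"
proof -
  obtain C where C: "0 < C" "\<And>z. z \<noteq> 0 \<Longrightarrow> norm z \<le> 2 * Re z \<Longrightarrow> norm (lambert_rem z) \<le> C"
    "\<And>z. z \<noteq> 0 \<Longrightarrow> norm z \<le> 2 * Re z \<Longrightarrow> \<exists>d. (lambert_rem has_field_derivative d) (at z) \<and> norm z * norm d \<le> C"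
    and L: "(lambert_rem \<longlongrightarrow> - (1 / 4)) (at 0)"
    using lambert_rem_bounds by metis
  let ?t = "\<lambda>z m. lambert_rem (of_nat (2 * m + 1) * z) / of_nat (2 * m + 1) - lambert_rem (of_nat (2 * m + 2) * z) / of_nat (2 * m + 2)"
  have eq: "log_gf z - of_real (pi ^ 2 / 16) / z = (\<Sum>m. ?t z m)" if z: "z \<noteq> 0" "norm z \<le> 2 * Re z" for z
  proof -
    have "0 < norm z" using z by simp
    then have re: "0 < Re z" using z(2) by linarith
    have "(\<lambda>j. complex_of_real ((-1) ^ j / real (Suc j) ^ 2)) sums of_real (pi ^ 2 / 12)"
      by (rule sums_of_real[OF alternating_inverse_squares_sums])
    then have "(\<lambda>j. 3 / (4 * z) * complex_of_real ((-1) ^ j / real (Suc j) ^ 2)) sums (3 / (4 * z) * of_real (pi ^ 2 / 12))"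
      by (rule sums_mult)
    from sums_diff[OF summable_sums[OF summable_log_gf[OF re]] this]
    have "(\<lambda>j. (-1) ^ j / of_nat (Suc j) * lambert (of_nat (Suc j) * z) - 3 / (4 * z) * complex_of_real ((-1) ^ j / real (Suc j) ^ 2))
      sums (log_gf z - 3 / (4 * z) * of_real (pi ^ 2 / 12))"
      by (simp only: log_gf_def)
    also have "(\<lambda>j. (-1) ^ j / of_nat (Suc j) * lambert (of_nat (Suc j) * z) - 3 / (4 * z) * complex_of_real ((-1) ^ j / real (Suc j) ^ 2)) =
        (\<lambda>j. (-1) ^ j * (lambert_rem (of_nat (Suc j) * z) / of_nat (Suc j)))"
      using z(1) by (auto simp: lambert_rem_def power2_eq_square diff_divide_distrib right_diff_distrib mult_ac simp del: of_nat_Suc)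
    also have "3 / (4 * z) * of_real (pi ^ 2 / 12) = of_real (pi ^ 2 / 16) / z"
      using z(1) by (simp add: field_simps)
    finally have "(\<lambda>j. (-1) ^ j * (lambert_rem (of_nat (Suc j) * z) / of_nat (Suc j))) sums (log_gf z - of_real (pi ^ 2 / 16) / z)" .
    from sums_group[OF this, of 2]
    have "(\<lambda>m. \<Sum>j = m * 2..<m * 2 + 2. (-1) ^ j * (lambert_rem (of_nat (Suc j) * z) / of_nat (Suc j))) sums (log_gf z - of_real (pi ^ 2 / 16) / z)"
      by simp
    moreover have "(\<Sum>j = m * 2..<m * 2 + 2. (-1) ^ j * (lambert_rem (of_nat (Suc j) * z) / of_nat (Suc j))) = ?t z m" for m
    proof -
      have "{m * 2..<m * 2 + 2} = {2 * m, 2 * m + 1}" by auto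
      then show ?thesis by simp
    qed
    ultimately show ?thesis by (simp add: sums_iff)
  qed
  have bound: "norm (?t z m) \<le> 2 * C / (real (Suc m)) ^ 2" if z: "z \<noteq> 0" "norm z \<le> 2 * Re z" for z m
  proof -
    let ?a = "2 * m + 1" and ?b = "2 * m + 2"
    have 1: "norm (lambert_rem (of_nat ?a * z)) \<le> C"
    proof (rule C(2))
      have "real ?a * norm z \<le> real ?a * (2 * Re z)" using z(2) by (intro mult_left_mono) auto
      also have "\<dots> = 2 * Re (of_nat ?a * z)" by simp
      finally show "norm (of_nat ?a * z) \<le> 2 * Re (of_nat ?a * z)"
        unfolding norm_mult norm_of_nat .
      show "of_nat ?a * z \<noteq> 0" unfolding mult_eq_0_iff of_nat_eq_0_iff using z(1) by simp
    qed
    have 2: "norm (lambert_rem (of_nat ?b * z) - lambert_rem (of_nat ?a * z)) \<le> C / real ?a"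
      using lambert_rem_diff[OF C(3) z, of ?a] by simp
    \<comment> \<open>The first term gains from the small difference of the reciprocals, the second
      from the slow variation of \<open>lambert_rem\<close>; each is of order 1/m^2, uniformly in
      z.\<close>
    have "?t z m = lambert_rem (of_nat ?a * z) * (1 / of_nat ?a - 1 / of_nat ?b) -
        (lambert_rem (of_nat ?b * z) - lambert_rem (of_nat ?a * z)) / of_nat ?b"
      by (simp only: diff_divide_distrib right_diff_distrib mult_1_right times_divide_eq_right) simp
    also have "1 / of_nat ?a - 1 / of_nat ?b = complex_of_real (1 / (real ?a * real ?b))"
    proof -
      have "1 / real ?a - 1 / real ?b = 1 / (real ?a * real ?b)" by (simp add: field_simps)
      then have "complex_of_real (1 / real ?a - 1 / real ?b) = of_real (1 / (real ?a * real ?b))"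
        by (rule arg_cong)
      then show ?thesis by (simp only: of_real_diff of_real_divide of_real_1 of_real_of_nat_eq)
    qed
    finally have "norm (?t z m) \<le> norm (lambert_rem (of_nat ?a * z) * complex_of_real (1 / (real ?a * real ?b))) +
        norm ((lambert_rem (of_nat ?b * z) - lambert_rem (of_nat ?a * z)) / of_nat ?b)"
      using norm_triangle_ineq4 by metis
    also have "\<dots> = norm (lambert_rem (of_nat ?a * z)) * (1 / (real ?a * real ?b)) +
        norm (lambert_rem (of_nat ?b * z) - lambert_rem (of_nat ?a * z)) / real ?b"
      by (simp only: norm_mult norm_divide norm_of_real norm_of_nat) simp
    also have "\<dots> \<le> C * (1 / (real ?a * real ?b)) + C / real ?a / real ?b"
      by (intro add_mono mult_right_mono divide_right_mono 1 2) auto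
    also have "\<dots> = 2 * C / (real ?a * real ?b)" by (simp add: field_simps)
    also have "\<dots> \<le> 2 * C / (real (Suc m)) ^ 2"
      unfolding power2_eq_square using C(1) by (intro divide_left_mono mult_mono) auto
    finally show ?thesis .
  qed
  let ?l = "\<lambda>m. - (1 / 4) / of_nat (2 * m + 1) - (- (1 / 4)) / of_nat (2 * m + 2) :: complex"
  have ne: "\<forall>\<^sub>F x in F. f x \<noteq> 0" using lim by (simp add: filterlim_at)
  have T: "((\<lambda>x. \<Sum>m. ?t (f x) m) \<longlongrightarrow> (\<Sum>m. ?l m)) F"
  proof (rule conjunct2[OF conjunct2[OF tannerys_theorem]])
    fix m
    have sc: "((\<lambda>x. lambert_rem (of_nat k * f x)) \<longlongrightarrow> - (1 / 4)) F" if "0 < k" for k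
    proof (rule filterlim_compose[OF L])
      have "((\<lambda>x. of_nat k * f x) \<longlongrightarrow> of_nat k * 0) F"
        using lim by (intro tendsto_intros) (simp add: filterlim_at)
      then show "filterlim (\<lambda>x. of_nat k * f x) (at 0) F"
        unfolding filterlim_at using ne that by (auto elim: eventually_mono)
    qed
    show "((\<lambda>x. ?t (f x) m) \<longlongrightarrow> ?l m) F"
      by (intro tendsto_diff tendsto_divide sc tendsto_const; (unfold of_nat_eq_0_iff)?) simp_all
  next
    have "\<forall>\<^sub>F x in F. \<forall>m. norm (?t (f x) m) \<le> 2 * C / (real (Suc m)) ^ 2"
      using ne sect by eventually_elim (use bound in auto)
    then show "\<forall>\<^sub>F (m, x) in at_top \<times>\<^sub>F F. norm (?t (f x) m) \<le> 2 * C / (real (Suc m)) ^ 2"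
      unfolding eventually_prod_filter by (intro exI[of _ "\<lambda>_. True"] exI conjI) auto
    have "summable (\<lambda>m. 2 * C * (1 / (real (Suc m)) ^ 2))"
      using inverse_squares_sums by (intro summable_mult) (simp add: sums_iff add.commute)
    then show "summable (\<lambda>m. 2 * C / (real (Suc m)) ^ 2)" by simp
  qed (fact F)
  have "(\<lambda>m. \<Sum>k = m * 2..<m * 2 + 2. (-1) ^ k / real (Suc k)) sums ln 2"
    using sums_group[OF alternating_harmonic_series_sums, of 2] by simp
  moreover have "(\<Sum>k = m * 2..<m * 2 + 2. (-1) ^ k / real (Suc k)) = 1 / real (2 * m + 1) - 1 / real (2 * m + 2)" for m
  proof -
    have "{m * 2..<m * 2 + 2} = {2 * m, 2 * m + 1}" by auto
    then show ?thesis by simp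
  qed
  ultimately have "(\<lambda>m. - (1 / 4) * (1 / real (2 * m + 1) - 1 / real (2 * m + 2))) sums (- (1 / 4) * ln 2)"
    by (intro sums_mult) simp
  from sums_of_real[OF this, where 'a = complex] have "(\<lambda>m. ?l m) sums of_real (- (1 / 4) * ln 2)"
    by (simp add: algebra_simps)
  then have "(\<Sum>m. ?l m) = of_real (- (ln 2 / 4))" by (simp add: sums_iff)
  moreover have "\<forall>\<^sub>F x in F. (\<Sum>m. ?t (f x) m) = log_gf (f x) - of_real (pi ^ 2 / 16) / f x"
    using ne sect by eventually_elim (use eq in auto)
  ultimately show ?thesis using T Lim_transform_eventually by fastforce
qed

subsection \<open>Decay away from the positive axis\<close>

definition gap_total :: "complex \<Rightarrow> complex" where
  "gap_total z = (\<Sum>k. gap_gf (exp (- z)) 0 k)"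

definition gap_total_real :: "real \<Rightarrow> real" where
  "gap_total_real t = (\<Sum>k. gap_gf (exp (- t)) 0 k)"

lemma gap_total_eq_exp: "0 < Re z \<Longrightarrow> gap_total z = exp (log_gf z)"
  using gap_gf_prod[of "exp (- z)"] exp_log_gf[of z] LIMSEQ_unique
  by (auto simp: gap_total_def)

lemma gap_total_of_real:
  assumes "0 < t"
  shows "gap_total (of_real t) = of_real (gap_total_real t)"
proof -
  have "((\<lambda>n. of_real (real (card (gap_partitions n)) * exp (- t) ^ n)) has_sum complex_of_real (gap_total_real t)) UNIV"
    unfolding gap_total_real_def using assms by (intro has_sum_of_real has_sum_gap_partitions) auto
  moreover have "((\<lambda>n. of_nat (card (gap_partitions n)) * exp (- of_real t) ^ n) has_sum gap_total (of_real t)) UNIV"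
    unfolding gap_total_def using assms by (intro has_sum_gap_partitions) auto
  ultimately show ?thesis
    by (simp add: exp_of_real[symmetric] has_sum_unique)
qed

text \<open>The squared modulus is (1+r)^2 - 2r(1 - cos \<phi>). As (1+r)^2 is at most 4, the loss
  is at least (1+r)^2 times r(1 - cos \<phi>)/2, and the square root halves the resulting
  exponent.\<close>

lemma norm_one_plus_cis_le:
  assumes "0 \<le> r" "r \<le> 1"
  shows "norm (1 + of_real r * cis \<phi>) \<le> (1 + r) * exp (- (r * (1 - cos \<phi>) / 4))"
proof (rule power2_le_imp_le)
  have "norm (1 + of_real r * cis \<phi>) ^ 2 = (1 + r * cos \<phi>) ^ 2 + (r * sin \<phi>) ^ 2"
    by (simp add: cmod_power2)
  also have "\<dots> = 1 + 2 * r * cos \<phi> + r ^ 2 * ((cos \<phi>) ^ 2 + (sin \<phi>) ^ 2)"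
    by (simp add: power2_eq_square algebra_simps del: sin_cos_squared_add sin_cos_squared_add2 sin_cos_squared_add3)
  also have "\<dots> = (1 + r) ^ 2 - 2 * (r * (1 - cos \<phi>))"
    by (simp add: power2_eq_square algebra_simps)
  also have "\<dots> \<le> (1 + r) ^ 2 - (1 + r) ^ 2 / 2 * (r * (1 - cos \<phi>))"
  proof -
    have "(1 + r) ^ 2 \<le> 2 ^ 2" using assms by (intro power_mono) auto
    then have "(1 + r) ^ 2 / 2 * (r * (1 - cos \<phi>)) \<le> 2 * (r * (1 - cos \<phi>))"
      using assms by (intro mult_right_mono mult_nonneg_nonneg) auto
    then show ?thesis by simp
  qed
  also have "\<dots> = (1 + r) ^ 2 * (1 + - (r * (1 - cos \<phi>) / 2))" by (simp add: algebra_simps)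
  also have "\<dots> \<le> (1 + r) ^ 2 * exp (- (r * (1 - cos \<phi>) / 2))"
    by (intro mult_left_mono exp_ge_add_one_self) auto
  also have "\<dots> = ((1 + r) * exp (- (r * (1 - cos \<phi>) / 4))) ^ 2"
    by (simp add: power_mult_distrib exp_double[symmetric])
  finally show "norm (1 + of_real r * cis \<phi>) ^ 2 \<le> ((1 + r) * exp (- (r * (1 - cos \<phi>) / 4))) ^ 2" .
qed (use assms in auto)

text \<open>One quarter of this is a guaranteed decrease of log |1 + q^m| when q turns from exp(-t)
  to the angle \<theta>.\<close>

definition damp :: "real \<Rightarrow> real \<Rightarrow> nat \<Rightarrow> real" where
  "damp t \<theta> m = exp (- t) ^ m * (1 - cos (real m * \<theta>))"

lemma damp_nonneg: "0 \<le> damp t \<theta> m"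
  by (simp add: damp_def)

text \<open>A sequence \<open>s\<close> below the total damping, instead of the damping itself, lets
  each application keep only the factors that help it. The sign in
  \<open>Complex t (- \<theta>)\<close> makes \<theta> the argument of q.\<close>

lemma norm_gap_total_le:
  assumes t: "0 < t" and lim: "s \<longlonglongrightarrow> E"
    and le: "\<And>N. s N \<le> (\<Sum>i<N. damp t \<theta> (4 * i + 1) + damp t \<theta> (4 * i + 2) + damp t \<theta> (4 * i + 4))"
  shows "norm (gap_total (Complex t (- \<theta>))) \<le> gap_total_real t * exp (- (E / 4))"
proof -
  let ?z = "Complex t (- \<theta>)"
  let ?q = "exp (- t)"
  have q: "0 \<le> ?q ^ m" "?q ^ m \<le> 1" for m using t by (auto intro!: power_le_one)
  have pw: "exp (- ?z) ^ m = of_real (?q ^ m) * cis (real m * \<theta>)" for m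
  proof -
    have "exp (- ?z) = of_real ?q * cis \<theta>" by (simp add: exp_eq_polar)
    then show ?thesis by (simp add: power_mult_distrib Complex.DeMoivre)
  qed
  have fac: "norm (1 + exp (- ?z) ^ m) \<le> (1 + ?q ^ m) * exp (- (damp t \<theta> m / 4))" for m
    unfolding pw damp_def by (rule norm_one_plus_cis_le[OF q])
  have "norm (\<Prod>i<N. (1 + exp (- ?z) ^ (4 * i + 1)) * (1 + exp (- ?z) ^ (4 * i + 2)) * (1 + exp (- ?z) ^ (4 * i + 4))) \<le>
    (\<Prod>i<N. (1 + ?q ^ (4 * i + 1)) * (1 + ?q ^ (4 * i + 2)) * (1 + ?q ^ (4 * i + 4))) * exp (- (s N / 4))" (is "norm (?P N) \<le> ?R N * _") for N
  proof -
    have "norm (?P N) \<le> (\<Prod>i<N. ((1 + ?q ^ (4 * i + 1)) * exp (- (damp t \<theta> (4 * i + 1) / 4))) *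
      ((1 + ?q ^ (4 * i + 2)) * exp (- (damp t \<theta> (4 * i + 2) / 4))) * ((1 + ?q ^ (4 * i + 4)) * exp (- (damp t \<theta> (4 * i + 4) / 4))))"
      unfolding prod_norm[symmetric] norm_mult
      by (intro prod_mono conjI mult_mono fac mult_nonneg_nonneg) (use q in \<open>auto intro: add_nonneg_nonneg\<close>)
    also have "\<dots> = ?R N * (\<Prod>i<N. exp (- ((damp t \<theta> (4 * i + 1) + damp t \<theta> (4 * i + 2) + damp t \<theta> (4 * i + 4)) / 4)))"
      unfolding prod.distrib[symmetric]
      by (intro prod.cong refl) (simp add: exp_add[symmetric] mult_exp_exp add_divide_distrib algebra_simps)
    also have "(\<Prod>i<N. exp (- ((damp t \<theta> (4 * i + 1) + damp t \<theta> (4 * i + 2) + damp t \<theta> (4 * i + 4)) / 4))) =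
      exp (- ((\<Sum>i<N. damp t \<theta> (4 * i + 1) + damp t \<theta> (4 * i + 2) + damp t \<theta> (4 * i + 4)) / 4))"
      by (simp add: exp_sum[symmetric] sum_negf sum_divide_distrib)
    also have "?R N * \<dots> \<le> ?R N * exp (- (s N / 4))"
      using le[of N] q by (intro mult_left_mono prod_nonneg) (auto intro!: mult_nonneg_nonneg add_nonneg_nonneg)
    finally show ?thesis .
  qed
  moreover have "?P \<longlonglongrightarrow> gap_total ?z"
    unfolding gap_total_def using t by (intro gap_gf_prod) auto
  moreover have "?R \<longlonglongrightarrow> gap_total_real t"
    unfolding gap_total_real_def using t by (intro gap_gf_prod) auto
  ultimately show ?thesis
    by (intro LIMSEQ_le[of "\<lambda>N. norm (?P N)" _ "\<lambda>N. ?R N * exp (- (s N / 4))"] tendsto_norm tendsto_mult tendsto_exp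
        tendsto_minus tendsto_divide lim tendsto_const) auto
qed

text \<open>The cosine series is the real part of the geometric series at w = x exp(i \<psi>), with
  |1 - w|^2 = (1-x)^2 + 2x(1 - cos \<psi>).\<close>

lemma geometric_cos_sums:
  fixes x \<psi> :: real
  assumes "0 \<le> x" "x < 1"
  shows "(\<lambda>k. x ^ k * (1 - cos (real k * \<psi>))) sums
    (x * (1 + x) * (1 - cos \<psi>) / ((1 - x) * ((1 - x) ^ 2 + 2 * x * (1 - cos \<psi>))))"
proof -
  define c where "c = 1 - cos \<psi>"
  define D where "D = (1 - x) ^ 2 + 2 * x * c"
  have D: "D > 0" using assms by (auto simp: D_def c_def intro!: add_pos_nonneg)
  define w where "w = of_real x * cis \<psi>"
  have w: "norm w < 1" using assms by (simp add: w_def norm_mult)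
  have "(\<lambda>k. Re (w ^ k)) sums Re (1 / (1 - w))"
    by (intro sums_Re geometric_sums w)
  moreover have "Re (w ^ k) = x ^ k * cos (real k * \<psi>)" for k
    by (simp add: w_def power_mult_distrib Complex.DeMoivre flip: of_real_power)
  moreover have "Re (1 / (1 - w)) = (1 - x * (1 - c)) / D"
  proof -
    have "(1 - x * cos \<psi>) ^ 2 + (x * sin \<psi>) ^ 2 = 1 - 2 * x * cos \<psi> + x ^ 2 * ((cos \<psi>) ^ 2 + (sin \<psi>) ^ 2)"
      by (simp add: power2_eq_square algebra_simps del: sin_cos_squared_add sin_cos_squared_add2 sin_cos_squared_add3)
    also have "\<dots> = D" by (simp add: D_def c_def power2_eq_square algebra_simps)
    finally show ?thesis by (simp add: w_def Re_divide c_def)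
  qed
  ultimately have "(\<lambda>k. x ^ k - x ^ k * cos (real k * \<psi>)) sums (1 / (1 - x) - (1 - x * (1 - c)) / D)"
    using assms by (intro sums_diff geometric_sums) auto
  also have "1 / (1 - x) - (1 - x * (1 - c)) / D = (D - (1 - x) * (1 - x * (1 - c))) / ((1 - x) * D)"
    using assms D by (simp add: field_simps)
  also have "D - (1 - x) * (1 - x * (1 - c)) = x * (1 + x) * c"
    by (simp add: D_def power2_eq_square algebra_simps)
  finally show ?thesis by (simp add: D_def c_def right_diff_distrib)
qed

lemma abs_sin_ge_half:
  assumes "\<bar>x\<bar> \<le> pi / 2"
  shows "\<bar>x\<bar> / 2 \<le> \<bar>sin x\<bar>"
proof -
  have small: "5 / 6 * y \<le> sin y" if "0 \<le> y" "y \<le> 1" for y :: real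
  proof -
    have "\<bar>sin y - y\<bar> \<le> \<bar>y\<bar> ^ 3 / 6"
      using Maclaurin_sin_bound[of y 3] by (simp add: sin_coeff_def eval_nat_numeral lessThan_Suc)
    then have "y - y ^ 3 / 6 \<le> sin y" using that by linarith
    moreover have "y ^ 3 \<le> y ^ 1" using that by (intro power_decreasing) auto
    ultimately show ?thesis by simp
  qed
  have pos: "y / 2 \<le> sin y" if y: "0 \<le> y" "y \<le> pi / 2" for y
  proof (cases "y \<le> 1")
    case True
    then show ?thesis using small[of y] y by simp
  next
    case False
    then have "sin 1 \<le> sin y" using y by (intro sin_monotone_2pi_le) auto
    \<comment> \<open>The number 5/3 lies between pi/2 and 2 sin 1, since sin 1 is at least
      5/6.\<close>
    moreover have "y \<le> 5 / 3" using y pi_approx by simp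
    ultimately show ?thesis using small[of 1] by simp
  qed
  show ?thesis using pos[of x] pos[of "- x"] assms by (cases "0 \<le> x") auto
qed


text \<open>If 2xC is at most (1-x)^2, the denominator is at most 16 t^3 and the numerator at least
  C/3. Otherwise the denominator is at most 8 t x C, and C cancels. For C of order \<theta>^2 the
  change occurs at angles of order t.\<close>

lemma geometric_cos_lower:
  fixes x C t :: real
  assumes t: "0 < t" and x: "1 / 3 \<le> x" "x < 1" "1 - x \<le> 2 * t" and C: "0 \<le> C"
  shows "min (C / (48 * t ^ 3)) (1 / (8 * t)) \<le> x * (1 + x) * C / ((1 - x) * ((1 - x) ^ 2 + 2 * x * C))"
proof -
  define y where "y = 1 - x"
  have y: "0 < y" "y \<le> 2 * t" using x by (auto simp: y_def)
  have D: "0 < y ^ 2 + 2 * x * C" using y x C by (intro add_pos_nonneg) auto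
  have xx: "x * C \<le> x * (1 + x) * C" using x C by (intro mult_right_mono) auto
  show ?thesis
  proof (cases "2 * x * C \<le> y ^ 2")
    case True
    have "y ^ 3 \<le> (2 * t) ^ 3" using y by (intro power_mono) auto
    then have y3: "2 * y ^ 3 \<le> 16 * t ^ 3" by (simp add: power_mult_distrib)
    have "y * (y ^ 2 + 2 * x * C) \<le> y * (2 * y ^ 2)" using y True by (intro mult_left_mono) auto
    also have "\<dots> = 2 * y ^ 3" by (simp add: power2_eq_square power3_eq_cube)
    also note y3
    finally have le: "y * (y ^ 2 + 2 * x * C) \<le> 16 * t ^ 3" .
    have "1 / 3 * C \<le> x * C" using x C by (intro mult_right_mono) auto
    with le have "(C / 3) / (16 * t ^ 3) \<le> x * (1 + x) * C / (y * (y ^ 2 + 2 * x * C))"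
      using xx y D C t by (intro frac_le) auto
    then show ?thesis by (simp add: y_def min.coboundedI1)
  next
    case False
    then have "0 < x * C" using zero_le_power2[of y] by linarith
    have "y ^ 2 + 2 * x * C \<le> 4 * (x * C)" using False by linarith
    then have "y * (y ^ 2 + 2 * x * C) \<le> y * (4 * (x * C))" using y by (intro mult_left_mono) auto
    also have "\<dots> \<le> 2 * t * (4 * (x * C))" using y \<open>0 < x * C\<close> by (intro mult_right_mono) auto
    finally have "x * C / (2 * t * (4 * (x * C))) \<le> x * (1 + x) * C / (y * (y ^ 2 + 2 * x * C))"
      using xx y D C t \<open>0 < x * C\<close> x by (intro frac_le) auto
    moreover have "x * C / (2 * t * (4 * (x * C))) = 1 / (8 * t)"
    proof -
      have "x \<noteq> 0" "C \<noteq> 0" using \<open>0 < x * C\<close> by auto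
      then show ?thesis by simp
    qed
    ultimately show ?thesis by (simp add: y_def min.coboundedI2)
  qed
qed

lemma exp_neg_1_ge: "1 / 3 \<le> exp (- 1 :: real)"
  using exp_le by (simp add: exp_minus field_simps)

text \<open>Only even m are kept: they form a series in q^2 at the angle 2\<theta>, and 1 -
  cos(2\<theta>) = 2 sin(\<theta>)^2 is at least \<delta>^2/2. Here \<delta> stands for the distance
  of \<theta> to 0 or to pi. The constant 400 rounds up 4 * 96, with 96 = 2 * 48.\<close>

lemma norm_gap_total_le_sin:
  assumes t: "0 < t" "t \<le> 1 / 8" and d: "0 \<le> \<delta>" "\<delta> / 2 \<le> \<bar>sin \<theta>\<bar>"
  shows "norm (gap_total (Complex t (- \<theta>))) \<le> gap_total_real t * exp (- (min (\<delta> ^ 2 / t ^ 3) (1 / t) / 400))"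
proof -
  define x where "x = exp (- t) ^ 2"
  define C where "C = 1 - cos (2 * \<theta>)"
  have xe: "x = exp (- (2 * t))" using exp_double[of "- t"] by (simp add: x_def)
  have x: "1 / 3 \<le> x" "x < 1" "1 - x \<le> 2 * t"
  proof -
    have "exp (- 1) \<le> exp (- (2 * t))" using t by simp
    then show "1 / 3 \<le> x" using exp_neg_1_ge unfolding xe by linarith
    show "x < 1" using t by (simp add: xe)
    show "1 - x \<le> 2 * t" using exp_ge_add_one_self[of "- (2 * t)"] unfolding xe by linarith
  qed
  have "\<delta> ^ 2 / 4 \<le> (sin \<theta>) ^ 2"
    using power_mono[OF d(2), of 2] d(1) by (simp add: power_divide)
  then have C: "\<delta> ^ 2 / 2 \<le> C" by (simp add: C_def cos_double_sin)
  define E where "E = x * (1 + x) * C / ((1 - x) * ((1 - x) ^ 2 + 2 * x * C))"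
  have "0 \<le> C" by (simp add: C_def)
  then have low: "min (C / (48 * t ^ 3)) (1 / (8 * t)) \<le> E"
    unfolding E_def using x t by (intro geometric_cos_lower) auto
  have "\<delta> ^ 2 / t ^ 3 / 96 \<le> C / (48 * t ^ 3)" using C t by (simp add: field_simps)
  moreover have "1 / t / 96 \<le> 1 / (8 * t)" using t by (simp add: field_simps)
  moreover have "min a b / 96 \<le> min c d" if "a / 96 \<le> c" "b / 96 \<le> d" for a b c d :: real
    using that by (auto simp: min_def)
  ultimately have "min (\<delta> ^ 2 / t ^ 3) (1 / t) / 96 \<le> min (C / (48 * t ^ 3)) (1 / (8 * t))"
    by blast
  moreover have "0 \<le> min (\<delta> ^ 2 / t ^ 3) (1 / t)" using t by simp
  moreover have "a / 400 \<le> E / 4" if "a / 96 \<le> b" "0 \<le> a" "b \<le> E" for a b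
    using that by simp
  ultimately have E: "min (\<delta> ^ 2 / t ^ 3) (1 / t) / 400 \<le> E / 4" using low by blast
  have "(\<lambda>k. x ^ k * (1 - cos (real k * (2 * \<theta>)))) sums E"
    unfolding E_def C_def using x by (intro geometric_cos_sums) auto
  then have "(\<lambda>N. \<Sum>k<N. x ^ k * (1 - cos (real k * (2 * \<theta>)))) \<longlonglongrightarrow> E" by (simp add: sums_def)
  \<comment> \<open>The index k = 0 contributes 0, and k = 1, ..., 2N give the exponents 2, 4, ...,
    4N, which are exactly the even ones among the first N blocks.\<close>
  from LIMSEQ_subseq_LIMSEQ[OF this, of "\<lambda>N. 2 * N + 1"]
  have lim: "(\<lambda>N. \<Sum>k<2 * N + 1. x ^ k * (1 - cos (real k * (2 * \<theta>)))) \<longlonglongrightarrow> E"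
    by (simp add: strict_mono_def o_def)
  have summand: "x ^ k * (1 - cos (real k * (2 * \<theta>))) = damp t \<theta> (2 * k)" for k
  proof -
    have "x ^ k = exp (- t) ^ (2 * k)" by (simp only: x_def power_mult)
    moreover have "real k * (2 * \<theta>) = real (2 * k) * \<theta>" by simp
    ultimately show ?thesis by (simp only: damp_def)
  qed
  have eq: "(\<Sum>k<2 * N + 1. x ^ k * (1 - cos (real k * (2 * \<theta>)))) = (\<Sum>i<N. damp t \<theta> (4 * i + 2) + damp t \<theta> (4 * i + 4))" for N
    unfolding summand
  proof (induction N)
    case 0
    show ?case by (simp add: damp_def)
  next
    case (Suc N)
    have 1: "2 * Suc N + 1 = Suc (Suc (2 * N + 1))" "2 * (2 * N + 1) = 4 * N + 2" "2 * Suc (2 * N + 1) = 4 * N + 4"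
      by simp_all
    show ?case unfolding 1(1) sum.lessThan_Suc 1(2,3) Suc.IH by simp
  qed
  have "norm (gap_total (Complex t (- \<theta>))) \<le> gap_total_real t * exp (- (E / 4))"
    using t(1) lim
  proof (rule norm_gap_total_le)
    show "(\<Sum>k<2 * N + 1. x ^ k * (1 - cos (real k * (2 * \<theta>)))) \<le> (\<Sum>i<N. damp t \<theta> (4 * i + 1) + damp t \<theta> (4 * i + 2) + damp t \<theta> (4 * i + 4))" for N
      unfolding eq by (intro sum_mono) (simp add: damp_nonneg)
  qed
  also have "\<dots> \<le> gap_total_real t * exp (- (min (\<delta> ^ 2 / t ^ 3) (1 / t) / 400))"
  proof (intro mult_left_mono)
    show "0 \<le> gap_total_real t"
      unfolding gap_total_real_def using t by (intro suminf_nonneg summable_gap_gf gap_gf_nonneg) auto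
  qed (use E in simp)
  finally show ?thesis .
qed

text \<open>Near \<open>\<theta> = \<pi>\<close> the even factors do not help, but those with \<open>m\<close> congruent to 1 modulo 4 do.\<close>

lemma norm_gap_total_le_near_pi:
  assumes t: "0 < t" "t \<le> 1 / 8" and d: "0 \<le> \<delta>" "\<delta> \<le> t" "\<bar>\<theta>\<bar> = pi - \<delta>"
  shows "norm (gap_total (Complex t (- \<theta>))) \<le> gap_total_real t * exp (- (1 / (96 * t)))"
proof -
  \<comment> \<open>For i < K the exponent m = 4i + 1 satisfies m t \<le> 1. Then exp(-tm) is at
    least 1/e, and m \<delta> stays below pi/2, so that cos(m \<theta>) is not positive.\<close>
  define K where "K = nat \<lfloor>1 / (4 * t)\<rfloor>"
  have "1 \<le> 1 / (8 * t)" using t by (simp add: field_simps)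
  moreover have "1 / (4 * t) = 1 / (8 * t) + 1 / (8 * t)" by (simp add: field_simps)
  moreover have "real K = of_int \<lfloor>1 / (4 * t)\<rfloor>" unfolding K_def using t by (intro of_nat_nat) simp
  ultimately have K: "1 / (8 * t) \<le> real K" "real K \<le> 1 / (4 * t)"
    using of_int_floor_le[of "1 / (4 * t)"] real_of_int_floor_gt_diff_one[of "1 / (4 * t)"] by linarith+
  have big: "1 / 3 \<le> damp t \<theta> (4 * i + 1)" if "i < K" for i
  proof -
    define m where "m = 4 * i + 1"
    have "real m \<le> 4 * real K" using that by (simp add: m_def)
    also have "\<dots> \<le> 1 / t" using K(2) by (simp add: field_simps)
    finally have m: "real m * t \<le> 1" using t by (simp add: field_simps)
    have "exp (- 1) \<le> exp (- (real m * t))" using m by simp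
    then have "1 / 3 \<le> exp (- (real m * t))" using exp_neg_1_ge by linarith
    then have 1: "1 / 3 \<le> exp (- t) ^ m" by (simp add: exp_of_nat_mult[symmetric])
    have "real m * \<delta> \<le> real m * t" using d by (intro mult_left_mono) auto
    then have "real m * \<delta> \<le> pi / 2" using m pi_gt3 by linarith
    moreover have "0 \<le> real m * \<delta>" using d by simp
    ultimately have "0 \<le> cos (real m * \<delta>)" using pi_gt_zero by (intro cos_ge_zero) linarith+
    moreover have "cos (real m * \<theta>) = - cos (real m * \<delta>)"
    proof -
      have "cos (real m * \<theta>) = cos (real m * \<bar>\<theta>\<bar>)" by (cases "0 \<le> \<theta>") auto
      also have "\<dots> = cos (real m * pi - real m * \<delta>)" by (simp add: d(3) right_diff_distrib)
      also have "\<dots> = - cos (real m * \<delta>)"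
      proof -
        have "(- 1) ^ m = (- 1 :: real)" by (simp add: m_def)
        then show ?thesis unfolding cos_diff using cos_npi[of m] sin_npi[of m] by simp
      qed
      finally show ?thesis .
    qed
    ultimately have 2: "1 \<le> 1 - cos (real m * \<theta>)" by simp
    have "1 / 3 * 1 \<le> exp (- t) ^ m * (1 - cos (real m * \<theta>))"
      using 1 2 by (intro mult_mono) auto
    then show ?thesis by (simp add: damp_def m_def)
  qed
  \<comment> \<open>Only the first K blocks are used, each worth 1/3, with K at least 1/(8t). A
    lower bound that jumps from 0 to 1/(24t) at N = K has the required limit.\<close>
  have "(\<lambda>N. if N < K then 0 else 1 / (24 * t)) \<longlonglongrightarrow> 1 / (24 * t)"
    by (rule tendsto_eventually) (auto simp: eventually_sequentially intro!: exI[of _ K])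
  with t(1) have "norm (gap_total (Complex t (- \<theta>))) \<le> gap_total_real t * exp (- (1 / (24 * t) / 4))"
  proof (rule norm_gap_total_le)
    fix N
    show "(if N < K then 0 else 1 / (24 * t)) \<le> (\<Sum>i<N. damp t \<theta> (4 * i + 1) + damp t \<theta> (4 * i + 2) + damp t \<theta> (4 * i + 4))"
    proof (cases "N < K")
      case False
      have "1 / (24 * t) \<le> (\<Sum>i<K. 1 / 3)" using K(1) by simp
      also have "\<dots> \<le> (\<Sum>i<K. damp t \<theta> (4 * i + 1) + damp t \<theta> (4 * i + 2) + damp t \<theta> (4 * i + 4))"
      proof (rule sum_mono)
        fix i assume "i \<in> {..<K}"
        then show "1 / 3 \<le> damp t \<theta> (4 * i + 1) + damp t \<theta> (4 * i + 2) + damp t \<theta> (4 * i + 4)"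
          using big[of i] damp_nonneg[of t \<theta> "4 * i + 2"] damp_nonneg[of t \<theta> "4 * i + 4"] by simp
      qed
      also have "\<dots> \<le> (\<Sum>i<N. damp t \<theta> (4 * i + 1) + damp t \<theta> (4 * i + 2) + damp t \<theta> (4 * i + 4))"
        using False by (intro sum_mono2) (auto intro!: add_nonneg_nonneg damp_nonneg)
      finally show ?thesis using False by simp
    qed (auto intro!: sum_nonneg add_nonneg_nonneg damp_nonneg)
  qed
  then show ?thesis by (simp add: field_simps)
qed

text \<open>Beyond pi/2 it suffices to save 1/t. If \<delta> = pi - |\<theta>| exceeds t, then
  \<delta>^2/t^3 is at least 1/t in the sine bound; otherwise the residue class 1 modulo 4 supplies
  the saving.\<close>

lemma norm_gap_total_bound:
  assumes t: "0 < t" "t \<le> 1 / 8" and th: "\<bar>\<theta>\<bar> \<le> pi"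
  shows "norm (gap_total (Complex t (- \<theta>))) \<le> gap_total_real t * exp (- (min (\<theta> ^ 2 / t ^ 3) (1 / t) / 400))"
proof (cases "\<bar>\<theta>\<bar> \<le> pi / 2")
  case True
  then show ?thesis using norm_gap_total_le_sin[OF t, of "\<bar>\<theta>\<bar>" \<theta>] abs_sin_ge_half[OF True] by simp
next
  case False
  have nonneg: "0 \<le> gap_total_real t"
    unfolding gap_total_real_def using t by (intro suminf_nonneg summable_gap_gf gap_gf_nonneg) auto
  define \<delta> where "\<delta> = pi - \<bar>\<theta>\<bar>"
  have d: "0 \<le> \<delta>" "\<bar>\<delta>\<bar> \<le> pi / 2" using False th by (auto simp: \<delta>_def)
  have "\<bar>sin \<delta>\<bar> = \<bar>sin \<theta>\<bar>" by (cases "0 \<le> \<theta>") (auto simp: \<delta>_def)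
  with abs_sin_ge_half[OF d(2)] d(1) have sin: "\<delta> / 2 \<le> \<bar>sin \<theta>\<bar>" by simp
  have "norm (gap_total (Complex t (- \<theta>))) \<le> gap_total_real t * exp (- (1 / t / 400))"
  proof (cases "\<delta> \<le> t")
    case True
    have "norm (gap_total (Complex t (- \<theta>))) \<le> gap_total_real t * exp (- (1 / (96 * t)))"
      using norm_gap_total_le_near_pi[OF t d(1) True] by (simp add: \<delta>_def)
    also have "\<dots> \<le> gap_total_real t * exp (- (1 / t / 400))"
      using t nonneg by (intro mult_left_mono) (auto simp: field_simps)
    finally show ?thesis .
  next
    case False
    have "t ^ 2 \<le> \<delta> ^ 2" using False t by (intro power_mono) auto
    then have "1 / t \<le> \<delta> ^ 2 / t ^ 3" using t by (simp add: field_simps power2_eq_square power3_eq_cube)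
    then show ?thesis using norm_gap_total_le_sin[OF t d(1) sin] by simp
  qed
  also have "\<dots> \<le> gap_total_real t * exp (- (min (\<theta> ^ 2 / t ^ 3) (1 / t) / 400))"
    using nonneg by (intro mult_left_mono) auto
  finally show ?thesis .
qed

text \<open>The factors 27 and 400^3 come from the cube of y/3 with y = 1/(400t), and 16 from u^2
  t^3 = \<theta>^2, which is at most pi^2 < 16 on the circle.\<close>

definition decay_const :: real where "decay_const = 27 * 16 * 400 ^ 3"

text \<open>The majorant may not depend on t. Where the minimum is 1/t, this is rescued by u^2 being
  at most 16/t^3, because exp(-1/(400t)) is smaller than a multiple of t^3.\<close>

lemma decay_bound:
  assumes t: "0 < t" and u: "u ^ 2 * t ^ 3 \<le> 16"
  shows "exp (- (min (u ^ 2) (1 / t) / 400)) \<le> decay_const * inverse (1 + u ^ 2)"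
proof (cases "u ^ 2 \<le> 1 / t")
  case True
  have "exp (- (u ^ 2 / 400)) = 1 / exp (u ^ 2 / 400)" by (simp add: exp_minus field_simps)
  also have "\<dots> \<le> 1 / (1 + u ^ 2 / 400)"
    using exp_ge_add_one_self[of "u ^ 2 / 400"] by (intro divide_left_mono) (auto intro!: add_pos_nonneg mult_pos_pos)
  also have "\<dots> \<le> 400 * inverse (1 + u ^ 2)"
  proof -
    have "0 < 1 + u ^ 2" "0 < 400 + u ^ 2" by (intro add_pos_nonneg; simp)+
    then show ?thesis by (simp add: field_simps)
  qed
  also have "\<dots> \<le> decay_const * inverse (1 + u ^ 2)"
    by (intro mult_right_mono) (auto simp: decay_const_def)
  finally show ?thesis using True by (simp add: min_def)
next
  case False
  define y where "y = 1 / t / 400"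
  have y: "0 < y" using t by (simp add: y_def)
  have "(1 + y / 3) ^ 3 \<le> exp (y / 3) ^ 3"
    using y exp_ge_add_one_self[of "y / 3"] by (intro power_mono) auto
  also have "exp (y / 3) ^ 3 = exp y" by (simp flip: exp_of_nat_mult)
  finally have le: "(1 + y / 3) ^ 3 \<le> exp y" .
  have "1 + (y / 3) ^ 3 \<le> exp y"
  proof -
    have "(1 + a) ^ 3 = 1 + a ^ 3 + 3 * (a * (1 + a))" for a :: real
      by (simp add: power3_eq_cube algebra_simps)
    from this[of "y / 3"] le have "1 + (y / 3) ^ 3 + 3 * (y / 3 * (1 + y / 3)) \<le> exp y" by simp
    moreover have "0 \<le> y / 3 * (1 + y / 3)" using y by simp
    ultimately show ?thesis by linarith
  qed
  moreover have "(y / 3) ^ 3 \<ge> u ^ 2 / decay_const"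
  proof -
    have "u ^ 2 \<le> 16 / t ^ 3" using u t by (simp add: field_simps)
    then show ?thesis using t by (simp add: y_def decay_const_def power_divide field_simps)
  qed
  ultimately have "1 + u ^ 2 / decay_const \<le> exp y" by linarith
  moreover have "0 < 1 + u ^ 2 / decay_const" by (intro add_pos_nonneg) (auto simp: decay_const_def)
  ultimately have "exp (- y) \<le> 1 / (1 + u ^ 2 / decay_const)"
    by (simp add: exp_minus inverse_eq_divide frac_le)
  also have "\<dots> \<le> decay_const * inverse (1 + u ^ 2)"
  proof -
    have "0 < 1 + u ^ 2" by (intro add_pos_nonneg) auto
    moreover have "0 < decay_const + u ^ 2" by (intro add_pos_nonneg) (auto simp: decay_const_def)
    moreover have "1 \<le> decay_const" by (simp add: decay_const_def)
    moreover have "1 / (1 + u ^ 2 / decay_const) = decay_const / (decay_const + u ^ 2)"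
      by (simp add: decay_const_def field_simps)
    ultimately show ?thesis by (simp add: inverse_eq_divide frac_le)
  qed
  finally show ?thesis using False by (simp add: min_def y_def)
qed

subsection \<open>Local limit theorem for the number of partitions\<close>

lemma gap_total_sums:
  assumes "0 < t"
  shows "(\<lambda>m. of_real (real (card (gap_partitions m)) * exp (- t) ^ m) * cis (real m * \<theta>)) sums gap_total (Complex t (- \<theta>))"
proof -
  let ?z = "Complex t (- \<theta>)"
  have "exp (- ?z) = of_real (exp (- t)) * cis \<theta>" by (simp add: exp_eq_polar)
  then have pw: "exp (- ?z) ^ m = of_real (exp (- t) ^ m) * cis (real m * \<theta>)" for m
    by (simp add: power_mult_distrib Complex.DeMoivre)
  have "((\<lambda>m. of_nat (card (gap_partitions m)) * exp (- ?z) ^ m) has_sum gap_total ?z) UNIV"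
    unfolding gap_total_def using assms by (intro has_sum_gap_partitions) auto
  from has_sum_imp_sums[OF this] show ?thesis unfolding pw by (simp add: mult.assoc)
qed

lemma integral_cis:
  fixes m n :: nat
  shows "has_bochner_integral lborel (\<lambda>\<theta>. indicator {- pi..pi} \<theta> *\<^sub>R cis ((real m - real n) * \<theta>)) (if m = n then of_real (2 * pi) else 0)"
proof (cases "m = n")
  case True
  have "has_bochner_integral lborel (\<lambda>\<theta>. indicator {- pi..pi} \<theta> *\<^sub>R (1 :: complex)) (of_real pi - of_real (- pi))"
  proof (rule has_bochner_integral_FTC_Icc)
    show "(complex_of_real has_vector_derivative 1) (at x within {- pi..pi})" for x
      using has_vector_derivative_of_real[OF DERIV_ident] by (simp add: o_def)
  qed auto
  then show ?thesis using True by simp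
next
  case False
  define k where "k = real m - real n"
  have k: "k \<noteq> 0" using False by (simp add: k_def)
  let ?F = "\<lambda>z. exp (\<i> * of_real k * z) / (\<i> * of_real k)"
  have sin: "sin (k * pi) = 0"
    by (simp add: k_def left_diff_distrib sin_diff)
  have "has_bochner_integral lborel (\<lambda>\<theta>. indicator {- pi..pi} \<theta> *\<^sub>R cis (k * \<theta>)) (?F (of_real pi) - ?F (of_real (- pi)))"
  proof (rule has_bochner_integral_FTC_Icc)
    fix x
    have "(?F has_field_derivative exp (\<i> * of_real k * of_real x)) (at (of_real x))"
      using k by (auto intro!: derivative_eq_intros)
    moreover have "exp (\<i> * of_real k * of_real x) = cis (k * x)"
      by (simp add: cis_conv_exp mult.assoc)
    ultimately show "((\<lambda>x. ?F (of_real x)) has_vector_derivative cis (k * x)) (at x within {- pi..pi})"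
      by (intro has_vector_derivative_real_field) simp
  qed (auto intro!: continuous_intros)
  moreover have "exp (\<i> * of_real k * of_real pi) = exp (\<i> * of_real k * of_real (- pi))"
  proof -
    have "cis (k * pi) = cis (k * - pi)" by (simp add: complex_eq_iff sin)
    then show ?thesis by (simp add: cis_conv_exp mult.assoc)
  qed
  ultimately show ?thesis using False by (simp add: k_def)
qed

text \<open>Summability of the coefficients at exp(-t) bounds the integrals of the norms and
  justifies termwise integration. The interval enters as an indicator, so that after rescaling all
  integrals are over the whole line.\<close>

lemma gap_fourier:
  assumes t: "0 < t"
  shows "has_bochner_integral lborel (\<lambda>\<theta>. indicator {- pi..pi} \<theta> *\<^sub>R (gap_total (Complex t (- \<theta>)) * cis (- (real n * \<theta>))))
    (of_real (2 * pi * (real (card (gap_partitions n)) * exp (- t) ^ n)))"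
proof -
  define p where "p m = real (card (gap_partitions m)) * exp (- t) ^ m" for m
  define f where "f m \<theta> = of_real (p m) * (indicator {- pi..pi} \<theta> *\<^sub>R cis ((real m - real n) * \<theta>))" for m \<theta>
  have f: "has_bochner_integral lborel (f m) (of_real (p m) * (if m = n then of_real (2 * pi) else 0))" for m
    unfolding f_def by (intro has_bochner_integral_mult_right integral_cis)
  have nf: "norm (f m \<theta>) = p m * indicator {- pi..pi} \<theta>" for m \<theta>
    by (simp add: f_def p_def norm_mult norm_power indicator_def)
  have sp: "summable p"
    unfolding p_def using t by (intro summable_on_imp_summable has_sum_imp_summable[OF has_sum_gap_partitions]) auto
  have int_norm: "(\<integral>\<theta>. norm (f m \<theta>) \<partial>lborel) = p m * (2 * pi)" for m
    unfolding nf by simp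
  have 1: "AE \<theta> in lborel. summable (\<lambda>m. norm (f m \<theta>))"
    unfolding nf by (intro AE_I2 summable_mult2 sp)
  have 2: "summable (\<lambda>m. \<integral>\<theta>. norm (f m \<theta>) \<partial>lborel)"
    unfolding int_norm by (intro summable_mult2 sp)
  have int: "integrable lborel (f m)" for m using f by (simp add: has_bochner_integral_iff)
  have eq: "(\<Sum>m. f m \<theta>) = indicator {- pi..pi} \<theta> *\<^sub>R (gap_total (Complex t (- \<theta>)) * cis (- (real n * \<theta>)))" for \<theta>
  proof -
    have "(\<lambda>m. indicator {- pi..pi} \<theta> *\<^sub>R ((of_real (p m) * cis (real m * \<theta>)) * cis (- (real n * \<theta>)))) sums
      (indicator {- pi..pi} \<theta> *\<^sub>R (gap_total (Complex t (- \<theta>)) * cis (- (real n * \<theta>))))"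
      unfolding p_def by (intro sums_scaleR_right sums_mult2 gap_total_sums t)
    moreover have "indicator {- pi..pi} \<theta> *\<^sub>R ((of_real (p m) * cis (real m * \<theta>)) * cis (- (real n * \<theta>))) = f m \<theta>" for m
      by (simp add: f_def mult.assoc cis_mult left_diff_distrib)
    ultimately show ?thesis by (simp add: sums_iff)
  qed
  have sums: "(\<lambda>m. integral\<^sup>L lborel (f m)) sums (\<integral>\<theta>. (\<Sum>m. f m \<theta>) \<partial>lborel)"
    by (rule sums_integral[OF int 1 2])
  have "integral\<^sup>L lborel (f m) = (if m = n then of_real (2 * pi * p m) else 0)" for m
    using f[of m] by (simp add: has_bochner_integral_iff)
  then have "(\<lambda>m. integral\<^sup>L lborel (f m)) sums complex_of_real (2 * pi * p n)"
    using sums_single[of n "\<lambda>m. complex_of_real (2 * pi * p m)"] by simp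
  from sums_unique2[OF sums this]
  have "(\<integral>\<theta>. (\<Sum>m. f m \<theta>) \<partial>lborel) = of_real (2 * pi * p n)" .
  moreover have "integrable lborel (\<lambda>\<theta>. \<Sum>m. f m \<theta>)" by (rule integrable_suminf[OF int 1 2])
  ultimately show ?thesis unfolding eq by (simp add: has_bochner_integral_iff p_def)
qed

lemma gap_fourier_scaled:
  assumes t: "0 < t" and s: "0 < s"
  shows "has_bochner_integral lborel (\<lambda>u. indicator {- pi..pi} (s * u) *\<^sub>R (gap_total (Complex t (- (s * u))) * cis (- (real n * (s * u)))))
    (of_real (2 * pi * (real (card (gap_partitions n)) * exp (- t) ^ n) / s))"
proof -
  let ?f = "\<lambda>\<theta>. indicator {- pi..pi} \<theta> *\<^sub>R (gap_total (Complex t (- \<theta>)) * cis (- (real n * \<theta>)))"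
  note * = gap_fourier[OF t, of n, unfolded has_bochner_integral_iff]
  have "integrable lborel (\<lambda>u. ?f (0 + s * u))"
    using s by (intro lborel_integrable_real_affine conjunct1[OF *]) auto
  moreover have "integral\<^sup>L lborel ?f = \<bar>s\<bar> *\<^sub>R (\<integral>u. ?f (0 + s * u) \<partial>lborel)"
    using s by (intro lborel_integral_real_affine) simp
  then have "of_real (2 * pi * (real (card (gap_partitions n)) * exp (- t) ^ n)) = s *\<^sub>R (\<integral>u. ?f (0 + s * u) \<partial>lborel)"
    using conjunct2[OF *] s by simp
  ultimately show ?thesis using s by (simp add: has_bochner_integral_iff scaleR_conv_of_real)
qed

lemma integral_gaussian:
  "has_bochner_integral lborel (\<lambda>u. exp (- (pi ^ 2 / 16 * u ^ 2))) (4 / sqrt pi)"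
proof -
  \<comment> \<open>The variance 8/pi^2 solves 1/(2 \<sigma>^2) = pi^2/16.\<close>
  define \<sigma> where "\<sigma> = sqrt 8 / pi"
  have \<sigma>: "0 < \<sigma>" "\<sigma> ^ 2 = 8 / pi ^ 2" by (auto simp: \<sigma>_def power_divide)
  have "has_bochner_integral lborel (normal_density 0 \<sigma>) 1"
    using \<sigma> by (simp add: has_bochner_integral_iff)
  then have "has_bochner_integral lborel (\<lambda>u. 4 / sqrt pi * normal_density 0 \<sigma> u) (4 / sqrt pi * 1)"
    by (intro has_bochner_integral_mult_right) auto
  moreover have "4 / sqrt pi * normal_density 0 \<sigma> u = exp (- (pi ^ 2 / 16 * u ^ 2))" for u
  proof -
    have "2 * pi * \<sigma> ^ 2 = 16 / pi" unfolding \<sigma>(2) by (simp add: power2_eq_square)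
    then have "sqrt (2 * pi * \<sigma> ^ 2) = sqrt (16 / pi)" by simp
    also have "\<dots> = 4 / sqrt pi" by (simp add: real_sqrt_divide)
    finally show ?thesis unfolding normal_density_def by (simp add: \<sigma>(2) mult.commute)
  qed
  ultimately show ?thesis by simp
qed

text \<open>The junk value at 0 is \<open>saddle 0 = 0\<close>.\<close>

definition saddle :: "nat \<Rightarrow> real" where
  "saddle n = pi / (4 * sqrt (real n))"

lemma saddle_pos: "0 < n \<Longrightarrow> 0 < saddle n"
  by (simp add: saddle_def)

lemma saddle_sq: "0 < n \<Longrightarrow> real n * saddle n ^ 2 = pi ^ 2 / 16"
  by (simp add: saddle_def power_divide power_mult_distrib)

lemma saddle_tendsto: "saddle \<longlonglongrightarrow> 0"
  unfolding saddle_def by real_asymp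

lemma saddle_le:
  assumes "100 \<le> n"
  shows "saddle n \<le> 1 / 8"
proof -
  have "sqrt 100 \<le> sqrt (real n)" using assms by (intro real_sqrt_le_mono) simp
  also have "sqrt 100 = 10" by (simp add: real_sqrt_unique)
  finally have "10 \<le> sqrt (real n)" by simp
  then have "saddle n \<le> 4 / (4 * 10)" unfolding saddle_def using pi_less_4 by (intro frac_le) auto
  then show ?thesis by simp
qed

lemma gap_total_real_pos: "0 < t \<Longrightarrow> 0 < gap_total_real t"
proof -
  assume t: "0 < t"
  have "gap_total (of_real t) \<noteq> 0"
    using t gap_total_eq_exp[of "of_real t"] by simp
  then have "gap_total_real t \<noteq> 0" unfolding gap_total_of_real[OF t] by simp
  moreover have "0 \<le> gap_total_real t"
    unfolding gap_total_real_def using t by (intro suminf_nonneg summable_gap_gf gap_gf_nonneg) auto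
  ultimately show ?thesis by simp
qed

text \<open>Write A = pi^2/16 and z = t w with w = 1 - i r and r = sqrt t * u, which tends to 0, so
  z stays in the sector. As n t^2 = A, the linear term cancels exactly: A/z - A/t - (A/t)(1-w) =
  (A/t)(1-w)^2/w = - A u^2/w. The constants -(ln 2)/4 cancel in the quotient.\<close>

lemma gap_total_pointwise:
  fixes u :: real
  defines "z \<equiv> \<lambda>n. Complex (saddle n) (- (saddle n * sqrt (saddle n) * u))"
  shows "(\<lambda>n. gap_total (z n) * cis (- (real n * (saddle n * sqrt (saddle n) * u))) / of_real (gap_total_real (saddle n)))
    \<longlonglongrightarrow> of_real (exp (- (pi ^ 2 / 16 * u ^ 2)))"
proof -
  let ?A = "of_real (pi ^ 2 / 16) :: complex"
  define r where "r n = sqrt (saddle n) * u" for n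
  have r: "r \<longlonglongrightarrow> 0" unfolding r_def
    using tendsto_mult[OF tendsto_real_sqrt[OF saddle_tendsto] tendsto_const[of u]] by simp
  have z: "z n = of_real (saddle n) * (1 - \<i> * of_real (r n))" for n
    by (simp add: z_def complex_eq_iff r_def mult.assoc)
  have pos: "\<forall>\<^sub>F n in sequentially. 0 < saddle n"
    using saddle_pos by (auto simp: eventually_sequentially intro!: exI[of _ 1])
  have lt: "filterlim (\<lambda>n. complex_of_real (saddle n)) (at 0) sequentially"
    unfolding filterlim_at using pos tendsto_of_real[OF saddle_tendsto, where 'a = complex]
    by (auto elim: eventually_mono)
  have st: "\<forall>\<^sub>F n in sequentially. norm (complex_of_real (saddle n)) \<le> 2 * Re (of_real (saddle n))"
    using pos by eventually_elim simp
  have "(\<lambda>n. of_real (saddle n) * (1 - \<i> * of_real (r n))) \<longlonglongrightarrow> of_real 0 * (1 - \<i> * of_real 0)"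
    by (intro tendsto_intros saddle_tendsto r)
  then have "z \<longlonglongrightarrow> 0" unfolding z[abs_def, symmetric] by (simp add: z[abs_def])
  moreover have "\<forall>\<^sub>F n in sequentially. z n \<noteq> 0"
    using pos by eventually_elim (auto simp: z_def complex_eq_iff)
  ultimately have lz: "filterlim z (at 0) sequentially" by (simp add: filterlim_at)
  have "\<forall>\<^sub>F n in sequentially. \<bar>r n\<bar> < 1" using r by (auto dest: tendstoD[of _ _ _ 1] simp: dist_real_def)
  with pos have sz: "\<forall>\<^sub>F n in sequentially. norm (z n) \<le> 2 * Re (z n)"
  proof eventually_elim
    case (elim n)
    have "norm (1 - \<i> * of_real (r n)) \<le> norm (1::complex) + norm (\<i> * complex_of_real (r n))" by (rule norm_triangle_ineq4)
    also have "\<dots> \<le> 2" using elim by (simp add: norm_mult)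
    finally have "saddle n * norm (1 - \<i> * of_real (r n)) \<le> saddle n * 2" using elim by (intro mult_left_mono) auto
    then show ?case using elim by (simp add: z norm_mult)
  qed
  define D where "D n = (log_gf (z n) - ?A / z n) - (log_gf (of_real (saddle n)) - ?A / of_real (saddle n))
    - of_real (pi ^ 2 / 16 * u ^ 2) / (1 - \<i> * of_real (r n))" for n
  have "D \<longlonglongrightarrow> of_real (- (ln 2 / 4)) - of_real (- (ln 2 / 4)) - of_real (pi ^ 2 / 16 * u ^ 2) / (1 - \<i> * of_real 0)"
    unfolding D_def by (intro tendsto_intros log_gf_asymp lz sz lt st r) auto
  then have "(\<lambda>n. exp (D n)) \<longlonglongrightarrow> exp (- of_real (pi ^ 2 / 16 * u ^ 2))" by (intro tendsto_exp) simp
  moreover have "\<forall>\<^sub>F n in sequentially. exp (D n) =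
    gap_total (z n) * cis (- (real n * (saddle n * sqrt (saddle n) * u))) / of_real (gap_total_real (saddle n))"
    using eventually_gt_at_top[of 0]
  proof eventually_elim
    case (elim n)
    define t where "t = saddle n"
    have t: "0 < t" "real n = pi ^ 2 / 16 / t ^ 2"
      using saddle_pos[OF elim] saddle_sq[OF elim] by (auto simp: t_def field_simps)
    define w where "w = 1 - \<i> * of_real (r n)"
    have w: "w \<noteq> 0" by (auto simp: w_def complex_eq_iff)
    have zw: "z n = of_real t * w" by (simp add: z t_def w_def)
    have tt: "t * sqrt t * u = t * r n" "r n ^ 2 = t * u ^ 2"
      using t by (simp_all add: r_def t_def power_mult_distrib)
    have wr: "\<i> * of_real (r n) = 1 - w" by (simp add: w_def)
    have "- ?A / (of_real t * w) + ?A / of_real t - of_real (pi ^ 2 / 16 * u ^ 2) / w = - (\<i> * of_real (real n * (t * sqrt t * u)))"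
    proof -
      have "of_real t * of_real (u ^ 2) = complex_of_real (r n) ^ 2" using tt(2) by (metis of_real_mult of_real_power)
      also have "\<dots> = - ((\<i> * of_real (r n)) ^ 2)" by (simp add: power_mult_distrib)
      finally have 1: "of_real t * of_real (u ^ 2) = - ((1 - w) ^ 2)" by (simp only: wr)
      have "\<i> * of_real (real n * (t * sqrt t * u)) = of_real (real n * t) * (\<i> * of_real (r n))"
        unfolding tt by simp
      also have "real n * t = pi ^ 2 / 16 / t" using t by (simp add: power2_eq_square)
      finally have 2: "\<i> * of_real (real n * (t * sqrt t * u)) = ?A / of_real t * (1 - w)" by (simp add: wr)
      have "of_real (pi ^ 2 / 16 * u ^ 2) / w = ?A / of_real t * (of_real t * of_real (u ^ 2)) / w" using t by simp
      also have "\<dots> = - (?A / of_real t * (1 - w) ^ 2 / w)" unfolding 1 by simp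
      finally have 3: "of_real (pi ^ 2 / 16 * u ^ 2) / w = - (?A / of_real t * (1 - w) ^ 2 / w)" .
      have "- ?A / (of_real t * w) + ?A / of_real t + ?A / of_real t * (1 - w) ^ 2 / w = - (?A / of_real t * (1 - w))"
        using t w by (simp add: divide_simps) (simp add: power2_eq_square algebra_simps)
      then show ?thesis unfolding 2 3 by simp
    qed
    then have "D n = log_gf (z n) - log_gf (of_real t) + - (\<i> * of_real (real n * (t * sqrt t * u)))"
      unfolding D_def zw t_def[symmetric] w_def[symmetric] by (simp add: algebra_simps)
    then have "exp (D n) = exp (log_gf (z n)) * exp (- (\<i> * of_real (real n * (t * sqrt t * u)))) / exp (log_gf (of_real t))"
      by (simp only: exp_add exp_diff) simp
    also have "exp (log_gf (z n)) = gap_total (z n)"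
      using t by (intro gap_total_eq_exp[symmetric]) (simp add: z_def t_def)
    also have "exp (log_gf (of_real t)) = of_real (gap_total_real t)"
      using t gap_total_eq_exp[of "of_real t"] gap_total_of_real[of t] by simp
    also have "exp (- (\<i> * of_real (real n * (t * sqrt t * u)))) = cis (- (real n * (t * sqrt t * u)))"
      unfolding cis_conv_exp by simp
    finally show ?case by (simp add: t_def)
  qed
  ultimately have "(\<lambda>n. gap_total (z n) * cis (- (real n * (saddle n * sqrt (saddle n) * u))) / of_real (gap_total_real (saddle n)))
    \<longlonglongrightarrow> exp (- of_real (pi ^ 2 / 16 * u ^ 2))"
    by (rule Lim_transform_eventually)
  then show ?thesis by (simp add: exp_of_real[symmetric])
qed

text \<open>Up to the factor 2 pi the quotient is the integral of a function of the scaled angle u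
  that tends to exp(-pi^2 u^2/16), and the Gaussian integral is 4/sqrt pi.\<close>

theorem card_gap_partitions_local_limit:
  "(\<lambda>n. real (card (gap_partitions n)) * exp (- saddle n) ^ n / (gap_total_real (saddle n) * (saddle n * sqrt (saddle n))))
    \<longlonglongrightarrow> 2 / (pi * sqrt pi)"
proof -
  define s where "s n = saddle n * sqrt (saddle n)" for n
  define G where "G n u = indicator {- pi..pi} (s n * u) *\<^sub>R (gap_total (Complex (saddle n) (- (s n * u))) *
    cis (- (real n * (s n * u)))) / of_real (gap_total_real (saddle n))" for n u
  have spos: "0 < s n" if "0 < n" for n using saddle_pos[OF that] by (simp add: s_def)
  have G: "has_bochner_integral lborel (G n)
      (of_real (2 * pi * (real (card (gap_partitions n)) * exp (- saddle n) ^ n) / s n) / of_real (gap_total_real (saddle n)))"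
    if "0 < n" for n
    unfolding G_def
    by (intro has_bochner_integral_divide_zero gap_fourier_scaled saddle_pos spos that)
  \<comment> \<open>The majorant has to hold for every member of the sequence, and the condition t
    \<le> 1/8 is guaranteed from n = 100 on.\<close>
  have "(\<lambda>n. integral\<^sup>L lborel (G (n + 100))) \<longlonglongrightarrow> (\<integral>u. complex_of_real (exp (- (pi ^ 2 / 16 * u ^ 2))) \<partial>lborel)"
  proof (rule integral_dominated_convergence)
    show "integrable lborel (\<lambda>u::real. decay_const * inverse (1 + u ^ 2))"
      using integrable_inverse_1_plus_square by (intro integrable_mult_right) (simp add: set_integrable_def)
    show "AE u in lborel. norm (G (n + 100) u) \<le> decay_const * inverse (1 + u ^ 2)" for n
    proof (rule AE_I2)
      fix u :: real
      let ?n = "n + 100"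
      define t where "t = saddle ?n"
      have t: "0 < t" "t \<le> 1 / 8" unfolding t_def by (intro saddle_pos saddle_le; simp)+
      have s2: "(s ?n * u) ^ 2 = u ^ 2 * t ^ 3"
        using t by (simp add: s_def t_def power_mult_distrib power2_eq_square power3_eq_cube)
      show "norm (G ?n u) \<le> decay_const * inverse (1 + u ^ 2)"
      proof (cases "\<bar>s ?n * u\<bar> \<le> pi")
        case True
        have "norm (gap_total (Complex t (- (s ?n * u)))) \<le> gap_total_real t * exp (- (min ((s ?n * u) ^ 2 / t ^ 3) (1 / t) / 400))"
          by (rule norm_gap_total_bound[OF t True])
        also have "(s ?n * u) ^ 2 / t ^ 3 = u ^ 2" using t by (simp add: s2)
        also have "gap_total_real t * exp (- (min (u ^ 2) (1 / t) / 400)) \<le> gap_total_real t * (decay_const * inverse (1 + u ^ 2))"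
        proof (intro mult_left_mono decay_bound t)
          have "\<bar>s ?n * u\<bar> ^ 2 \<le> 4 ^ 2" using True pi_less_4 by (intro power_mono) auto
          then show "u ^ 2 * t ^ 3 \<le> 16" using s2 by simp
        qed (use gap_total_real_pos[OF t(1)] in simp)
        finally show ?thesis
          using gap_total_real_pos[OF t(1)] True unfolding G_def t_def[symmetric]
          by (auto simp: norm_divide norm_mult field_simps indicator_def)
      next
        case False
        then have "G ?n u = 0" by (auto simp: G_def indicator_def)
        then show ?thesis by (simp add: decay_const_def)
      qed
    qed
    show "AE u in lborel. (\<lambda>n. G (n + 100) u) \<longlonglongrightarrow> complex_of_real (exp (- (pi ^ 2 / 16 * u ^ 2)))"
    proof (rule AE_I2)
      fix u :: real
      have "s \<longlonglongrightarrow> 0 * sqrt 0" unfolding s_def by (intro tendsto_intros saddle_tendsto)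
      then have "(\<lambda>n. s n * u) \<longlonglongrightarrow> 0" by (intro tendsto_mult_left_zero) simp
      from tendstoD[OF this pi_gt_zero] have "\<forall>\<^sub>F n in sequentially. \<bar>s n * u\<bar> < pi"
        by simp
      then have "\<forall>\<^sub>F n in sequentially. gap_total (Complex (saddle n) (- (saddle n * sqrt (saddle n) * u))) *
          cis (- (real n * (saddle n * sqrt (saddle n) * u))) / of_real (gap_total_real (saddle n)) = G n u"
        by eventually_elim (auto simp: G_def s_def indicator_def abs_le_iff)
      from Lim_transform_eventually[OF gap_total_pointwise this]
      show "(\<lambda>n. G (n + 100) u) \<longlonglongrightarrow> complex_of_real (exp (- (pi ^ 2 / 16 * u ^ 2)))"
        by (rule LIMSEQ_ignore_initial_segment)
    qed
    show "G (n + 100) \<in> borel_measurable lborel" for n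
      using G[of "n + 100"] by (intro borel_measurable_integrable) (simp add: has_bochner_integral_iff)
  qed simp
  moreover have "(\<integral>u. complex_of_real (exp (- (pi ^ 2 / 16 * u ^ 2))) \<partial>lborel) = of_real (4 / sqrt pi)"
    using integral_gaussian by (simp add: has_bochner_integral_iff)
  moreover have "integral\<^sup>L lborel (G (n + 100)) =
    of_real (2 * pi * (real (card (gap_partitions (n + 100))) * exp (- saddle (n + 100)) ^ (n + 100) / (gap_total_real (saddle (n + 100)) * s (n + 100))))" for n
    using G[of "n + 100"] by (simp add: has_bochner_integral_iff field_simps)
  ultimately have "(\<lambda>n. complex_of_real (2 * pi * (real (card (gap_partitions (n + 100))) * exp (- saddle (n + 100)) ^ (n + 100) /
      (gap_total_real (saddle (n + 100)) * s (n + 100))))) \<longlonglongrightarrow> of_real (4 / sqrt pi)"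
    by (simp only:)
  then have "(\<lambda>n. 2 * pi * (real (card (gap_partitions (n + 100))) * exp (- saddle (n + 100)) ^ (n + 100) /
      (gap_total_real (saddle (n + 100)) * s (n + 100)))) \<longlonglongrightarrow> 4 / sqrt pi"
    by (simp only: tendsto_of_real_iff)
  then have "(\<lambda>n. 2 * pi * (real (card (gap_partitions n)) * exp (- saddle n) ^ n / (gap_total_real (saddle n) * s n))) \<longlonglongrightarrow> 4 / sqrt pi"
    by (rule LIMSEQ_offset)
  then have "(\<lambda>n. 1 / (2 * pi) * (2 * pi * (real (card (gap_partitions n)) * exp (- saddle n) ^ n / (gap_total_real (saddle n) * s n)))) \<longlonglongrightarrow> 1 / (2 * pi) * (4 / sqrt pi)"
    by (intro tendsto_intros)
  then show ?thesis by (simp add: s_def)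
qed

lemma gap_total_real_asymp:
  "(\<lambda>n. gap_total_real (saddle n) * exp (- (pi ^ 2 / 16 / saddle n))) \<longlonglongrightarrow> exp (- (ln 2 / 4))"
proof -
  have pos: "\<forall>\<^sub>F n in sequentially. 0 < saddle n"
    using saddle_pos by (auto simp: eventually_sequentially intro!: exI[of _ 1])
  have lt: "filterlim (\<lambda>n. complex_of_real (saddle n)) (at 0) sequentially"
    unfolding filterlim_at using pos tendsto_of_real[OF saddle_tendsto, where 'a = complex]
    by (auto elim: eventually_mono)
  have st: "\<forall>\<^sub>F n in sequentially. norm (complex_of_real (saddle n)) \<le> 2 * Re (of_real (saddle n))"
    using pos by eventually_elim simp
  have "(\<lambda>n. exp (log_gf (of_real (saddle n)) - of_real (pi ^ 2 / 16) / of_real (saddle n))) \<longlonglongrightarrow> exp (of_real (- (ln 2 / 4)))"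
    by (intro tendsto_exp log_gf_asymp lt st) simp
  moreover have "\<forall>\<^sub>F n in sequentially. exp (log_gf (of_real (saddle n)) - of_real (pi ^ 2 / 16) / of_real (saddle n)) =
      complex_of_real (gap_total_real (saddle n) * exp (- (pi ^ 2 / 16 / saddle n)))"
    using pos
  proof eventually_elim
    case (elim n)
    have "exp (log_gf (of_real (saddle n))) = of_real (gap_total_real (saddle n))"
      using elim gap_total_eq_exp[of "of_real (saddle n)"] gap_total_of_real[OF elim] by simp
    then show ?case
      unfolding of_real_divide[symmetric] exp_diff exp_of_real exp_minus by (simp only: of_real_mult of_real_inverse divide_inverse)
  qed
  ultimately have "(\<lambda>n. complex_of_real (gap_total_real (saddle n) * exp (- (pi ^ 2 / 16 / saddle n)))) \<longlonglongrightarrow> exp (of_real (- (ln 2 / 4)))"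
    by (rule Lim_transform_eventually)
  then have "(\<lambda>n. complex_of_real (gap_total_real (saddle n) * exp (- (pi ^ 2 / 16 / saddle n)))) \<longlonglongrightarrow> of_real (exp (- (ln 2 / 4)))"
    by (simp only: exp_of_real)
  then show ?thesis by (simp only: tendsto_of_real_iff)
qed

subsection \<open>Concentration of the number of parts\<close>

definition part_density :: real where
  "part_density = ln (1 + sqrt 2) / 2"

lemma part_density_pos: "0 < part_density"
  unfolding part_density_def by (intro divide_pos_pos ln_gt_zero) simp_all

lemma exp_part_density: "exp (- (2 * part_density)) = sqrt 2 - 1"
proof -
  have "0 < 1 + sqrt 2" by (simp add: add_pos_pos)
  then have "exp (- (2 * part_density)) = 1 / (1 + sqrt 2)"
    by (simp add: part_density_def exp_minus inverse_eq_divide)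
  also have "\<dots> = sqrt 2 - 1"
    using \<open>0 < 1 + sqrt 2\<close> by (simp add: field_simps)
  finally show ?thesis .
qed

text \<open>The quotient of two consecutive weights, with y = exp(3t) stemming from the parameter
  q^(-3). Keeping y separate allows a comparison with the limiting case y = 1 by
  monotonicity.\<close>

definition step_ratio :: "real \<Rightarrow> real \<Rightarrow> real" where
  "step_ratio y x = x * (1 + y * x) / (1 - x)"

lemma step_ratio_mono:
  assumes "0 \<le> x" "x \<le> x'" "x' < 1" "0 \<le> y" "y \<le> y'"
  shows "step_ratio y x \<le> step_ratio y' x'"
  unfolding step_ratio_def using assms
  by (intro frac_le mult_mono add_mono) (auto intro!: mult_nonneg_nonneg add_nonneg_nonneg)

lemma step_ratio_1_less:
  assumes "0 \<le> x" "x < sqrt 2 - 1"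
  shows "step_ratio 1 x < 1"
proof -
  have "sqrt 2 < 2" by (rule real_less_lsqrt) auto
  then have "x < 1" using assms by simp
  have "(x + 1) ^ 2 < (sqrt 2) ^ 2" using assms by (intro power_strict_mono) auto
  then have "x * (1 + x) < 1 - x" by (simp add: power2_eq_square algebra_simps)
  then show ?thesis using \<open>x < 1\<close> by (simp add: step_ratio_def field_simps)
qed

lemma step_ratio_1_greater:
  assumes "sqrt 2 - 1 < x" "x < 1"
  shows "1 < step_ratio 1 x"
proof -
  have "(sqrt 2) ^ 2 < (x + 1) ^ 2" using assms by (intro power_strict_mono) auto
  then have "1 - x < x * (1 + x)" by (simp add: power2_eq_square algebra_simps)
  then show ?thesis using assms by (simp add: step_ratio_def field_simps)
qed

lemma gap_gf_Suc:
  assumes t: "0 < t"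
  shows "gap_gf (exp (- t)) 0 (Suc k) = gap_gf (exp (- t)) 0 k * step_ratio (exp (3 * t)) (exp (- (2 * (real (Suc k) * t))))"
proof -
  have "exp (- t) < 1" using t by simp
  moreover have "(exp (- t) ^ 2) ^ Suc k = exp (- (2 * (real (Suc k) * t)))"
    unfolding power_mult[symmetric] exp_of_nat_mult[symmetric] by simp
  moreover have "1 / exp (- t) ^ 3 = exp (3 * t)"
    unfolding exp_of_nat_mult[symmetric] by (simp add: exp_minus field_simps)
  ultimately show ?thesis
    by (simp add: gap_gf_eq_leb_term leb_term_Suc step_ratio_def del: power_Suc of_nat_Suc)
qed

lemma gap_gf_le_total:
  assumes "0 < t"
  shows "gap_gf (exp (- t)) 0 k \<le> gap_total_real t"
  unfolding gap_total_real_def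
  using sum_le_suminf[of "\<lambda>k. gap_gf (exp (- t)) 0 k" "{k}"] assms
  by (simp add: summable_gap_gf gap_gf_nonneg)

text \<open>At the half-way point kt = \<open>part_density + \<epsilon> / 2\<close>, where exp(-2kt)
  is \<open>x\<close>, the quotients are already below some \<eta> < 1. The remaining
  \<epsilon>/(2t) steps yield the exponential factor, starting from a weight that the total bounds.
  As exp(3t) enlarges the quotients, t has to be small.\<close>

lemma gap_gf_upper_tail:
  assumes \<epsilon>: "0 < \<epsilon>"
  obtains c where "0 < c" "\<forall>\<^sub>F t in at_right 0. \<forall>k. part_density + \<epsilon> \<le> real k * t \<longrightarrow>
    gap_gf (exp (- t)) 0 k \<le> exp (- (c / t)) * gap_total_real t"
proof -
  define x where "x = (sqrt 2 - 1) * exp (- \<epsilon>)"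
  have "1 < sqrt 2" by (rule real_less_rsqrt) simp
  then have "x < (sqrt 2 - 1) * 1" unfolding x_def using \<epsilon> by (intro mult_strict_left_mono) auto
  then have x: "0 < x" "x < sqrt 2 - 1" using \<open>1 < sqrt 2\<close> by (auto simp: x_def)
  have "sqrt 2 < 2" by (rule real_less_lsqrt) auto
  with x have x1: "x < 1" by simp
  define \<eta> where "\<eta> = (1 + step_ratio 1 x) / 2"
  have h: "0 < step_ratio 1 x" "step_ratio 1 x < 1"
    using step_ratio_1_less[of x] x x1 by (auto simp: step_ratio_def intro!: divide_pos_pos mult_pos_pos add_pos_pos)
  then have \<eta>: "step_ratio 1 x < \<eta>" "0 < \<eta>" "\<eta> < 1" by (auto simp: \<eta>_def)
  have "((\<lambda>t. step_ratio (exp (3 * t)) x) \<longlongrightarrow> step_ratio (exp (3 * 0)) x) (at_right 0)"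
    unfolding step_ratio_def using x1 by (intro tendsto_intros) auto
  then have ev: "\<forall>\<^sub>F t in at_right 0. step_ratio (exp (3 * t)) x < \<eta>"
    using \<eta> by (intro order_tendstoD) auto
  define c where "c = \<epsilon> / 2 * (- ln \<eta>)"
  have "0 < - ln \<eta>" using \<eta> by simp
  then have c: "0 < c" unfolding c_def using \<epsilon> by (intro mult_pos_pos) simp_all
  have "\<forall>\<^sub>F t in at_right 0. \<forall>k. part_density + \<epsilon> \<le> real k * t \<longrightarrow>
    gap_gf (exp (- t)) 0 k \<le> exp (- (c / t)) * gap_total_real t"
    using ev eventually_at_right_less[of 0]
  proof eventually_elim
    case (elim t)
    define a where "a = (part_density + \<epsilon> / 2) / t"
    define m where "m = nat \<lfloor>a\<rfloor>"
    have "0 \<le> a" using elim \<epsilon> part_density_pos by (simp add: a_def)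
    then have m: "real m \<le> a" "a < real m + 1" unfolding m_def by linarith+
    have step: "gap_gf (exp (- t)) 0 (Suc k) \<le> gap_gf (exp (- t)) 0 k * \<eta>" if "m \<le> k" for k
    proof -
      have "a \<le> real (Suc k)" using m that by simp
      then have "part_density + \<epsilon> / 2 \<le> real (Suc k) * t" using elim by (simp add: a_def field_simps)
      then have "exp (- (2 * (real (Suc k) * t))) \<le> exp (- (2 * part_density) + - \<epsilon>)" by simp
      also have "\<dots> = x" unfolding exp_add exp_part_density x_def ..
      finally have "step_ratio (exp (3 * t)) (exp (- (2 * (real (Suc k) * t)))) \<le> step_ratio (exp (3 * t)) x"
        using x1 by (intro step_ratio_mono) auto
      then show ?thesis unfolding gap_gf_Suc[OF elim(2)]
        using elim by (intro mult_left_mono gap_gf_nonneg) auto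
    qed
    have pow: "gap_gf (exp (- t)) 0 (m + j) \<le> gap_gf (exp (- t)) 0 m * \<eta> ^ j" for j
    proof (induction j)
      case (Suc j)
      have "gap_gf (exp (- t)) 0 (m + Suc j) \<le> gap_gf (exp (- t)) 0 (m + j) * \<eta>" using step[of "m + j"] by simp
      also have "\<dots> \<le> gap_gf (exp (- t)) 0 m * \<eta> ^ j * \<eta>" using Suc.IH \<eta> by (intro mult_right_mono) auto
      finally show ?case by (simp add: mult_ac)
    qed simp
    show ?case
    proof (intro allI impI)
      fix k assume k: "part_density + \<epsilon> \<le> real k * t"
      have "a + \<epsilon> / 2 / t = (part_density + \<epsilon>) / t" using elim by (simp add: a_def field_simps)
      also have "\<dots> \<le> real k" using k elim by (simp add: field_simps)
      finally have ak: "a + \<epsilon> / 2 / t \<le> real k" .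
      moreover have "0 < \<epsilon> / 2 / t" using \<epsilon> elim by simp
      ultimately have "m \<le> k" using m by simp
      then obtain j where j: "k = m + j" using le_Suc_ex by blast
      have jt: "\<epsilon> / 2 / t \<le> real j" using ak m by (simp add: j)
      have "\<eta> ^ j = exp (real j * ln \<eta>)" using \<eta> by (simp add: exp_of_nat_mult)
      also have "\<dots> \<le> exp (\<epsilon> / 2 / t * ln \<eta>)"
        unfolding exp_le_cancel_iff using jt \<open>0 < - ln \<eta>\<close> by (intro mult_right_mono_neg) simp_all
      also have "\<dots> = exp (- (c / t))" by (simp add: c_def)
      finally have "\<eta> ^ j \<le> exp (- (c / t))" .
      then have "gap_gf (exp (- t)) 0 m * \<eta> ^ j \<le> gap_total_real t * exp (- (c / t))"
        using gap_gf_le_total[OF elim(2), of m] \<eta> gap_total_real_pos[OF elim(2)] by (intro mult_mono) auto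
      then show "gap_gf (exp (- t)) 0 k \<le> exp (- (c / t)) * gap_total_real t"
        using pow[of j] by (simp add: j mult.commute)
    qed
  qed
  with c show ?thesis by (rule that)
qed

text \<open>Before the half-way point the weights grow by a factor \<zeta> > 1 at each step, so a
  weight far to the left is tiny compared with the one at \<open>m\<close>. Here exp(3t) works in
  the right direction. Rounding down to \<open>m\<close> may cost one step, hence the constant
  \<zeta>.\<close>

lemma gap_gf_lower_tail:
  assumes \<epsilon>: "0 < \<epsilon>" "\<epsilon> < part_density"
  obtains c C where "0 < c" "0 < C" "\<forall>\<^sub>F t in at_right 0. \<forall>k. real k * t \<le> part_density - \<epsilon> \<longrightarrow>
    gap_gf (exp (- t)) 0 k \<le> C * exp (- (c / t)) * gap_total_real t"
proof -
  define x where "x = exp (- (2 * part_density) + \<epsilon>)"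
  have x: "sqrt 2 - 1 < x" "x < 1" "0 < x" using \<epsilon> by (auto simp: x_def exp_part_density[symmetric])
  define \<zeta> where "\<zeta> = step_ratio 1 x"
  have \<zeta>: "1 < \<zeta>" unfolding \<zeta>_def by (rule step_ratio_1_greater[OF x(1,2)])
  define c where "c = \<epsilon> / 2 * ln \<zeta>"
  have c: "0 < c" using \<epsilon> \<zeta> by (auto simp: c_def)
  have "\<forall>\<^sub>F t in at_right 0. \<forall>k. real k * t \<le> part_density - \<epsilon> \<longrightarrow>
    gap_gf (exp (- t)) 0 k \<le> \<zeta> * exp (- (c / t)) * gap_total_real t"
    using eventually_at_right_less[of 0]
  proof eventually_elim
    case (elim t)
    define a where "a = (part_density - \<epsilon> / 2) / t"
    define m where "m = nat \<lfloor>a\<rfloor>"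
    have "0 \<le> a" using elim \<epsilon> by (simp add: a_def)
    then have m: "real m \<le> a" "a < real m + 1" unfolding m_def by linarith+
    have step: "gap_gf (exp (- t)) 0 k * \<zeta> \<le> gap_gf (exp (- t)) 0 (Suc k)" if "Suc k \<le> m" for k
    proof -
      have "real (Suc k) \<le> a" using m that by simp
      then have "real (Suc k) * t \<le> part_density - \<epsilon> / 2" using elim by (simp add: a_def field_simps)
      then have xe: "x \<le> exp (- (2 * (real (Suc k) * t)))" by (simp add: x_def)
      have "\<zeta> \<le> step_ratio (exp (3 * t)) (exp (- (2 * (real (Suc k) * t))))"
        unfolding \<zeta>_def using x xe elim by (intro step_ratio_mono) auto
      then show ?thesis unfolding gap_gf_Suc[OF elim]
        using elim by (intro mult_left_mono gap_gf_nonneg) auto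
    qed
    have pow: "gap_gf (exp (- t)) 0 k * \<zeta> ^ j \<le> gap_gf (exp (- t)) 0 (k + j)" if "k + j \<le> m" for k j
      using that
    proof (induction j)
      case (Suc j)
      have "gap_gf (exp (- t)) 0 k * \<zeta> ^ Suc j = gap_gf (exp (- t)) 0 k * \<zeta> ^ j * \<zeta>" by simp
      also have "\<dots> \<le> gap_gf (exp (- t)) 0 (k + j) * \<zeta>" using Suc \<zeta> by (intro mult_right_mono) auto
      also have "\<dots> \<le> gap_gf (exp (- t)) 0 (Suc (k + j))" using Suc.prems by (intro step) simp
      finally show ?case by simp
    qed simp
    show ?case
    proof (intro allI impI)
      fix k assume k: "real k * t \<le> part_density - \<epsilon>"
      have "real k \<le> (part_density - \<epsilon>) / t" using k elim by (simp add: field_simps)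
      also have "\<dots> = a - \<epsilon> / 2 / t" using elim by (simp add: a_def field_simps)
      finally have ak: "real k \<le> a - \<epsilon> / 2 / t" .
      moreover have "0 < \<epsilon> / 2 / t" using \<epsilon> elim by simp
      ultimately have "k \<le> m" using m by linarith
      then obtain j where j: "m = k + j" using le_Suc_ex by blast
      have jt: "\<epsilon> / 2 / t - 1 \<le> real j" using ak m by (simp add: j)
      have "exp (c / t) = \<zeta> * exp ((\<epsilon> / 2 / t - 1) * ln \<zeta>)"
        using \<zeta> by (simp add: c_def left_diff_distrib exp_diff)
      also have "\<dots> \<le> \<zeta> * exp (real j * ln \<zeta>)"
      proof (rule mult_left_mono)
        show "exp ((\<epsilon> / 2 / t - 1) * ln \<zeta>) \<le> exp (real j * ln \<zeta>)"
          unfolding exp_le_cancel_iff using \<zeta> by (intro mult_right_mono jt) simp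
      qed (use \<zeta> in simp)
      also have "exp (real j * ln \<zeta>) = \<zeta> ^ j" using \<zeta> by (simp add: exp_of_nat_mult)
      finally have "gap_gf (exp (- t)) 0 k * exp (c / t) \<le> gap_gf (exp (- t)) 0 k * (\<zeta> * \<zeta> ^ j)"
        using elim by (intro mult_left_mono gap_gf_nonneg) auto
      also have "\<dots> = \<zeta> * (gap_gf (exp (- t)) 0 k * \<zeta> ^ j)" by simp
      also have "\<dots> \<le> \<zeta> * gap_total_real t"
        using pow[of k j] gap_gf_le_total[OF elim, of m] \<zeta> by (intro mult_left_mono) (auto simp: j)
      finally show "gap_gf (exp (- t)) 0 k \<le> \<zeta> * exp (- (c / t)) * gap_total_real t"
        by (simp add: exp_minus field_simps)
    qed
  qed
  moreover have "0 < \<zeta>" using \<zeta> by simp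
  ultimately show ?thesis using c that by blast
qed

lemma gap_gf_concentration:
  assumes \<epsilon>: "0 < \<epsilon>" "\<epsilon> < part_density"
  obtains c C where "0 < c" "0 < C" "\<forall>\<^sub>F t in at_right 0. \<forall>k. \<epsilon> \<le> \<bar>real k * t - part_density\<bar> \<longrightarrow>
    gap_gf (exp (- t)) 0 k \<le> C * exp (- (c / t)) * gap_total_real t"
proof -
  obtain c1 where c1: "0 < c1" "\<forall>\<^sub>F t in at_right 0. \<forall>k. part_density + \<epsilon> \<le> real k * t \<longrightarrow>
    gap_gf (exp (- t)) 0 k \<le> exp (- (c1 / t)) * gap_total_real t"
    using gap_gf_upper_tail[OF \<epsilon>(1)] .
  obtain c2 C2 where c2: "0 < c2" "0 < C2" "\<forall>\<^sub>F t in at_right 0. \<forall>k. real k * t \<le> part_density - \<epsilon> \<longrightarrow>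
    gap_gf (exp (- t)) 0 k \<le> C2 * exp (- (c2 / t)) * gap_total_real t"
    using gap_gf_lower_tail[OF \<epsilon>] .
  define c where "c = min c1 c2"
  define C where "C = max 1 C2"
  have "\<forall>\<^sub>F t in at_right 0. \<forall>k. \<epsilon> \<le> \<bar>real k * t - part_density\<bar> \<longrightarrow>
    gap_gf (exp (- t)) 0 k \<le> C * exp (- (c / t)) * gap_total_real t"
    using c1(2) c2(3) eventually_at_right_less[of 0]
  proof eventually_elim
    case (elim t)
    have F: "0 < gap_total_real t" by (rule gap_total_real_pos) (use elim in simp)
    have le: "D * exp (- (d / t)) * gap_total_real t \<le> C * exp (- (c / t)) * gap_total_real t"
      if "D \<le> C" "c \<le> d" "0 \<le> D" for D d
    proof -
      have "exp (- (d / t)) \<le> exp (- (c / t))" using that elim(3) by (simp add: divide_right_mono)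
      then show ?thesis using that F by (intro mult_right_mono mult_mono) auto
    qed
    show ?case
    proof (intro allI impI)
      fix k assume "\<epsilon> \<le> \<bar>real k * t - part_density\<bar>"
      then consider "part_density + \<epsilon> \<le> real k * t" | "real k * t \<le> part_density - \<epsilon>" by linarith
      then show "gap_gf (exp (- t)) 0 k \<le> C * exp (- (c / t)) * gap_total_real t"
      proof cases
        case 1
        then show ?thesis using elim(1) le[of 1 c1] by (force simp: C_def c_def)
      next
        case 2
        then show ?thesis using elim(2) le[of C2 c2] c2(2) by (force simp: C_def c_def)
      qed
    qed
  qed
  moreover have "0 < c" "0 < C" using c1 c2 by (auto simp: c_def C_def)
  ultimately show ?thesis using that by blast
qed

section \<open>From weights to the mean number of parts at a fixed size\<close>

lemma saddle_at_right: "filterlim saddle (at_right 0) sequentially"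
proof -
  have "\<forall>\<^sub>F n in sequentially. saddle n \<in> {0<..} \<and> saddle n \<noteq> 0"
    using eventually_gt_at_top[of 0]
  proof eventually_elim
    case (elim n)
    then show ?case using saddle_pos[of n] by simp
  qed
  then show ?thesis using saddle_tendsto by (simp add: filterlim_at)
qed

lemma length_gap_le:
  assumes "xs \<in> gap_partitions n"
  shows "length xs \<le> n"
proof -
  have "length ys \<le> sum_list ys" if "\<forall>y\<in>set ys. 0 < y" for ys :: "nat list"
    using that by (induction ys) auto
  then show ?thesis using assms by (auto simp: gap_partitions_eq)
qed

text \<open>A typical partition deviates by less than \<epsilon>, any other by at most n t +
  \<open>part_density\<close>. The untypical ones are grouped by length: there are at most n + 1
  lengths, and each group, weighted by exp(-t)^n, is at most B.\<close>

lemma sum_length_deviation: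
  fixes t \<epsilon> B :: real
  assumes t: "0 < t" and B: "\<And>k. \<epsilon> \<le> \<bar>real k * t - part_density\<bar> \<Longrightarrow> gap_gf (exp (- t)) 0 k \<le> B" and B0: "0 \<le> B" and \<epsilon>: "0 \<le> \<epsilon>"
  shows "\<bar>t * real (g1 1 n) - part_density * real (card (gap_partitions n))\<bar> * exp (- t) ^ n \<le>
    \<epsilon> * real (card (gap_partitions n)) * exp (- t) ^ n + (real n * t + part_density) * (real (Suc n) * B)"
proof -
  let ?G = "gap_partitions n"
  let ?d = "\<lambda>xs. \<bar>real (length xs) * t - part_density\<bar>"
  let ?far = "{xs \<in> ?G. \<epsilon> \<le> ?d xs}"
  let ?K = "{k \<in> {..n}. \<epsilon> \<le> \<bar>real k * t - part_density\<bar>}"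
  have fin: "finite ?G" by (rule finite_gap_partitions)
  have "t * real (g1 1 n) - part_density * real (card ?G) = (\<Sum>xs\<in>?G. real (length xs) * t - part_density)"
    unfolding g1_1_eq by (simp add: sum_subtractf sum_distrib_left mult.commute)
  then have "\<bar>t * real (g1 1 n) - part_density * real (card ?G)\<bar> \<le> (\<Sum>xs\<in>?G. ?d xs)" by simp
  also have "\<dots> \<le> (\<Sum>xs\<in>?G. \<epsilon> + (if \<epsilon> \<le> ?d xs then real n * t + part_density else 0))"
  proof (rule sum_mono)
    fix xs assume xs: "xs \<in> ?G"
    have "real (length xs) * t \<le> real n * t" using length_gap_le[OF xs] t by (intro mult_right_mono) auto
    moreover have "0 \<le> real (length xs) * t" using t by simp
    ultimately have "?d xs \<le> real n * t + part_density" using part_density_pos by linarith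
    then show "?d xs \<le> \<epsilon> + (if \<epsilon> \<le> ?d xs then real n * t + part_density else 0)" using \<epsilon> by simp
  qed
  also have "\<dots> = \<epsilon> * real (card ?G) + (real n * t + part_density) * real (card ?far)"
    using fin by (simp add: sum.distrib sum.If_cases Int_def mult.commute)
  finally have 1: "\<bar>t * real (g1 1 n) - part_density * real (card ?G)\<bar> \<le>
      \<epsilon> * real (card ?G) + (real n * t + part_density) * real (card ?far)" .
  have "?far \<subseteq> (\<Union>k\<in>?K. {xs \<in> ?G. length xs = k})"
    using length_gap_le by auto
  then have "card ?far \<le> card (\<Union>k\<in>?K. {xs \<in> ?G. length xs = k})"
    using fin by (intro card_mono) auto
  also have "\<dots> \<le> (\<Sum>k\<in>?K. card {xs \<in> ?G. length xs = k})" by (intro card_UN_le) auto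
  finally have "real (card ?far) \<le> (\<Sum>k\<in>?K. real (card {xs \<in> ?G. length xs = k}))"
    by (simp only: of_nat_sum[symmetric] of_nat_le_iff)
  then have "real (card ?far) * exp (- t) ^ n \<le> (\<Sum>k\<in>?K. real (card {xs \<in> ?G. length xs = k})) * exp (- t) ^ n"
    by (intro mult_right_mono) auto
  also have "\<dots> = (\<Sum>k\<in>?K. real (card {xs \<in> ?G. length xs = k}) * exp (- t) ^ n)"
    by (rule sum_distrib_right)
  also have "\<dots> \<le> (\<Sum>k\<in>?K. B)"
  proof (rule sum_mono)
    fix k assume "k \<in> ?K"
    then have "gap_gf (exp (- t)) 0 k \<le> B" by (intro B) simp
    then show "real (card {xs \<in> ?G. length xs = k}) * exp (- t) ^ n \<le> B"
      using card_gap_partitions_length_le[of "exp (- t)" n k] t by simp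
  qed
  also have "\<dots> \<le> real (Suc n) * B"
  proof -
    have "card ?K \<le> card {..n}" by (intro card_mono) auto
    then have "real (card ?K) \<le> real (Suc n)" by simp
    then show ?thesis using B0 by (simp add: mult_right_mono del: of_nat_Suc)
  qed
  finally have 2: "real (card ?far) * exp (- t) ^ n \<le> real (Suc n) * B" .
  have "\<bar>t * real (g1 1 n) - part_density * real (card ?G)\<bar> * exp (- t) ^ n \<le>
      (\<epsilon> * real (card ?G) + (real n * t + part_density) * real (card ?far)) * exp (- t) ^ n"
    using 1 by (intro mult_right_mono) auto
  also have "\<dots> = \<epsilon> * real (card ?G) * exp (- t) ^ n + (real n * t + part_density) * (real (card ?far) * exp (- t) ^ n)"
    by (simp add: algebra_simps)
  also have "\<dots> \<le> \<epsilon> * real (card ?G) * exp (- t) ^ n + (real n * t + part_density) * (real (Suc n) * B)"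
    using 2 t part_density_pos by (intro add_left_mono mult_left_mono) auto
  finally show ?thesis .
qed

lemma mean_length_asymp:
  "(\<lambda>n. saddle n * real (g1 1 n) / real (card (gap_partitions n))) \<longlonglongrightarrow> part_density"
proof (rule tendstoI)
  fix e :: real assume e: "0 < e"
  define \<epsilon> where "\<epsilon> = min (e / 2) (part_density / 2)"
  have \<epsilon>: "0 < \<epsilon>" "\<epsilon> < part_density" "\<epsilon> \<le> e / 2" using e part_density_pos by (auto simp: \<epsilon>_def min_def)
  obtain c C where c: "0 < c" "0 < C" and ev: "\<forall>\<^sub>F t in at_right 0. \<forall>k. \<epsilon> \<le> \<bar>real k * t - part_density\<bar> \<longrightarrow>
    gap_gf (exp (- t)) 0 k \<le> C * exp (- (c / t)) * gap_total_real t"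
    using gap_gf_concentration[OF \<epsilon>(1,2)] .
  define L where "L n = real (card (gap_partitions n)) * exp (- saddle n) ^ n / (gap_total_real (saddle n) * (saddle n * sqrt (saddle n)))" for n
  \<comment> \<open>This is the contribution of untypical lengths divided by F(exp(-t)) t^(3/2), the
    order of the weight of size n. At the saddle it is a power of n times exp(-c' sqrt n), whereas
    \<open>L n\<close> has a positive limit.\<close>
  define E where "E n = (real n * saddle n + part_density) * (real (Suc n) * (C * exp (- (c / saddle n)))) / (saddle n * sqrt (saddle n))" for n
  have L: "L \<longlonglongrightarrow> 2 / (pi * sqrt pi)" unfolding L_def by (rule card_gap_partitions_local_limit)
  have "E \<longlonglongrightarrow> 0"
    unfolding E_def saddle_def using c(1) part_density_pos by real_asymp
  then have "(\<lambda>n. E n / L n) \<longlonglongrightarrow> 0 / (2 / (pi * sqrt pi))" by (intro tendsto_divide L) auto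
  then have "\<forall>\<^sub>F n in sequentially. E n / L n < e / 2" using e by (intro order_tendstoD) auto
  moreover have "\<forall>\<^sub>F n in sequentially. 0 < L n" using L by (rule order_tendstoD) simp
  moreover have "\<forall>\<^sub>F n in sequentially. \<forall>k. \<epsilon> \<le> \<bar>real k * saddle n - part_density\<bar> \<longrightarrow>
    gap_gf (exp (- saddle n)) 0 k \<le> C * exp (- (c / saddle n)) * gap_total_real (saddle n)"
    using filterlim_iff[THEN iffD1, OF saddle_at_right] ev by blast
  ultimately show "\<forall>\<^sub>F n in sequentially. dist (saddle n * real (g1 1 n) / real (card (gap_partitions n))) part_density < e"
    using eventually_gt_at_top[of 0]
  proof eventually_elim
    case (elim n)
    define t where "t = saddle n"
    define p where "p = real (card (gap_partitions n))"
    define F where "F = gap_total_real t"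
    define s where "s = t * sqrt t"
    have t: "0 < t" using saddle_pos elim(4) by (simp add: t_def)
    have s: "0 < s" using t by (simp add: s_def)
    have F: "0 < F" unfolding F_def by (rule gap_total_real_pos[OF t])
    have Ln: "L n = p * exp (- t) ^ n / (F * s)" by (simp add: L_def p_def F_def s_def t_def)
    have pe: "p * exp (- t) ^ n = L n * (F * s)" using F s by (simp add: Ln)
    have "p \<noteq> 0" using elim(2) unfolding Ln by fastforce
    then have p: "0 < p" by (simp add: p_def)
    have En: "(real n * t + part_density) * (real (Suc n) * (C * exp (- (c / t)) * F)) = E n * (F * s)"
      using s unfolding E_def t_def[symmetric] s_def[symmetric] by simp
    have "\<bar>t * real (g1 1 n) - part_density * p\<bar> * exp (- t) ^ n \<le>
      \<epsilon> * p * exp (- t) ^ n + (real n * t + part_density) * (real (Suc n) * (C * exp (- (c / t)) * F))"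
      unfolding p_def F_def using elim(3) c \<epsilon> t F
      by (intro sum_length_deviation) (auto simp: t_def F_def intro!: mult_nonneg_nonneg)
    also have "\<dots> = \<epsilon> * (p * exp (- t) ^ n) + E n / L n * (p * exp (- t) ^ n)"
      unfolding En mult.assoc[of \<epsilon> p] pe using elim(2) by simp
    also have "\<dots> < e * (p * exp (- t) ^ n)"
    proof -
      have "\<epsilon> + E n / L n < e" using elim(1) \<epsilon> by linarith
      then have "(\<epsilon> + E n / L n) * (p * exp (- t) ^ n) < e * (p * exp (- t) ^ n)"
        using p by (intro mult_strict_right_mono) auto
      then show ?thesis by (simp only: distrib_right)
    qed
    finally have "\<bar>t * real (g1 1 n) - part_density * p\<bar> * exp (- t) ^ n < (e * p) * exp (- t) ^ n"
      by (simp only: mult.assoc)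
    then have "\<bar>t * real (g1 1 n) - part_density * p\<bar> < e * p"
      by (simp add: mult_less_cancel_right)
    moreover have "t * real (g1 1 n) / p - part_density = (t * real (g1 1 n) - part_density * p) / p"
      using p by (simp add: field_simps)
    ultimately have "\<bar>t * real (g1 1 n) / p - part_density\<bar> < e"
      using p by (simp add: abs_divide field_simps)
    then show ?case by (simp add: dist_real_def t_def p_def)
  qed
qed

text \<open>In the product of the three limits everything cancels but sqrt t = sqrt pi / (2 n^(1/4))
  and the exponents n t and pi^2/(16t), each of which is (pi/4) sqrt n. The factor 2^(5/4) combines
  2^(1/4) from exp(-(ln 2)/4) with the 2 in \<open>part_density\<close>.\<close>

lemma g1_1_asymp:
  "(\<lambda>n. real (g1 1 n)) \<sim>[sequentially]
    (\<lambda>n. ln (sqrt 2 + 1) / (2 powr (5 / 4) * pi) * real n powr (- (1 / 4)) * exp (pi / 2 * sqrt (real n)))"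
proof (rule asymp_equivI')
  let ?T = "\<lambda>n. ln (sqrt 2 + 1) / (2 powr (5 / 4) * pi) * real n powr (- (1 / 4)) * exp (pi / 2 * sqrt (real n))"
  let ?p = "\<lambda>n. real (card (gap_partitions n))"
  let ?s = "\<lambda>n. saddle n * sqrt (saddle n)"
  let ?F = "\<lambda>n. gap_total_real (saddle n)"
  let ?L = "\<lambda>n. ?p n * exp (- saddle n) ^ n / (?F n * ?s n)"
  have "(\<lambda>n. saddle n * real (g1 1 n) / ?p n * ?L n * (?F n * exp (- (pi ^ 2 / 16 / saddle n)))) \<longlonglongrightarrow>
      part_density * (2 / (pi * sqrt pi)) * exp (- (ln 2 / 4))"
    by (intro tendsto_mult mean_length_asymp card_gap_partitions_local_limit gap_total_real_asymp)
  then have "(\<lambda>n. (saddle n * real (g1 1 n) / ?p n * ?L n * (?F n * exp (- (pi ^ 2 / 16 / saddle n)))) /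
      (part_density * (2 / (pi * sqrt pi)) * exp (- (ln 2 / 4)))) \<longlonglongrightarrow>
      (part_density * (2 / (pi * sqrt pi)) * exp (- (ln 2 / 4))) / (part_density * (2 / (pi * sqrt pi)) * exp (- (ln 2 / 4)))"
    using part_density_pos by (intro tendsto_divide tendsto_const) auto
  then have lim: "(\<lambda>n. (saddle n * real (g1 1 n) / ?p n * ?L n * (?F n * exp (- (pi ^ 2 / 16 / saddle n)))) /
      (part_density * (2 / (pi * sqrt pi)) * exp (- (ln 2 / 4)))) \<longlonglongrightarrow> 1"
    using part_density_pos by simp
  have "\<forall>\<^sub>F n in sequentially. 0 < ?L n"
    using card_gap_partitions_local_limit by (rule order_tendstoD) simp
  then have "\<forall>\<^sub>F n in sequentially. (saddle n * real (g1 1 n) / ?p n * ?L n * (?F n * exp (- (pi ^ 2 / 16 / saddle n)))) /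
      (part_density * (2 / (pi * sqrt pi)) * exp (- (ln 2 / 4))) = real (g1 1 n) / ?T n"
    using eventually_gt_at_top[of 0]
  proof eventually_elim
    case (elim n)
    define t where "t = saddle n"
    have t: "0 < t" using saddle_pos elim(2) by (simp add: t_def)
    have F: "0 < gap_total_real t" by (rule gap_total_real_pos[OF t])
    have p: "?p n \<noteq> 0"
    proof
      assume 0: "?p n = 0"
      show False using elim(1) unfolding 0 by simp
    qed
    have "saddle n * real (g1 1 n) / ?p n * ?L n * (?F n * exp (- (pi ^ 2 / 16 / saddle n))) =
      real (g1 1 n) / sqrt t * (exp (- t) ^ n * exp (- (pi ^ 2 / 16 / t)))"
      using t F p unfolding t_def[symmetric] by simp
    also have "exp (- t) ^ n * exp (- (pi ^ 2 / 16 / t)) = exp (- (real n * t) - pi ^ 2 / 16 / t)"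
      by (simp add: exp_of_nat_mult[symmetric] mult_exp_exp)
    also have "- (real n * t) - pi ^ 2 / 16 / t = - (pi / 2 * sqrt (real n))"
    proof -
      have "a * a * (pi / (4 * a)) = pi / 4 * a" if "0 < a" for a :: real
        using that by (simp add: field_simps)
      from this[of "sqrt (real n)"] have "real n * t = pi / 4 * sqrt (real n)"
        unfolding t_def saddle_def using elim(2) by simp
      moreover have "pi ^ 2 / 16 / t = pi / 4 * sqrt (real n)"
        unfolding t_def saddle_def by (simp add: power2_eq_square)
      ultimately show ?thesis by simp
    qed
    finally have 1: "saddle n * real (g1 1 n) / ?p n * ?L n * (?F n * exp (- (pi ^ 2 / 16 / saddle n))) =
      real (g1 1 n) / sqrt t * exp (- (pi / 2 * sqrt (real n)))" .
    define N where "N = real n powr (1 / 4)"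
    define W where "W = (2 :: real) powr (1 / 4)"
    define X where "X = exp (pi / 2 * sqrt (real n))"
    have pos: "0 < N" "0 < W" "0 < X" using elim(2) by (simp_all add: N_def W_def X_def)
    have "sqrt (sqrt (real n)) = N"
      unfolding N_def using elim(2) by (simp add: powr_half_sqrt[symmetric] powr_powr)
    then have 2: "sqrt t = sqrt pi / (2 * N)"
      by (simp add: t_def saddle_def real_sqrt_divide real_sqrt_mult)
    have 3: "exp (- (ln 2 / 4)) = 1 / W" by (simp add: W_def powr_def exp_minus inverse_eq_divide)
    have "2 powr (5 / 4) = 2 powr 1 * W" unfolding W_def powr_add[symmetric] by simp
    then have 4: "2 powr (5 / 4) = 2 * W" by simp
    have 5: "real n powr (- (1 / 4)) = 1 / N" by (simp add: N_def powr_minus_divide)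
    have 6: "exp (- (pi / 2 * sqrt (real n))) = 1 / X" by (simp add: X_def exp_minus inverse_eq_divide)
    have 7: "ln (sqrt 2 + 1) = 2 * part_density" by (simp add: part_density_def add.commute)
    show ?case
      unfolding 1 2 3 4 5 6 7 X_def[symmetric] using pos part_density_pos by (simp add: field_simps)
  qed
  from Lim_transform_eventually[OF lim this]
  show "(\<lambda>n. real (g1 1 n) / ?T n) \<longlonglongrightarrow> 1" .
qed


theorem theorem1p6:
  shows "(\<lambda>n. real (g1 1 n)) \<sim>[sequentially] (\<lambda>n. real (g1 2 n)) \<and>
    (\<lambda>n. real (g1 2 n)) \<sim>[sequentially]
      (\<lambda>n. ln (sqrt 2 + 1) / (2 powr (5 / 4) * pi) * real n powr (- (1 / 4))
             * exp (pi / 2 * sqrt (real n)))"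
proof -
  let ?p = "\<lambda>n. real (card (gap_partitions n))"
  let ?M = "\<lambda>n. saddle n * real (g1 1 n) / ?p n"
  \<comment> \<open>The quotient is \<open>?p n / g1 1 n\<close>, the reciprocal of the mean number
    of parts. It tends to 0, so an error of at most one hook per partition is negligible.\<close>
  have "(\<lambda>n. saddle n / ?M n) \<longlonglongrightarrow> 0 / part_density"
    using part_density_pos by (intro tendsto_divide saddle_tendsto mean_length_asymp) auto
  then have lim: "(\<lambda>n. 1 - saddle n / ?M n) \<longlonglongrightarrow> 1"
    using tendsto_diff[OF tendsto_const[of "1::real"], of "\<lambda>n. saddle n / ?M n" 0 sequentially] by simp
  have ev: "\<forall>\<^sub>F n in sequentially. 0 < ?M n"
    using mean_length_asymp part_density_pos by (rule order_tendstoD)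
  have g12: "(\<lambda>n. real (g1 2 n)) \<sim>[sequentially] (\<lambda>n. real (g1 1 n))"
  proof (rule asymp_equivI', rule tendsto_sandwich[OF _ _ lim tendsto_const])
    show "\<forall>\<^sub>F n in sequentially. 1 - saddle n / ?M n \<le> real (g1 2 n) / real (g1 1 n)"
      using ev eventually_gt_at_top[of 0]
    proof eventually_elim
      case (elim n)
      have s: "0 < saddle n" by (rule saddle_pos[OF elim(2)])
      have "real (g1 1 n) \<noteq> 0" "?p n \<noteq> 0" using elim(1) by fastforce+
      then have pos: "0 < real (g1 1 n)" by simp
      have "real (g1 1 n) \<le> real (g1 2 n) + ?p n"
        using g1_2_bounds(2)[of n] by (simp only: of_nat_add[symmetric] of_nat_le_iff)
      then have "(real (g1 1 n) - ?p n) / real (g1 1 n) \<le> real (g1 2 n) / real (g1 1 n)"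
        using pos by (intro divide_right_mono) auto
      moreover have "(real (g1 1 n) - ?p n) / real (g1 1 n) = 1 - saddle n / ?M n"
        using s pos by (simp add: diff_divide_distrib)
      ultimately show ?case by simp
    qed
    show "\<forall>\<^sub>F n in sequentially. real (g1 2 n) / real (g1 1 n) \<le> 1"
      using g1_2_bounds(1) by (auto intro!: always_eventually simp: divide_le_eq_1)
  qed
  show ?thesis
    using asymp_equiv_symI[OF g12] asymp_equiv_trans[OF g12 g1_1_asymp] by blast
qed

end
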